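(* Suppose that the common null sets condition, the smoothness and moment condition, the non-degenerate modified score condition, and the dense non-critical points condition (all stated in the context) hold. Then for any $n\ge 1$ there is a set $\mathcal{Y}^n$ of full measure such that $T_n(\cdot;\cdot)$, which is defined by $T_n(\theta;y^n)=s_n(\theta;y^n)^{\mathsf T}\mathcal{I}_n(\theta)^{-1}s_n(\theta;y^n)$ at non-critical $\theta$, has a continuous extension on $\Theta\times\mathcal{Y}^n$ (jointly in $(\theta,y^n)$), and that extension is $$T_n(\theta;y^n)=\tilde{s}_n(\theta;y^n)^{\mathsf T}\,\tilde{\mathcal{I}}_n(\theta)^{-1}\,\tilde{s}_n(\theta;y^n),$$ where $\tilde s_n$ and $\tilde{\mathcal I}_n$ are formed with orders $k_j$ and eigenvectors $v^n_{\theta j}$ as in the non-degenerate modified score condition.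
   Context: Setting. Let $d\ge1$ and $\Theta\subseteq\mathbb{R}^d$. For $i=1,2,\dots$, the random vectors $Y_i\in\mathbb{R}^{r_i}$ ($r_i\ge1$) are independent and, when the parameter is $\theta\in\Theta$, $Y_i$ has density $f^i_\theta$ (also written $f_\theta(y_i)$) with respect to a dominating measure $\gamma_i$. Write $Y^n=(Y_1,\dots,Y_n)$, with realization $y^n=(y_1,\dots,y_n)$. A subscript $\theta$ on $\mathsf P,\mathbb{E},\operatorname{var},\operatorname{cov}$ means the data have the distribution indexed by $\theta$. Let $\nabla$ be the gradient with respect to $\theta$, $\nabla_j^l$ the $l$th order partial derivative with respect to $\theta_j$, and $\ell^i(\theta;y_i)=\log f_\theta(y_i)$, $\ell_n(\theta;y^n)=\sum_{i=1}^n\ell^i(\theta;y_i)$, $s^i=\nabla\ell^i$, $s_n=\nabla\ell_n$, $\mathcal{I}^i(\theta)=\operatorname{cov}_\theta\{s^i(\theta;Y_i)\}$, $\mathcal{I}_n(\theta)=\operatorname{cov}_\theta\{s_n(\theta;Y^n)\}$. A point $\theta\in\Theta$ is critical if $\mathcal{I}_n(\theta)$ is singular, and non-critical otherwise. "Almost every $y_i$" (or $y^n$) and "full measure" refer to the distribution $f_\theta(y_i)\gamma_i(\mathrm{d}y_i)$ (or the corresponding product measure) for any $\theta\in\Theta$. Common null sets condition: for every $i$, the distributions $f_\theta(y_i)\gamma_i(\mathrm{d}y_i)$, $\theta\in\Theta$, all have the same null sets. Smoothness and moment condition: for every $\theta'\in\Theta$ there is an open ball $B=B(\theta')\subseteq\mathbb{R}^d$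 centered at $\theta'$ on which, for every $i$ and almost every $y_i$, partial derivatives of $\theta\mapsto\ell^i(\theta;y_i)$ of an order $k=k(\theta')\ge2$ exist and are jointly continuous in $(\theta,y_i)$; moreover there is a $\delta=\delta(\theta')>0$ such that for all non-negative integers $l_1,\dots,l_d$ summing to $l\le k$, $$\sup_{i}\ \sup_{\theta\in B\cap\Theta,\ \tilde\theta\in B}\int\left|\frac{\partial^l}{\partial\theta_1^{l_1}\cdots\partial\theta_d^{l_d}}\ell^i(\theta;y_i)\Big|_{\theta=\tilde\theta}\right|^{2+\delta}f_\theta(y_i)\,\gamma_i(\mathrm{d}y_i)<\infty .$$ If $B\not\subseteq\Theta$ this means that extensions of the partial derivatives to $B\times\mathcal{Y}_i$, for some set $\mathcal{Y}_i$ of full measure, exist and satisfy these conditions. Modified score: given, for each $\theta\in\Theta$ and $n$, positive integers $k_j=k_j(\theta,n)$ and orthonormal eigenvectors $v^n_{\theta1},\dots,v^n_{\theta d}$ of $\mathcal{I}_n(\theta)$, let $\tilde s^i_n(\theta;y_i)\in\mathbb{R}^d$ have $j$th element $\{\nabla_j^{k_j-1}s^i(\theta;y_i)\}^{\mathsf T}v^n_{\theta j}$, and let $\tilde s_n(\theta;y^n)=\sum_{i=1}^n\tilde s_n^i(\theta;y_i)$, $\tilde{\mathcal I}_n(\theta)=\operatorname{cov}_\theta\{\tilde s_n(\theta;Y^n)\}$. Non-degenerate modified score condition: for every $\theta\in\Theta$ and $n=1,2,\dots$ there exist integers $k_j=k_j(\theta,n)\in\{1,2,\dots\}$ ($j=1,\dots,d$)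 and a set of orthonormal eigenvectors $\{v^n_{\theta1},\dots,v^n_{\theta d}\}$ of $\mathcal I_n(\theta)$ such that (i) $\tilde{\mathcal I}_n(\theta)$ is positive definite; (ii) $\{\nabla_j^l s_n(\tilde\theta;y^n)\}^{\mathsf T}v^n_{\theta j}=0$, $l=0,\dots,k_j-2$, for every $\tilde\theta$ with $\tilde\theta_j=\theta_j$ and almost every $y^n$; (iii) $k_j(\theta,n)$ is upper bounded by the $k=k(\theta)$ in the smoothness and moment condition for every $j,\theta,n$. Dense non-critical points condition: for every $\theta\in\Theta$ there is a sequence of non-critical points in $\Theta$ tending to $\theta$. *)

theory Defs
  imports "HOL-Probability.Probability"
begin

text \<open>
  The parameter space is \<open>real ^ 'd\<close>.  The dimension \<open>r i\<close> of the observation \<open>Y\<^sub>i\<close> varies with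
  \<open>i\<close>, so a vector in \<open>\<real>\<^sup>r\<close> is a function \<open>nat \<Rightarrow> real\<close> that is \<open>undefined\<close> outside \<open>{..<r}\<close>.  On these
  functions the product topology of \<open>nat \<Rightarrow> real\<close> is the Euclidean topology, and
  \<open>euclidean_borel r\<close> carries its Borel sigma-algebra.  A realization of \<open>Y\<^sup>n\<close> is a function on
  \<open>{1..n}\<close>, again with the product topology.
\<close>

type_synonym obs = "nat \<Rightarrow> real"

definition euclidean_borel :: "nat \<Rightarrow> obs measure" where
  "euclidean_borel r = (\<Pi>\<^sub>M j\<in>{..<r}. borel)"

definition density_model ::
  "(real ^ 'd) set \<Rightarrow> (nat \<Rightarrow> nat) \<Rightarrow> (nat \<Rightarrow> obs measure) \<Rightarrow>
   (nat \<Rightarrow> real ^ 'd \<Rightarrow> obs \<Rightarrow> real) \<Rightarrow> bool" where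
  "density_model \<Theta> r \<gamma> f \<longleftrightarrow>
     (\<forall>i\<ge>1. 1 \<le> r i \<and> sets (\<gamma> i) = sets (euclidean_borel (r i)) \<and>
        (\<forall>\<theta>\<in>\<Theta>. f i \<theta> \<in> borel_measurable (\<gamma> i) \<and> (\<forall>y\<in>space (\<gamma> i). 0 \<le> f i \<theta> y) \<and>
               (\<integral>\<^sup>+ y. ennreal (f i \<theta> y) \<partial>\<gamma> i) = 1))"

text \<open>The distribution of \<open>Y\<^sub>i\<close> and, by independence, of \<open>Y\<^sup>n\<close>, under \<open>\<theta>\<close>.\<close>

definition law ::
  "(nat \<Rightarrow> obs measure) \<Rightarrow> (nat \<Rightarrow> real ^ 'd \<Rightarrow> obs \<Rightarrow> real) \<Rightarrow> nat \<Rightarrow> real ^ 'd \<Rightarrow> obs measure" where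
  "law \<gamma> f i \<theta> = density (\<gamma> i) (\<lambda>y. ennreal (f i \<theta> y))"

definition joint_law ::
  "(nat \<Rightarrow> obs measure) \<Rightarrow> (nat \<Rightarrow> real ^ 'd \<Rightarrow> obs \<Rightarrow> real) \<Rightarrow> nat \<Rightarrow> real ^ 'd \<Rightarrow>
   (nat \<Rightarrow> obs) measure" where
  "joint_law \<gamma> f n \<theta> = (\<Pi>\<^sub>M i\<in>{1..n}. law \<gamma> f i \<theta>)"

definition full_measure :: "'p set \<Rightarrow> ('p \<Rightarrow> 'y measure) \<Rightarrow> 'y set \<Rightarrow> bool" where
  "full_measure \<Theta> P A \<longleftrightarrow> (\<forall>\<theta>\<in>\<Theta>. A \<in> sets (P \<theta>) \<and> (AE y in P \<theta>. y \<in> A))"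

definition common_null_sets ::
  "(real ^ 'd) set \<Rightarrow> (nat \<Rightarrow> obs measure) \<Rightarrow> (nat \<Rightarrow> real ^ 'd \<Rightarrow> obs \<Rightarrow> real) \<Rightarrow> bool" where
  "common_null_sets \<Theta> \<gamma> f \<longleftrightarrow>
     (\<forall>i\<ge>1. \<forall>\<theta>\<in>\<Theta>. \<forall>\<theta>'\<in>\<Theta>. null_sets (law \<gamma> f i \<theta>) = null_sets (law \<gamma> f i \<theta>'))"

text \<open>
  The derivatives in the score exist only almost everywhere in \<open>y\<close> and are arbitrary, possibly
  non-measurable, on the exceptional null set.  Integrating over the completion makes the
  covariance independent of these values.
\<close>

definition cov_matrix :: "'y measure \<Rightarrow> ('y \<Rightarrow> real ^ 'd) \<Rightarrow> real ^ 'd ^ 'd" where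
  "cov_matrix M X =
     (\<chi> a b. LINT y|completion M.
        (X y $ a - (LINT z|completion M. X z $ a)) * (X y $ b - (LINT z|completion M. X z $ b)))"

definition pos_definite :: "real ^ 'd ^ 'd \<Rightarrow> bool" where
  "pos_definite A \<longleftrightarrow> transpose A = A \<and> (\<forall>x. x \<noteq> 0 \<longrightarrow> 0 < x \<bullet> (A *v x))"

definition orthonormal_eigenvectors :: "real ^ 'd ^ 'd \<Rightarrow> ('d \<Rightarrow> real ^ 'd) \<Rightarrow> bool" where
  "orthonormal_eigenvectors A v \<longleftrightarrow>
     (\<forall>j l. v j \<bullet> v l = (if j = l then 1 else 0)) \<and> (\<forall>j. \<exists>c. A *v v j = c *\<^sub>R v j)"

definition partial :: "'d \<Rightarrow> (real ^ 'd \<Rightarrow> 'b::real_normed_vector) \<Rightarrow> real ^ 'd \<Rightarrow> 'b" where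
  "partial j g \<theta> = vector_derivative (\<lambda>t. g (\<theta> + t *\<^sub>R axis j 1)) (at 0)"

definition partial_exists :: "'d \<Rightarrow> (real ^ 'd \<Rightarrow> 'b::real_normed_vector) \<Rightarrow> real ^ 'd \<Rightarrow> bool" where
  "partial_exists j g \<theta> \<longleftrightarrow> (\<lambda>t. g (\<theta> + t *\<^sub>R axis j 1)) differentiable (at 0)"

text \<open>
  Mixed partial derivatives, indexed by the list of differentiation directions.  The derivatives
  of order \<open>l\<close> are those given by lists of length \<open>l\<close>; under the continuity required below the order
  of differentiation is irrelevant, so they are the derivatives
  \<open>\<partial>\<^sup>l / \<partial>\<theta>\<^sub>1\<^sup>l\<^sup>1 \<dots> \<partial>\<theta>\<^sub>d\<^sup>l\<^sup>d\<close>.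
\<close>

definition partials :: "'d list \<Rightarrow> (real ^ 'd \<Rightarrow> real) \<Rightarrow> real ^ 'd \<Rightarrow> real" where
  "partials js g = foldr partial js g"

definition grad :: "(real ^ 'd \<Rightarrow> real) \<Rightarrow> real ^ 'd \<Rightarrow> real ^ 'd" where
  "grad g \<theta> = (\<chi> m. partial m g \<theta>)"

text \<open>
  In the following, \<open>ell i \<theta> y\<close> is the log-density of \<open>Y\<^sub>i\<close>, extended in \<open>\<theta>\<close> beyond \<open>\<Theta>\<close>.  If \<open>\<Theta>\<close>
  contains the balls below, it is just \<open>ln (f i \<theta> y)\<close>, for almost every \<open>y\<close>; otherwise it is the
  extension whose partial derivatives extend those of the log-density.
\<close>

definition loglik :: "(nat \<Rightarrow> real ^ 'd \<Rightarrow> obs \<Rightarrow> real) \<Rightarrow> nat \<Rightarrow> real ^ 'd \<Rightarrow> (nat \<Rightarrow> obs) \<Rightarrow> real" where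
  "loglik ell n \<theta> y = (\<Sum>i=1..n. ell i \<theta> (y i))"

definition score_obs :: "(nat \<Rightarrow> real ^ 'd \<Rightarrow> obs \<Rightarrow> real) \<Rightarrow> nat \<Rightarrow> real ^ 'd \<Rightarrow> obs \<Rightarrow> real ^ 'd" where
  "score_obs ell i \<theta> y = grad (\<lambda>t. ell i t y) \<theta>"

definition score ::
  "(nat \<Rightarrow> real ^ 'd \<Rightarrow> obs \<Rightarrow> real) \<Rightarrow> nat \<Rightarrow> real ^ 'd \<Rightarrow> (nat \<Rightarrow> obs) \<Rightarrow> real ^ 'd" where
  "score ell n \<theta> y = grad (\<lambda>t. loglik ell n t y) \<theta>"

definition information ::
  "(nat \<Rightarrow> obs measure) \<Rightarrow> (nat \<Rightarrow> real ^ 'd \<Rightarrow> obs \<Rightarrow> real) \<Rightarrow> (nat \<Rightarrow> real ^ 'd \<Rightarrow> obs \<Rightarrow> real) \<Rightarrow>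
   nat \<Rightarrow> real ^ 'd \<Rightarrow> real ^ 'd ^ 'd" where
  "information \<gamma> f ell n \<theta> = cov_matrix (joint_law \<gamma> f n \<theta>) (score ell n \<theta>)"

definition critical ::
  "(nat \<Rightarrow> obs measure) \<Rightarrow> (nat \<Rightarrow> real ^ 'd \<Rightarrow> obs \<Rightarrow> real) \<Rightarrow> (nat \<Rightarrow> real ^ 'd \<Rightarrow> obs \<Rightarrow> real) \<Rightarrow>
   nat \<Rightarrow> real ^ 'd \<Rightarrow> bool" where
  "critical \<gamma> f ell n \<theta> \<longleftrightarrow> \<not> invertible (information \<gamma> f ell n \<theta>)"

definition score_stat ::
  "(nat \<Rightarrow> obs measure) \<Rightarrow> (nat \<Rightarrow> real ^ 'd \<Rightarrow> obs \<Rightarrow> real) \<Rightarrow> (nat \<Rightarrow> real ^ 'd \<Rightarrow> obs \<Rightarrow> real) \<Rightarrow>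
   nat \<Rightarrow> real ^ 'd \<Rightarrow> (nat \<Rightarrow> obs) \<Rightarrow> real" where
  "score_stat \<gamma> f ell n \<theta> y =
     score ell n \<theta> y \<bullet> (matrix_inv (information \<gamma> f ell n \<theta>) *v score ell n \<theta> y)"

text \<open>
  The ball \<open>B(\<theta>')\<close> is \<open>ball \<theta>' (\<rho> \<theta>')\<close>.  The set \<open>\<Y>\<close> of full measure may depend on \<open>i\<close> and \<open>\<theta>'\<close>.
  Positivity of the density on \<open>\<Y>\<close> says that the log-density is finite there; in HOL,
  \<open>ln 0 = 0\<close>.
\<close>

definition smoothness_and_moments ::
  "(real ^ 'd) set \<Rightarrow> (nat \<Rightarrow> obs measure) \<Rightarrow> (nat \<Rightarrow> real ^ 'd \<Rightarrow> obs \<Rightarrow> real) \<Rightarrow>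
   (nat \<Rightarrow> real ^ 'd \<Rightarrow> obs \<Rightarrow> real) \<Rightarrow>
   (real ^ 'd \<Rightarrow> real) \<Rightarrow> (real ^ 'd \<Rightarrow> nat) \<Rightarrow> (real ^ 'd \<Rightarrow> real) \<Rightarrow> bool" where
  "smoothness_and_moments \<Theta> \<gamma> f ell \<rho> k \<delta> \<longleftrightarrow>
     (\<forall>\<theta>'\<in>\<Theta>. 0 < \<rho> \<theta>' \<and> 2 \<le> k \<theta>' \<and> 0 < \<delta> \<theta>' \<and>
       (\<forall>i\<ge>1. \<exists>\<Y>. full_measure \<Theta> (law \<gamma> f i) \<Y> \<and>
          (\<forall>\<theta>\<in>ball \<theta>' (\<rho> \<theta>') \<inter> \<Theta>. \<forall>y\<in>\<Y>. 0 < f i \<theta> y \<and> ell i \<theta> y = ln (f i \<theta> y)) \<and>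
          (\<forall>js j. length js < k \<theta>' \<longrightarrow>
             (\<forall>\<theta>\<in>ball \<theta>' (\<rho> \<theta>'). \<forall>y\<in>\<Y>. partial_exists j (partials js (\<lambda>t. ell i t y)) \<theta>)) \<and>
          (\<forall>js. 1 \<le> length js \<and> length js \<le> k \<theta>' \<longrightarrow>
             continuous_on (ball \<theta>' (\<rho> \<theta>') \<times> \<Y>) (\<lambda>(\<theta>, y). partials js (\<lambda>t. ell i t y) \<theta>))) \<and>
       (\<forall>js. length js \<le> k \<theta>' \<longrightarrow>
          (SUP i\<in>{1..}. SUP \<theta>\<in>ball \<theta>' (\<rho> \<theta>') \<inter> \<Theta>. SUP \<tau>\<in>ball \<theta>' (\<rho> \<theta>').
             \<integral>\<^sup>+ y. ennreal (\<bar>partials js (\<lambda>t. ell i t y) \<tau>\<bar> powr (2 + \<delta> \<theta>')) \<partial>law \<gamma> f i \<theta>) < \<infinity>))"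

text \<open>
  Below, \<open>kk \<theta> n j\<close> and \<open>v \<theta> n j\<close> are the order \<open>k\<^sub>j(\<theta>, n)\<close> and the eigenvector \<open>v\<^sup>n\<^sub>\<theta>\<^sub>j\<close>;
  \<open>partial j ^^ l\<close> is \<open>\<nabla>\<^sub>j\<^sup>l\<close>, acting elementwise on vectors.
\<close>

definition mod_score_obs ::
  "(nat \<Rightarrow> real ^ 'd \<Rightarrow> obs \<Rightarrow> real) \<Rightarrow> (real ^ 'd \<Rightarrow> nat \<Rightarrow> 'd \<Rightarrow> nat) \<Rightarrow>
   (real ^ 'd \<Rightarrow> nat \<Rightarrow> 'd \<Rightarrow> real ^ 'd) \<Rightarrow> nat \<Rightarrow> nat \<Rightarrow> real ^ 'd \<Rightarrow> obs \<Rightarrow> real ^ 'd" where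
  "mod_score_obs ell kk v n i \<theta> y =
     (\<chi> j. (partial j ^^ (kk \<theta> n j - 1)) (\<lambda>t. score_obs ell i t y) \<theta> \<bullet> v \<theta> n j)"

definition mod_score ::
  "(nat \<Rightarrow> real ^ 'd \<Rightarrow> obs \<Rightarrow> real) \<Rightarrow> (real ^ 'd \<Rightarrow> nat \<Rightarrow> 'd \<Rightarrow> nat) \<Rightarrow>
   (real ^ 'd \<Rightarrow> nat \<Rightarrow> 'd \<Rightarrow> real ^ 'd) \<Rightarrow> nat \<Rightarrow> real ^ 'd \<Rightarrow> (nat \<Rightarrow> obs) \<Rightarrow> real ^ 'd" where
  "mod_score ell kk v n \<theta> y = (\<Sum>i=1..n. mod_score_obs ell kk v n i \<theta> (y i))"

definition mod_information ::
  "(nat \<Rightarrow> obs measure) \<Rightarrow> (nat \<Rightarrow> real ^ 'd \<Rightarrow> obs \<Rightarrow> real) \<Rightarrow> (nat \<Rightarrow> real ^ 'd \<Rightarrow> obs \<Rightarrow> real) \<Rightarrow>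
   (real ^ 'd \<Rightarrow> nat \<Rightarrow> 'd \<Rightarrow> nat) \<Rightarrow> (real ^ 'd \<Rightarrow> nat \<Rightarrow> 'd \<Rightarrow> real ^ 'd) \<Rightarrow>
   nat \<Rightarrow> real ^ 'd \<Rightarrow> real ^ 'd ^ 'd" where
  "mod_information \<gamma> f ell kk v n \<theta> =
     cov_matrix (joint_law \<gamma> f n \<theta>) (mod_score ell kk v n \<theta>)"

definition mod_score_stat ::
  "(nat \<Rightarrow> obs measure) \<Rightarrow> (nat \<Rightarrow> real ^ 'd \<Rightarrow> obs \<Rightarrow> real) \<Rightarrow> (nat \<Rightarrow> real ^ 'd \<Rightarrow> obs \<Rightarrow> real) \<Rightarrow>
   (real ^ 'd \<Rightarrow> nat \<Rightarrow> 'd \<Rightarrow> nat) \<Rightarrow> (real ^ 'd \<Rightarrow> nat \<Rightarrow> 'd \<Rightarrow> real ^ 'd) \<Rightarrow>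
   nat \<Rightarrow> real ^ 'd \<Rightarrow> (nat \<Rightarrow> obs) \<Rightarrow> real" where
  "mod_score_stat \<gamma> f ell kk v n \<theta> y =
     mod_score ell kk v n \<theta> y \<bullet>
       (matrix_inv (mod_information \<gamma> f ell kk v n \<theta>) *v mod_score ell kk v n \<theta> y)"

text \<open>
  In the vanishing condition, \<open>\<tau>\<close> ranges over all points of \<open>B(\<theta>)\<close>, inside or outside \<open>\<Theta>\<close>, with the
  same \<open>j\<close>th coordinate as \<open>\<theta>\<close>: derivatives of the order needed are only known to exist on \<open>B(\<theta>)\<close>.
  The exceptional null set may depend on \<open>\<tau>\<close>.  The bound \<open>l + 2 \<le> kk \<theta> n j\<close> is
  \<open>l \<le> k\<^sub>j - 2\<close> without truncated subtraction.
\<close>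

definition nondegenerate_mod_score ::
  "(real ^ 'd) set \<Rightarrow> (nat \<Rightarrow> obs measure) \<Rightarrow> (nat \<Rightarrow> real ^ 'd \<Rightarrow> obs \<Rightarrow> real) \<Rightarrow>
   (nat \<Rightarrow> real ^ 'd \<Rightarrow> obs \<Rightarrow> real) \<Rightarrow> (real ^ 'd \<Rightarrow> real) \<Rightarrow> (real ^ 'd \<Rightarrow> nat) \<Rightarrow>
   (real ^ 'd \<Rightarrow> nat \<Rightarrow> 'd \<Rightarrow> nat) \<Rightarrow> (real ^ 'd \<Rightarrow> nat \<Rightarrow> 'd \<Rightarrow> real ^ 'd) \<Rightarrow> bool" where
  "nondegenerate_mod_score \<Theta> \<gamma> f ell \<rho> k kk v \<longleftrightarrow>
     (\<forall>\<theta>\<in>\<Theta>. \<forall>n\<ge>1.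
        (\<forall>j. 1 \<le> kk \<theta> n j) \<and>
        orthonormal_eigenvectors (information \<gamma> f ell n \<theta>) (v \<theta> n) \<and>
        pos_definite (mod_information \<gamma> f ell kk v n \<theta>) \<and>
        (\<forall>j l. l + 2 \<le> kk \<theta> n j \<longrightarrow>
           (\<forall>\<tau>\<in>ball \<theta> (\<rho> \<theta>). \<tau> $ j = \<theta> $ j \<longrightarrow>
              (\<forall>\<theta>'\<in>\<Theta>. AE y in joint_law \<gamma> f n \<theta>'.
                 (partial j ^^ l) (\<lambda>t. score ell n t y) \<tau> \<bullet> v \<theta> n j = 0))) \<and>
        (\<forall>j. kk \<theta> n j \<le> k \<theta>))"

definition dense_noncritical ::
  "(real ^ 'd) set \<Rightarrow> (nat \<Rightarrow> obs measure) \<Rightarrow> (nat \<Rightarrow> real ^ 'd \<Rightarrow> obs \<Rightarrow> real) \<Rightarrow>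
   (nat \<Rightarrow> real ^ 'd \<Rightarrow> obs \<Rightarrow> real) \<Rightarrow> bool" where
  "dense_noncritical \<Theta> \<gamma> f ell \<longleftrightarrow>
     (\<forall>n\<ge>1. \<forall>\<theta>\<in>\<Theta>. \<exists>x. (\<forall>m::nat. x m \<in> \<Theta> \<and> \<not> critical \<gamma> f ell n (x m)) \<and> x \<longlonglongrightarrow> \<theta>)"

definition continuous_extension ::
  "(real ^ 'd) set \<Rightarrow> (nat \<Rightarrow> obs measure) \<Rightarrow> (nat \<Rightarrow> real ^ 'd \<Rightarrow> obs \<Rightarrow> real) \<Rightarrow>
   (nat \<Rightarrow> real ^ 'd \<Rightarrow> obs \<Rightarrow> real) \<Rightarrow> nat \<Rightarrow> (nat \<Rightarrow> obs) set \<Rightarrow>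
   (real ^ 'd \<Rightarrow> (nat \<Rightarrow> obs) \<Rightarrow> real) \<Rightarrow> bool" where
  "continuous_extension \<Theta> \<gamma> f ell n \<Y> T \<longleftrightarrow>
     continuous_on (\<Theta> \<times> \<Y>) (\<lambda>(\<theta>, y). T \<theta> y) \<and>
     (\<forall>\<theta>\<in>\<Theta>. \<not> critical \<gamma> f ell n \<theta> \<longrightarrow> (\<forall>y\<in>\<Y>. T \<theta> y = score_stat \<gamma> f ell n \<theta> y))"

end

theory Submission
  imports Defs
begin

text \<open>
  Let \<open>\<theta>\<^sub>m \<rightarrow> \<theta>\<close> be non-critical points.  By Taylor's formula in the direction \<open>j\<close> and the vanishing
  condition, the component of the score at \<open>\<theta>\<^sub>m\<close> along the eigenvector \<open>v\<^sub>j\<close> is \<open>\<delta>\<^sub>j ^ (k\<^sub>j - 1) / (k\<^sub>j - 1)!\<close>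
  times the derivative of order \<open>k\<^sub>j - 1\<close> at a point near \<open>\<theta>\<close>, where \<open>\<delta>\<^sub>j\<close> is the \<open>j\<close>th coordinate of
  \<open>\<theta>\<^sub>m - \<theta>\<close>.  Since \<open>\<theta>\<^sub>m\<close> is non-critical, the factors do not vanish, and the quadratic form \<open>T\<^sub>n\<close> is
  invariant under the invertible linear map that removes them.  The rescaled score converges to the
  modified score; its covariance converges to the modified information because the densities
  converge and the moments of order \<open>2 + \<delta>\<close> are bounded uniformly.  The exceptional null sets are
  made independent of \<open>\<theta>\<close> by passing to the supports of the distributions: a continuous function that
  vanishes almost everywhere vanishes on the support.
\<close>

subsection \<open>Moments and derivatives\<close>

text \<open>The obstacle is that \<open>kk\<close> and \<open>v\<close> depend on the parameter
  without any continuity, so modified scores at neighbouring points cannot be compared with each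
  other. Orders and eigenvectors are therefore always those of the limit point, and only the
  original statistic is evaluated along the approximating sequence; continuity of the modified
  statistic is recovered at the end by a diagonal choice of non-critical points. The Taylor
  remainder sits at a point that depends on the data, perhaps not measurably, so it yields the
  pointwise limit but no moment bound; moments are bounded by integrating derivatives repeatedly
  along a coordinate line. The order 2 + \<delta> enters because covariances contain products, which
  then have moments of order 1 + \<delta>/2 > 1, as uniform integrability asks. The score is not
  taken to be centred, so means pass to the limit together with second moments. One set of data must
  serve all parameters although the regularity sets vary with the parameter; this is where
  separability of the parameter space is used.\<close>

lemma abs_sum_powr_le:
  fixes a :: "'i \<Rightarrow> real"
  assumes "finite I" "1 \<le> p"
  shows "\<bar>\<Sum>i\<in>I. a i\<bar> powr p \<le> real (card I) powr (p - 1) * (\<Sum>i\<in>I. \<bar>a i\<bar> powr p)"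
proof -
  \<comment> \<open>The zero terms are dropped so that the arguments of the convex power stay
    strictly positive.\<close>
  define J where "J = {i\<in>I. a i \<noteq> 0}"
  have J: "finite J" "J \<subseteq> I"
    using assms by (auto simp: J_def)
  have sumJ: "(\<Sum>i\<in>I. a i) = (\<Sum>i\<in>J. a i)"
    using assms by (intro sum.mono_neutral_right) (auto simp: J_def)
  show ?thesis
  proof (cases "J = {}")
    case True
    then show ?thesis
      using sumJ by (simp add: sum_nonneg)
  next
    case False
    define c where "c = real (card J)"
    have c: "0 < c" "c \<le> real (card I)"
      using False J assms by (auto simp: c_def card_gt_0_iff intro: card_mono)
    have "(\<Sum>i\<in>J. (1 / c) *\<^sub>R \<bar>a i\<bar>) powr p \<le> (\<Sum>i\<in>J. (1 / c) * \<bar>a i\<bar> powr p)"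
    proof (rule convex_on_sum[OF J(1) False powr_convex[OF assms(2)]])
      show "(\<Sum>i\<in>J. 1 / c) = 1"
        using c by (simp add: c_def)
    qed (use c in \<open>auto simp: J_def\<close>)
    then have "((\<Sum>i\<in>J. \<bar>a i\<bar>) / c) powr p \<le> (\<Sum>i\<in>J. \<bar>a i\<bar> powr p) / c"
      by (simp add: sum_divide_distrib)
    then have "(\<Sum>i\<in>J. \<bar>a i\<bar>) powr p \<le> c powr p * ((\<Sum>i\<in>J. \<bar>a i\<bar> powr p) / c)"
      using c by (simp add: powr_divide sum_nonneg pos_divide_le_eq mult.commute)
    also have "\<dots> = c powr (p - 1) * (\<Sum>i\<in>J. \<bar>a i\<bar> powr p)"
      using c by (simp add: powr_diff)
    also have "\<dots> \<le> real (card I) powr (p - 1) * (\<Sum>i\<in>I. \<bar>a i\<bar> powr p)"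
      using c assms J
      by (intro mult_mono powr_mono2 sum_mono2 sum_nonneg) auto
    finally have "(\<Sum>i\<in>J. \<bar>a i\<bar>) powr p \<le> real (card I) powr (p - 1) * (\<Sum>i\<in>I. \<bar>a i\<bar> powr p)" .
    moreover have "\<bar>\<Sum>i\<in>I. a i\<bar> powr p \<le> (\<Sum>i\<in>J. \<bar>a i\<bar>) powr p"
      unfolding sumJ using assms by (intro powr_mono2 sum_abs) auto
    ultimately show ?thesis by linarith
  qed
qed

text \<open>On each cell the mean value theorem gives an exact increment of \<open>H\<close>, and
  uniform continuity moves the intermediate point to the left endpoint. Writing an integral as a
  limit of finite sums gives the moment bounds below without joint measurability in \<open>t\<close>
  and \<open>y\<close>.\<close>

lemma Riemann_sum_derivative_tendsto:
  fixes H G :: "real \<Rightarrow> real"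
  assumes deriv: "\<And>s. s \<in> {0..1} \<Longrightarrow> (H has_real_derivative G s) (at s within {0..1})"
    and cont: "continuous_on {0..1} G"
  shows "(\<lambda>N. \<Sum>i<Suc N. G (real i / real (Suc N)) / real (Suc N)) \<longlonglongrightarrow> H 1 - H 0"
proof (rule LIMSEQ_I)
  fix e :: real assume e: "0 < e"
  have "uniformly_continuous_on {0..1} G"
    by (rule compact_uniformly_continuous[OF cont]) simp
  then obtain d where d: "0 < d"
    and dG: "\<And>x y. x \<in> {0..1} \<Longrightarrow> y \<in> {0..1} \<Longrightarrow> dist y x < d \<Longrightarrow> dist (G y) (G x) < e / 2"
    using e unfolding uniformly_continuous_on_def by (metis half_gt_zero)
  obtain N0 :: nat where N0: "1 / d < real N0"
    using reals_Archimedean2 by blast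
  have "norm ((\<Sum>i<Suc N. G (real i / real (Suc N)) / real (Suc N)) - (H 1 - H 0)) < e"
    if N: "N \<ge> N0" for N
  proof -
    define n where "n = real (Suc N)"
    have "real N0 \<le> n"
      using N by (simp add: n_def)
    then have "1 / d < n"
      using N0 by linarith
    moreover have "0 < n"
      by (simp add: n_def)
    ultimately have n: "0 < n" "1 / n < d"
      using d by (simp_all add: pos_divide_less_eq mult.commute)
    have "H 1 - H 0 = (\<Sum>i<Suc N. H (real (Suc i) / n) - H (real i / n))"
      unfolding sum_lessThan_telescope[of "\<lambda>i. H (real i / n)"] using n(1)
      by (simp add: n_def[symmetric] del: of_nat_Suc)
    then have "(\<Sum>i<Suc N. G (real i / n) / n) - (H 1 - H 0) =
        (\<Sum>i<Suc N. G (real i / n) / n - (H (real (Suc i) / n) - H (real i / n)))"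
      by (simp only: sum_subtractf)
    also have "norm \<dots> \<le> (\<Sum>i<Suc N. e / 2 / n)"
    proof (rule order_trans[OF norm_sum], rule sum_mono)
      fix i assume i: "i \<in> {..<Suc N}"
      define a b where "a = real i / n" and "b = real (Suc i) / n"
      have ab: "0 \<le> a" "a < b" "b \<le> 1" "b - a = 1 / n"
        using i n by (auto simp: a_def b_def n_def field_simps)
      have "\<exists>x\<in>{a<..<b}. H b - H a = (b - a) * G x"
      proof -
        have "\<exists>x\<in>{a<..<b}. H b - H a = (*) (G x) (b - a)"
        proof (rule mvt_simple[OF ab(2)])
          fix x assume "a \<le> x" "x \<le> b"
          then have "(H has_real_derivative G x) (at x within {a..b})"
            using ab by (intro DERIV_subset[OF deriv]) auto
          then show "(H has_derivative (*) (G x)) (at x within {a..b})"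
            by (simp add: has_field_derivative_def)
        qed
        then show ?thesis by (simp add: mult.commute)
      qed
      then obtain x where x: "a < x" "x < b" "H b - H a = (b - a) * G x"
        by auto
      have "dist (G x) (G a) < e / 2"
        using x ab n by (intro dG) (auto simp: dist_real_def)
      then have "\<bar>G a - G x\<bar> / n \<le> e / 2 / n"
        using n by (intro divide_right_mono) (auto simp: dist_real_def abs_minus_commute)
      moreover have "G a / n - (H b - H a) = (G a - G x) / n"
        using x ab by (simp add: diff_divide_distrib)
      ultimately show "norm (G (real i / n) / n - (H (real (Suc i) / n) - H (real i / n))) \<le> e / 2 / n"
        using n by (simp add: a_def b_def)
    qed
    also have "\<dots> = e / 2"
      using n(1) by (simp add: n_def[symmetric] del: of_nat_Suc sum.lessThan_Suc)
    also have "\<dots> < e"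
      using e by simp
    finally show ?thesis
      by (simp add: n_def)
  qed
  then show "\<exists>no. \<forall>n\<ge>no. norm ((\<Sum>i<Suc n. G (real i / real (Suc n)) / real (Suc n)) - (H 1 - H 0)) < e"
    by blast
qed

text \<open>Since \<open>h 0 y = 0\<close>, \<open>h t y\<close> is the integral of \<open>g\<close>
  from 0 to \<open>t\<close>, approximated by the Riemann sums \<open>R N y\<close>. Convexity
  bounds the moment of each sum by an average of moments of \<open>g\<close>, and Fatou's lemma
  passes to the limit. A mean value point would depend on \<open>y\<close> and could not be used
  under the integral.\<close>

lemma nn_integral_powr_le_derivative:
  fixes h g :: "real \<Rightarrow> 'y \<Rightarrow> real" and C :: ennreal
  assumes p: "1 \<le> p"
    and regular: "AE y in M. h 0 y = 0 \<and> continuous_on {-a..a} (\<lambda>t. g t y) \<and>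
      (\<forall>t. \<bar>t\<bar> \<le> a \<longrightarrow> ((\<lambda>t. h t y) has_real_derivative g t y) (at t))"
    and meas: "\<And>t. \<bar>t\<bar> \<le> a \<Longrightarrow> g t \<in> borel_measurable M"
    and bound: "\<And>t. \<bar>t\<bar> \<le> a \<Longrightarrow> (\<integral>\<^sup>+ y. ennreal (\<bar>g t y\<bar> powr p) \<partial>M) \<le> C"
    and t: "\<bar>t\<bar> \<le> a"
  shows "(\<integral>\<^sup>+ y. ennreal (\<bar>h t y\<bar> powr p) \<partial>M) \<le> ennreal (a powr p) * C"
proof -
  define R where "R N y = (\<Sum>i<Suc N. t * g (t * (real i / real (Suc N))) y / real (Suc N))" for N y
  have in_range: "\<bar>t * s\<bar> \<le> a" if "0 \<le> s" "s \<le> 1" for s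
  proof -
    have "\<bar>t\<bar> * s \<le> \<bar>t\<bar>" using that by (simp add: mult_left_le)
    then show ?thesis using t that by (simp add: abs_mult)
  qed
  \<comment> \<open>Convexity contributes \<open>c powr (p - 1)\<close> and the mesh
    \<open>c powr (- p)\<close>; the remaining \<open>1 / c\<close> turns the \<open>c\<close>
    summands into an average, so the bound is independent of \<open>N\<close>.\<close>
  have scale: "c powr (p - 1) * \<bar>x * z / c\<bar> powr p = \<bar>x\<bar> powr p / c * \<bar>z\<bar> powr p"
    if "0 < c" for c x z :: real
  proof -
    have "\<bar>x * z / c\<bar> powr p = \<bar>x\<bar> powr p * \<bar>z\<bar> powr p / c powr p"
      using that by (simp add: abs_mult powr_mult powr_divide)
    then show ?thesis
      using that by (simp add: powr_diff)
  qed
  have meas' [measurable]: "g (t * (real i / real (Suc N))) \<in> borel_measurable M" if "i < Suc N" for i N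
    using that by (intro meas in_range) auto
  have R_meas: "R N \<in> borel_measurable M" for N
    unfolding R_def by (intro borel_measurable_sum borel_measurable_divide borel_measurable_times meas') auto
  have lim: "AE y in M. (\<lambda>N. R N y) \<longlonglongrightarrow> h t y"
    using regular
  proof eventually_elim
    case (elim y)
    have "(\<lambda>N. \<Sum>i<Suc N. (t * g (t * (real i / real (Suc N))) y) / real (Suc N))
        \<longlonglongrightarrow> h (t * 1) y - h (t * 0) y"
    proof (rule Riemann_sum_derivative_tendsto[where H = "\<lambda>s. h (t * s) y" and G = "\<lambda>s. t * g (t * s) y"])
      fix s :: real assume s: "s \<in> {0..1}"
      have "((\<lambda>t. h t y) has_real_derivative g (t * s) y) (at (t * s))"
        using elim in_range s by auto
      moreover have "((\<lambda>s. t * s) has_real_derivative t) (at s within {0..1})"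
        by (auto intro!: derivative_eq_intros)
      ultimately have "(((\<lambda>t. h t y) \<circ> (\<lambda>s. t * s)) has_real_derivative g (t * s) y * t) (at s within {0..1})"
        by (intro DERIV_chain)
      then show "((\<lambda>s. h (t * s) y) has_real_derivative t * g (t * s) y) (at s within {0..1})"
        by (simp add: o_def mult.commute)
    next
      have "continuous_on {0..1} (\<lambda>s. g (t * s) y)"
      proof (rule continuous_on_compose2[of "{-a..a}" "\<lambda>t. g t y" "{0..1}" "(*) t"])
        show "continuous_on {-a..a} (\<lambda>t. g t y)"
          using elim by blast
        show "(*) t ` {0..1} \<subseteq> {-a..a}"
          using in_range by (fastforce simp: abs_le_iff)
      qed (intro continuous_intros)
      then show "continuous_on {0..1} (\<lambda>s. t * g (t * s) y)"
        by (intro continuous_intros)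
    qed
    then show ?case
      using elim by (simp add: R_def)
  qed
  have "(\<integral>\<^sup>+ y. ennreal (\<bar>h t y\<bar> powr p) \<partial>M) = (\<integral>\<^sup>+ y. liminf (\<lambda>N. ennreal (\<bar>R N y\<bar> powr p)) \<partial>M)"
  proof (rule nn_integral_cong_AE, use lim in eventually_elim)
    case (elim y)
    have "(\<lambda>N. \<bar>R N y\<bar> powr p) \<longlonglongrightarrow> \<bar>h t y\<bar> powr p"
      using p by (intro tendsto_powr2 tendsto_rabs elim tendsto_const) auto
    then show ?case
      by (intro lim_imp_Liminf[symmetric]) auto
  qed
  also have "\<dots> \<le> liminf (\<lambda>N. \<integral>\<^sup>+ y. ennreal (\<bar>R N y\<bar> powr p) \<partial>M)"
    using R_meas by (intro nn_integral_liminf) measurable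
  also have "\<dots> \<le> ennreal (a powr p) * C"
  proof -
    have "(\<integral>\<^sup>+ y. ennreal (\<bar>R N y\<bar> powr p) \<partial>M) \<le> ennreal (a powr p) * C" for N
    proof -
      let ?n = "real (Suc N)" and ?t = "\<lambda>i. t * (real i / real (Suc N))"
      have "\<bar>R N y\<bar> powr p \<le> (\<Sum>i<Suc N. \<bar>t\<bar> powr p / ?n * \<bar>g (?t i) y\<bar> powr p)" for y
      proof -
        have "\<bar>R N y\<bar> powr p \<le> ?n powr (p - 1) * (\<Sum>i<Suc N. \<bar>t * g (?t i) y / ?n\<bar> powr p)"
          using abs_sum_powr_le[of "{..<Suc N}" p "\<lambda>i. t * g (?t i) y / ?n"] p
          unfolding R_def card_lessThan by blast
        also have "\<dots> = (\<Sum>i<Suc N. ?n powr (p - 1) * \<bar>t * g (?t i) y / ?n\<bar> powr p)"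
          by (simp only: sum_distrib_left)
        also have "\<dots> = (\<Sum>i<Suc N. \<bar>t\<bar> powr p / ?n * \<bar>g (?t i) y\<bar> powr p)"
          by (intro sum.cong refl scale) simp
        finally show ?thesis .
      qed
      then have "(\<integral>\<^sup>+ y. ennreal (\<bar>R N y\<bar> powr p) \<partial>M) \<le>
          (\<integral>\<^sup>+ y. (\<Sum>i<Suc N. ennreal (\<bar>t\<bar> powr p / ?n) * ennreal (\<bar>g (?t i) y\<bar> powr p)) \<partial>M)"
        by (intro nn_integral_mono)
          (auto simp del: of_nat_Suc sum.lessThan_Suc simp: sum_ennreal ennreal_mult[symmetric] intro!: ennreal_leI)
      also have "\<dots> = (\<Sum>i<Suc N. ennreal (\<bar>t\<bar> powr p / ?n) * (\<integral>\<^sup>+ y. ennreal (\<bar>g (?t i) y\<bar> powr p) \<partial>M))"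
      proof -
        have powr_meas: "(\<lambda>y. ennreal (\<bar>g (?t i) y\<bar> powr p)) \<in> borel_measurable M" if "i < Suc N" for i
          using meas'[OF that] by measurable
        show ?thesis
          by (subst nn_integral_sum)
            (use powr_meas in \<open>auto intro!: sum.cong nn_integral_cmult borel_measurable_times_ennreal
              simp del: of_nat_Suc sum.lessThan_Suc\<close>)
      qed
      also have "\<dots> \<le> (\<Sum>i<Suc N. ennreal (\<bar>t\<bar> powr p / ?n) * C)"
        by (intro sum_mono mult_left_mono bound in_range) auto
      also have "\<dots> = ennreal (?n * (\<bar>t\<bar> powr p / ?n)) * C"
        by (subst ennreal_mult) (simp_all add: ennreal_of_nat_eq_real_of_nat mult.assoc del: of_nat_Suc)
      also have "\<dots> \<le> ennreal (a powr p) * C"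
        using t p by (intro mult_right_mono ennreal_leI) (auto intro!: powr_mono2 simp del: of_nat_Suc)
      finally show ?thesis .
    qed
    then have "liminf (\<lambda>N. \<integral>\<^sup>+ y. ennreal (\<bar>R N y\<bar> powr p) \<partial>M) \<le> liminf (\<lambda>N. ennreal (a powr p) * C)"
      by (intro Liminf_mono) auto
    then show ?thesis by (simp add: Liminf_const)
  qed
  finally show ?thesis .
qed

text \<open>Descends from order \<open>L\<close> to order 0, each integration contributing a factor
  \<open>a powr p\<close>. The factor \<open>1 / fact L\<close> of Taylor's formula is given up,
  which costs only a constant in the application.\<close>

lemma nn_integral_powr_le_iterated_derivative:
  fixes D :: "nat \<Rightarrow> real \<Rightarrow> 'y \<Rightarrow> real" and C :: ennreal
  assumes p: "1 \<le> p"
    and zero: "AE y in M. \<forall>l<L. D l 0 y = 0"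
    and cont: "AE y in M. continuous_on {-a..a} (\<lambda>t. D L t y)"
    and deriv: "AE y in M. \<forall>l<L. \<forall>t. \<bar>t\<bar> \<le> a \<longrightarrow>
      ((\<lambda>t. D l t y) has_real_derivative D (Suc l) t y) (at t)"
    and meas: "\<And>l t. l \<le> L \<Longrightarrow> \<bar>t\<bar> \<le> a \<Longrightarrow> D l t \<in> borel_measurable M"
    and bound: "\<And>t. \<bar>t\<bar> \<le> a \<Longrightarrow> (\<integral>\<^sup>+ y. ennreal (\<bar>D L t y\<bar> powr p) \<partial>M) \<le> C"
    and t: "\<bar>t\<bar> \<le> a"
  shows "(\<integral>\<^sup>+ y. ennreal (\<bar>D 0 t y\<bar> powr p) \<partial>M) \<le> ennreal (a powr p) ^ L * C"
proof -
  have "(\<integral>\<^sup>+ y. ennreal (\<bar>D (L - m) t y\<bar> powr p) \<partial>M) \<le> ennreal (a powr p) ^ m * C"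
    if "m \<le> L" "\<bar>t\<bar> \<le> a" for m t
    using that
  proof (induction m arbitrary: t)
    case 0
    then show ?case using bound by simp
  next
    case (Suc m)
    then have m: "L - m = Suc (L - Suc m)" "L - Suc m < L" by auto
    have "(\<integral>\<^sup>+ y. ennreal (\<bar>D (L - Suc m) t y\<bar> powr p) \<partial>M) \<le> ennreal (a powr p) * (ennreal (a powr p) ^ m * C)"
    proof (rule nn_integral_powr_le_derivative[OF p])
      show "AE y in M. D (L - Suc m) 0 y = 0 \<and> continuous_on {-a..a} (\<lambda>t. D (L - m) t y) \<and>
        (\<forall>t. \<bar>t\<bar> \<le> a \<longrightarrow> ((\<lambda>t. D (L - Suc m) t y) has_real_derivative D (L - m) t y) (at t))"
        using zero cont deriv
      proof eventually_elim
        case (elim y)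
        have "continuous_on {-a..a} (\<lambda>t. D (L - m) t y)"
        \<comment> \<open>At the top order continuity is a hypothesis; below it, the next derivative
          provides it.\<close>
        proof (cases "m = 0")
          case False
          then have "L - m < L" using Suc by auto
          then show ?thesis
            using elim(3)
            by (intro DERIV_continuous_on[where D = "\<lambda>t. D (Suc (L - m)) t y"])
              (auto intro: has_field_derivative_at_within simp: abs_le_iff)
        qed (use elim in simp)
        then show ?case using elim m by auto
      qed
    qed (use Suc meas in auto)
    then show ?case by (simp add: mult.assoc)
  qed
  from this[of L t] t show ?thesis by simp
qed

subsection \<open>Convergence of expectations under varying laws\<close>

text \<open>Truncation by clamping rather than by setting large values to 0: it is continuous, so
  almost everywhere limits pass through it.\<close>

definition clamp_abs :: "real \<Rightarrow> real \<Rightarrow> real" where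
  "clamp_abs K x = max (- K) (min K x)"

text \<open>Above the level \<open>K\<close>, write \<open>\<bar>x\<bar>\<close> as
  \<open>\<bar>x\<bar> powr q * \<bar>x\<bar> powr (1 - q)\<close>; the second exponent is not
  positive, so its base may be lowered to \<open>K\<close>.\<close>

lemma clamp_abs_error:
  assumes "0 < K" "1 \<le> q"
  shows "\<bar>x - clamp_abs K x\<bar> \<le> \<bar>x\<bar> powr q * K powr (1 - q)"
proof (cases "\<bar>x\<bar> \<le> K")
  case False
  then have "\<bar>x - clamp_abs K x\<bar> \<le> \<bar>x\<bar> powr q * \<bar>x\<bar> powr (1 - q)"
    using assms by (auto simp: clamp_abs_def powr_add[symmetric])
  also have "\<dots> \<le> \<bar>x\<bar> powr q * K powr (1 - q)"
    using False assms by (intro mult_left_mono powr_mono2') auto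
  finally show ?thesis .
qed (use assms in \<open>auto simp: clamp_abs_def\<close>)

text \<open>The bound on the moments of order \<open>q > 1\<close> is uniform integrability: the error of
  truncating at \<open>\<plusminus>K\<close> is at most \<open>C * K powr (1 - q)\<close>, uniformly in \<open>m\<close>.\<close>
lemma integral_density_tendsto:
  fixes F w :: "nat \<Rightarrow> 'y \<Rightarrow> real" and w' :: "'y \<Rightarrow> real" and C :: real
  assumes P: "prob_space P"
    and F_meas [measurable]: "\<And>m. F m \<in> borel_measurable P"
    and F_nonneg: "\<And>m y. 0 \<le> F m y"
    and prob: "\<And>m. prob_space (density P (\<lambda>y. ennreal (F m y)))"
    and F_lim: "AE y in P. (\<lambda>m. F m y) \<longlonglongrightarrow> 1"
    and w_meas [measurable]: "\<And>m. w m \<in> borel_measurable P" "w' \<in> borel_measurable P"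
    and w_lim: "AE y in P. (\<lambda>m. w m y) \<longlonglongrightarrow> w' y"
    and q: "1 < q"
    and bound: "\<And>m. (\<integral>\<^sup>+ y. ennreal (\<bar>w m y\<bar> powr q) \<partial>density P (\<lambda>y. ennreal (F m y))) \<le> ennreal C"
  shows "(\<lambda>m. \<integral>y. w m y \<partial>density P (\<lambda>y. ennreal (F m y))) \<longlonglongrightarrow> (\<integral>y. w' y \<partial>P)"
    and "\<And>m. integrable (density P (\<lambda>y. ennreal (F m y))) (w m)"
    and "integrable P w'"
proof -
  interpret P: prob_space P by fact
  let ?Q = "\<lambda>m. density P (\<lambda>y. ennreal (F m y))"
  \<comment> \<open>A negative \<open>C\<close> has \<open>ennreal C = 0\<close>, so the real bound
    is cut off at 0.\<close>
  define C0 where "C0 = max C 0"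
  have C0: "0 \<le> C0" by (simp add: C0_def)
  have bound0: "(\<integral>\<^sup>+ y. ennreal (\<bar>w m y\<bar> powr q) \<partial>?Q m) \<le> ennreal C0" for m
    using bound[of m] by (auto simp: C0_def max_def ennreal_neg)
  have F_int: "integrable P (F m)" "(\<integral>y. F m y \<partial>P) = 1" for m
  proof -
    interpret Q: prob_space "?Q m" by (rule prob)
    have "(\<integral>\<^sup>+ y. ennreal (F m y) \<partial>P) = 1"
      using Q.emeasure_space_1 by (simp add: emeasure_density)
    then show "integrable P (F m)" "(\<integral>y. F m y \<partial>P) = 1"
      using F_nonneg by (auto simp: integrable_iff_bounded integral_eq_nn_integral)
  qed
  \<comment> \<open>Scheffe's argument: \<open>F m - 1\<close> has integral 0, so the integral of
    its absolute value is twice that of its negative part, which is dominated by 1.\<close>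
  have F_L1: "(\<lambda>m. \<integral>y. \<bar>F m y - 1\<bar> \<partial>P) \<longlonglongrightarrow> 0"
  proof -
    have "(\<lambda>m. \<integral>y. max 0 (1 - F m y) \<partial>P) \<longlonglongrightarrow> (\<integral>y. 0 \<partial>P)"
    proof (rule integral_dominated_convergence[where w = "\<lambda>_. 1"])
      show "AE y in P. (\<lambda>m. max 0 (1 - F m y)) \<longlonglongrightarrow> 0"
        using F_lim
      proof eventually_elim
        case (elim y)
        have "(\<lambda>m. max 0 (1 - F m y)) \<longlonglongrightarrow> max 0 (1 - 1)"
          by (intro tendsto_intros elim)
        then show ?case by simp
      qed
    qed (use F_nonneg in auto)
    moreover have "(\<integral>y. \<bar>F m y - 1\<bar> \<partial>P) = 2 * (\<integral>y. max 0 (1 - F m y) \<partial>P)" for m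
    proof -
      have "(\<integral>y. \<bar>F m y - 1\<bar> \<partial>P) = (\<integral>y. F m y - 1 + 2 * max 0 (1 - F m y) \<partial>P)"
        by (intro Bochner_Integration.integral_cong) (auto simp: max_def)
      also have "\<dots> = 2 * (\<integral>y. max 0 (1 - F m y) \<partial>P)"
        using F_int by (simp add: P.prob_space)
      finally show ?thesis .
    qed
    ultimately show ?thesis
      by (auto intro: tendsto_eq_intros)
  qed
  have powr_int: "integrable (?Q m) (\<lambda>y. \<bar>w m y\<bar> powr q)" "(\<integral>y. \<bar>w m y\<bar> powr q \<partial>?Q m) \<le> C0" for m
  proof -
    show "integrable (?Q m) (\<lambda>y. \<bar>w m y\<bar> powr q)"
      using bound0[of m] by (auto simp: integrable_iff_bounded le_less_trans)
    then have "ennreal (\<integral>y. \<bar>w m y\<bar> powr q \<partial>?Q m) \<le> ennreal C0"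
      using bound0[of m] by (subst nn_integral_eq_integral[symmetric]) auto
    then show "(\<integral>y. \<bar>w m y\<bar> powr q \<partial>?Q m) \<le> C0"
      using C0 by (simp add: ennreal_le_iff)
  qed
  have le_powr: "\<bar>x\<bar> \<le> 1 + \<bar>x\<bar> powr q" for x :: real
    using powr_mono[of 1 q "\<bar>x\<bar>"] powr_ge_zero[of "\<bar>x\<bar>" q] q
    by (cases "\<bar>x\<bar> \<le> 1") (linarith, auto)
  show w_int: "integrable (?Q m) (w m)" for m
  proof -
    interpret Q: prob_space "?Q m" by (rule prob)
    show ?thesis
      by (rule Bochner_Integration.integrable_bound[where f = "\<lambda>y. 1 + \<bar>w m y\<bar> powr q"])
        (use powr_int le_powr in auto)
  qed
  \<comment> \<open>Fatou's lemma transfers the moment bound to the limit, whose truncation error is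
    then controlled in the same way.\<close>
  have powr_int': "integrable P (\<lambda>y. \<bar>w' y\<bar> powr q)" "(\<integral>y. \<bar>w' y\<bar> powr q \<partial>P) \<le> C0"
  proof -
    have "(\<integral>\<^sup>+ y. ennreal (\<bar>w' y\<bar> powr q) \<partial>P) = (\<integral>\<^sup>+ y. liminf (\<lambda>m. ennreal (F m y * \<bar>w m y\<bar> powr q)) \<partial>P)"
    proof (rule nn_integral_cong_AE, use F_lim w_lim in eventually_elim)
      case (elim y)
      have "(\<lambda>m. F m y * \<bar>w m y\<bar> powr q) \<longlonglongrightarrow> 1 * \<bar>w' y\<bar> powr q"
        using q by (intro tendsto_mult tendsto_powr2 tendsto_rabs elim tendsto_const) auto
      then show ?case
        by (intro lim_imp_Liminf[symmetric]) auto
    qed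
    also have "\<dots> \<le> liminf (\<lambda>m. \<integral>\<^sup>+ y. ennreal (F m y * \<bar>w m y\<bar> powr q) \<partial>P)"
      by (intro nn_integral_liminf) measurable
    also have "\<dots> = liminf (\<lambda>m. \<integral>\<^sup>+ y. ennreal (\<bar>w m y\<bar> powr q) \<partial>?Q m)"
      using F_nonneg by (simp add: nn_integral_density ennreal_mult)
    also have "\<dots> \<le> liminf (\<lambda>m. ennreal C0)"
      using bound0 by (intro Liminf_mono) auto
    finally have le: "(\<integral>\<^sup>+ y. ennreal (\<bar>w' y\<bar> powr q) \<partial>P) \<le> ennreal C0"
      by (simp add: Liminf_const)
    then show "integrable P (\<lambda>y. \<bar>w' y\<bar> powr q)"
      by (auto simp: integrable_iff_bounded le_less_trans)
    then have "ennreal (\<integral>y. \<bar>w' y\<bar> powr q \<partial>P) \<le> ennreal C0"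
      using le by (subst nn_integral_eq_integral[symmetric]) auto
    then show "(\<integral>y. \<bar>w' y\<bar> powr q \<partial>P) \<le> C0"
      using C0 by (simp add: ennreal_le_iff)
  qed
  show w'_int: "integrable P w'"
    by (rule Bochner_Integration.integrable_bound[where f = "\<lambda>y. 1 + \<bar>w' y\<bar> powr q"])
      (use powr_int' le_powr in auto)
  have clamp_meas [measurable]: "clamp_abs K \<in> borel_measurable borel" for K
    unfolding clamp_abs_def[abs_def] by measurable
  have clamp_le: "\<bar>clamp_abs K x\<bar> \<le> K" if "0 < K" for K x
    using that by (auto simp: clamp_abs_def)
  have truncation: "\<bar>(\<integral>y. g y \<partial>M) - (\<integral>y. clamp_abs K (g y) \<partial>M)\<bar> \<le> C0 * K powr (1 - q)"
    if K: "0 < K" and M: "prob_space M" and g: "integrable M g" "integrable M (\<lambda>y. \<bar>g y\<bar> powr q)"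
      "(\<integral>y. \<bar>g y\<bar> powr q \<partial>M) \<le> C0"
    for K and M :: "'y measure" and g :: "'y \<Rightarrow> real"
  proof -
    interpret M: prob_space M by fact
    have [measurable]: "g \<in> borel_measurable M" using g by auto
    have c: "integrable M (\<lambda>y. clamp_abs K (g y))"
      using clamp_le[OF K] by (intro M.integrable_const_bound[of _ K]) auto
    have "\<bar>(\<integral>y. g y \<partial>M) - (\<integral>y. clamp_abs K (g y) \<partial>M)\<bar> \<le> (\<integral>y. \<bar>g y - clamp_abs K (g y)\<bar> \<partial>M)"
      using g c integral_norm_bound[of M "\<lambda>y. g y - clamp_abs K (g y)"]
      by (simp add: Bochner_Integration.integral_diff)
    also have "\<dots> \<le> (\<integral>y. \<bar>g y\<bar> powr q * K powr (1 - q) \<partial>M)"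
      using g c K q by (intro integral_mono clamp_abs_error) auto
    also have "\<dots> = (\<integral>y. \<bar>g y\<bar> powr q \<partial>M) * K powr (1 - q)"
      by simp
    also have "\<dots> \<le> C0 * K powr (1 - q)"
      using g by (intro mult_right_mono) auto
    finally show ?thesis .
  qed
  \<comment> \<open>The density is split as \<open>1 + (F m - 1)\<close>. Dominated convergence
    handles the first part, and L1 convergence of \<open>F m\<close> the second, because the clamped
    variable is bounded by \<open>K\<close>.\<close>
  have clamp_lim: "(\<lambda>m. \<integral>y. clamp_abs K (w m y) \<partial>?Q m) \<longlonglongrightarrow> (\<integral>y. clamp_abs K (w' y) \<partial>P)"
    if K: "0 < K" for K
  proof -
    have c_int: "integrable P (\<lambda>y. clamp_abs K (w m y))" for m
      using clamp_le[OF K] by (intro P.integrable_const_bound[of _ K]) auto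
    have Fc_int: "integrable P (\<lambda>y. (F m y - 1) * clamp_abs K (w m y))" for m
      by (rule Bochner_Integration.integrable_bound[where f = "\<lambda>y. \<bar>F m y - 1\<bar> * K"])
        (use F_int clamp_le[OF K] K in \<open>auto simp: abs_mult intro!: mult_left_mono\<close>)
    have "(\<lambda>m. \<integral>y. clamp_abs K (w m y) \<partial>P) \<longlonglongrightarrow> (\<integral>y. clamp_abs K (w' y) \<partial>P)"
    proof (rule integral_dominated_convergence[where w = "\<lambda>_. K"])
      show "AE y in P. (\<lambda>m. clamp_abs K (w m y)) \<longlonglongrightarrow> clamp_abs K (w' y)"
        using w_lim unfolding clamp_abs_def by eventually_elim (intro tendsto_intros)
    qed (use clamp_le[OF K] in auto)
    moreover have "(\<lambda>m. \<integral>y. (F m y - 1) * clamp_abs K (w m y) \<partial>P) \<longlonglongrightarrow> 0"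
    proof (rule Lim_null_comparison)
      show "\<forall>\<^sub>F m in sequentially. norm (\<integral>y. (F m y - 1) * clamp_abs K (w m y) \<partial>P) \<le> (\<integral>y. \<bar>F m y - 1\<bar> \<partial>P) * K"
      proof (intro always_eventually allI)
        fix m
        have "norm (\<integral>y. (F m y - 1) * clamp_abs K (w m y) \<partial>P) \<le> (\<integral>y. \<bar>F m y - 1\<bar> * K \<partial>P)"
        proof (rule order_trans[OF integral_norm_bound], rule integral_mono)
          show "integrable P (\<lambda>y. norm ((F m y - 1) * clamp_abs K (w m y)))"
            using Fc_int by (rule integrable_norm)
        qed (use F_int clamp_le[OF K] in \<open>auto simp: abs_mult intro!: mult_left_mono\<close>)
        then show "norm (\<integral>y. (F m y - 1) * clamp_abs K (w m y) \<partial>P) \<le> (\<integral>y. \<bar>F m y - 1\<bar> \<partial>P) * K"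
          by simp
      qed
      show "(\<lambda>m. (\<integral>y. \<bar>F m y - 1\<bar> \<partial>P) * K) \<longlonglongrightarrow> 0"
        using tendsto_mult_right[OF F_L1, of K] by simp
    qed
    ultimately have "(\<lambda>m. (\<integral>y. clamp_abs K (w m y) \<partial>P) + (\<integral>y. (F m y - 1) * clamp_abs K (w m y) \<partial>P))
        \<longlonglongrightarrow> (\<integral>y. clamp_abs K (w' y) \<partial>P) + 0"
      by (rule tendsto_add)
    moreover have "(\<integral>y. clamp_abs K (w m y) \<partial>?Q m) =
        (\<integral>y. clamp_abs K (w m y) \<partial>P) + (\<integral>y. (F m y - 1) * clamp_abs K (w m y) \<partial>P)" for m
    proof -
      have "(\<integral>y. clamp_abs K (w m y) \<partial>?Q m) = (\<integral>y. F m y * clamp_abs K (w m y) \<partial>P)"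
        using F_nonneg by (subst integral_real_density) auto
      also have "\<dots> = (\<integral>y. clamp_abs K (w m y) + (F m y - 1) * clamp_abs K (w m y) \<partial>P)"
        by (simp add: algebra_simps)
      finally show ?thesis
        using c_int Fc_int by simp
    qed
    ultimately show ?thesis by simp
  qed
  show "(\<lambda>m. \<integral>y. w m y \<partial>?Q m) \<longlonglongrightarrow> (\<integral>y. w' y \<partial>P)"
  proof (rule LIMSEQ_I)
    fix e :: real assume e: "0 < e"
    have "((\<lambda>K. C0 * K powr (1 - q)) \<longlongrightarrow> C0 * 0) at_top"
      using q by (intro tendsto_mult tendsto_const tendsto_neg_powr filterlim_ident) auto
    then have "\<forall>\<^sub>F K in at_top. C0 * K powr (1 - q) < e / 4"
      using e by (intro order_tendstoD) auto
    then obtain K where K: "0 < K" "C0 * K powr (1 - q) < e / 4"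
      using eventually_conj[OF eventually_gt_at_top[of 0]]
      by (metis (mono_tags, lifting) eventually_happens trivial_limit_at_top_linorder)
    obtain N where N: "\<And>m. m \<ge> N \<Longrightarrow> norm ((\<integral>y. clamp_abs K (w m y) \<partial>?Q m) - (\<integral>y. clamp_abs K (w' y) \<partial>P)) < e / 4"
      using LIMSEQ_D[OF clamp_lim[OF K(1)], of "e / 4"] e by auto
    \<comment> \<open>The two truncation errors and the difference of the clamped integrals are each
      below \<open>e / 4\<close>.\<close>
    have "norm ((\<integral>y. w m y \<partial>?Q m) - (\<integral>y. w' y \<partial>P)) < e" if "m \<ge> N" for m
      using N[OF that] K(2) e
        truncation[OF K(1) prob w_int powr_int, of m] truncation[OF K(1) P w'_int powr_int']
      by (simp only: real_norm_def)
    then show "\<exists>no. \<forall>n\<ge>no. norm ((\<integral>y. w n y \<partial>?Q n) - (\<integral>y. w' y \<partial>P)) < e"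
      by blast
  qed
qed

subsection \<open>Quadratic forms and covariance matrices\<close>

lemma matrix_inv_mult:
  fixes A :: "real ^ 'n ^ 'n"
  assumes "invertible A"
  shows "A ** matrix_inv A = mat 1" "matrix_inv A ** A = mat 1"
proof -
  from assms have "\<exists>B. A ** B = mat 1 \<and> B ** A = mat 1"
    by (simp add: invertible_def)
  from someI_ex[OF this] show "A ** matrix_inv A = mat 1" "matrix_inv A ** A = mat 1"
    by (simp_all add: matrix_inv_def)
qed

lemma matrix_inv_vector_eqI:
  fixes A :: "real ^ 'n ^ 'n"
  assumes "invertible A" "A *v z = x"
  shows "matrix_inv A *v x = z"
  using matrix_inv_mult(2)[OF assms(1)] assms(2)
  by (metis matrix_vector_mul_assoc matrix_vector_mul_lid)

lemma invertible_transpose_real: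
  fixes A :: "real ^ 'n ^ 'n"
  shows "invertible A \<Longrightarrow> invertible (transpose A)"
  unfolding invertible_def by (metis matrix_transpose_mul transpose_mat)

text \<open>The score statistic is invariant under an invertible transformation of the score, whose
  covariance becomes \<open>A ** I ** transpose A\<close>. The reason is that
  \<open>matrix_inv (transpose A)\<close> maps the solution of the old linear system to that of the
  new one.\<close>

lemma quadratic_form_inverse_change_of_basis:
  fixes A I :: "real ^ 'n ^ 'n"
  assumes A: "invertible A" and I: "invertible I"
  shows "(A *v s) \<bullet> (matrix_inv (A ** I ** transpose A) *v (A *v s)) = s \<bullet> (matrix_inv I *v s)"
proof -
  define z where "z = matrix_inv I *v s"
  define w where "w = matrix_inv (transpose A) *v z"
  have w: "transpose A *v w = z"
    using matrix_inv_mult(1)[OF invertible_transpose_real[OF A]]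
    by (simp add: w_def matrix_vector_mul_assoc matrix_vector_mul_lid)
  have "I *v z = s"
    using matrix_inv_mult(1)[OF I] by (simp add: z_def matrix_vector_mul_assoc matrix_vector_mul_lid)
  then have "(A ** I ** transpose A) *v w = A *v s"
    using w by (simp add: matrix_vector_mul_assoc[symmetric])
  then have "matrix_inv (A ** I ** transpose A) *v (A *v s) = w"
    using A I by (intro matrix_inv_vector_eqI invertible_mult invertible_transpose_real)
  then have "(A *v s) \<bullet> (matrix_inv (A ** I ** transpose A) *v (A *v s)) = s \<bullet> (transpose A *v w)"
    by (metis dot_lmul_matrix inner_commute vector_transpose_matrix)
  then show ?thesis using w by (simp add: z_def)
qed

lemma matrix_vector_norm_le_sum:
  fixes A :: "real ^ 'n ^ 'm"
  shows "norm (A *v x) \<le> (\<Sum>i\<in>UNIV. \<Sum>j\<in>UNIV. \<bar>A $ i $ j\<bar>) * norm x"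
proof -
  have "norm (A *v x) \<le> (\<Sum>i\<in>UNIV. \<bar>(A *v x) $ i\<bar>)"
    by (rule norm_le_l1_cart)
  also have "\<dots> \<le> (\<Sum>i\<in>UNIV. \<Sum>j\<in>UNIV. \<bar>A $ i $ j\<bar> * norm x)"
  proof (rule sum_mono)
    fix i
    have "\<bar>(A *v x) $ i\<bar> \<le> (\<Sum>j\<in>UNIV. \<bar>A $ i $ j * x $ j\<bar>)"
      unfolding matrix_vector_mult_def by (simp add: sum_abs)
    also have "\<dots> \<le> (\<Sum>j\<in>UNIV. \<bar>A $ i $ j\<bar> * norm x)"
      by (intro sum_mono) (auto simp: abs_mult intro!: mult_left_mono component_le_norm_cart)
    finally show "\<bar>(A *v x) $ i\<bar> \<le> (\<Sum>j\<in>UNIV. \<bar>A $ i $ j\<bar> * norm x)" .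
  qed
  also have "\<dots> = (\<Sum>i\<in>UNIV. \<Sum>j\<in>UNIV. \<bar>A $ i $ j\<bar>) * norm x"
    by (simp add: sum_distrib_right)
  finally show ?thesis .
qed

text \<open>A perturbation argument: \<open>C m *v z m = u m\<close> is rewritten as
  \<open>z m = matrix_inv C' *v (u m + (C' - C m) *v z m)\<close>, where only the inverse of the
  limit matrix occurs and the entries of \<open>C' - C m\<close> tend to 0.\<close>

lemma tendsto_matrix_inv_vector:
  fixes C :: "nat \<Rightarrow> real ^ 'n ^ 'n"
  assumes C: "\<And>i j. (\<lambda>m. C m $ i $ j) \<longlonglongrightarrow> C' $ i $ j"
    and inv: "\<And>m. invertible (C m)" "invertible C'"
    and u: "u \<longlonglongrightarrow> u'"
  shows "(\<lambda>m. matrix_inv (C m) *v u m) \<longlonglongrightarrow> matrix_inv C' *v u'"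
proof -
  define z where "z m = matrix_inv (C m) *v u m" for m
  define D where "D m = (\<Sum>i\<in>UNIV. \<Sum>j\<in>UNIV. \<bar>(C' - C m) $ i $ j\<bar>)" for m
  define K where "K = (\<Sum>i\<in>UNIV. \<Sum>j\<in>UNIV. \<bar>matrix_inv C' $ i $ j\<bar>)"
  have K: "0 \<le> K" by (auto simp: K_def intro!: sum_nonneg)
  have Cz: "C m *v z m = u m" for m
    using matrix_inv_mult(1)[OF inv(1)[of m]] by (simp add: z_def matrix_vector_mul_assoc)
  have D0: "D \<longlonglongrightarrow> 0"
  proof -
    have "D \<longlonglongrightarrow> (\<Sum>i\<in>UNIV. \<Sum>j\<in>UNIV. \<bar>C' $ i $ j - C' $ i $ j\<bar>)"
      unfolding D_def vector_minus_component by (intro tendsto_intros C)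
    then show ?thesis by simp
  qed
  have zeq: "z m = matrix_inv C' *v (u m + (C' - C m) *v z m)" for m
    using Cz[of m] inv(2)
    by (intro matrix_inv_vector_eqI[symmetric]) (auto simp: matrix_vector_mult_diff_rdistrib)
  have diff: "norm (z m - matrix_inv C' *v u') \<le> K * (norm (u m - u') + D m * norm (z m))" for m
  proof -
    have "z m - matrix_inv C' *v u' = matrix_inv C' *v ((u m - u') + (C' - C m) *v z m)"
      using zeq[of m] by (metis add_diff_eq diff_add_eq matrix_vector_mult_diff_distrib)
    also have "norm \<dots> \<le> K * norm ((u m - u') + (C' - C m) *v z m)"
      unfolding K_def by (rule matrix_vector_norm_le_sum)
    also have "\<dots> \<le> K * (norm (u m - u') + D m * norm (z m))"
      using K matrix_vector_norm_le_sum[of "C' - C m" "z m"]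
      by (intro mult_left_mono order_trans[OF norm_triangle_ineq] add_left_mono) (auto simp: D_def)
    finally show ?thesis .
  qed
  obtain M where M: "\<And>m. norm (u m) \<le> M"
    using convergent_imp_Bseq[OF convergentI[OF u]] by (auto simp: Bseq_def)
  have "(\<lambda>m. K * D m) \<longlonglongrightarrow> 0"
    using tendsto_mult_right_zero[OF D0, of K] by simp
  then have ev: "\<forall>\<^sub>F m in sequentially. K * D m < 1 / 2"
    by (rule order_tendstoD) simp
  \<comment> \<open>Once \<open>K * D m < 1 / 2\<close>, the term with \<open>z m\<close> on the
    right is absorbed into the left-hand side; this is the origin of the factor 2.\<close>
  have z_bound: "\<forall>\<^sub>F m in sequentially. norm (z m) \<le> 2 * K * M"
    using ev
  proof eventually_elim
    case (elim m)
    have "norm (z m) \<le> K * norm (u m + (C' - C m) *v z m)"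
      by (subst zeq) (unfold K_def, rule matrix_vector_norm_le_sum)
    also have "\<dots> \<le> K * (norm (u m) + D m * norm (z m))"
      using K matrix_vector_norm_le_sum[of "C' - C m" "z m"]
      by (intro mult_left_mono order_trans[OF norm_triangle_ineq] add_left_mono) (auto simp: D_def)
    also have "\<dots> \<le> K * M + K * D m * norm (z m)"
      using K M[of m] by (simp add: distrib_left mult_left_mono)
    also have "\<dots> \<le> K * M + 1 / 2 * norm (z m)"
      using elim by (intro add_left_mono mult_right_mono) auto
    finally show ?case by simp
  qed
  have "(\<lambda>m. z m - matrix_inv C' *v u') \<longlonglongrightarrow> 0"
  proof (rule Lim_null_comparison)
    show "\<forall>\<^sub>F m in sequentially. norm (z m - matrix_inv C' *v u') \<le> K * (norm (u m - u') + D m * (2 * K * M))"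
      using z_bound
    proof eventually_elim
      case (elim m)
      have "0 \<le> D m" by (auto simp: D_def intro!: sum_nonneg)
      then have "K * (norm (u m - u') + D m * norm (z m)) \<le> K * (norm (u m - u') + D m * (2 * K * M))"
        using K elim by (intro mult_left_mono add_left_mono) auto
      then show ?case using diff[of m] by linarith
    qed
    have "(\<lambda>m. K * (norm (u m - u') + D m * (2 * K * M))) \<longlonglongrightarrow> K * (norm (u' - u') + 0 * (2 * K * M))"
      by (intro tendsto_intros u D0)
    then show "(\<lambda>m. K * (norm (u m - u') + D m * (2 * K * M))) \<longlonglongrightarrow> 0" by simp
  qed
  then show ?thesis
    using LIM_zero_iff by (auto simp: z_def)
qed

lemma pos_definite_invertible:
  assumes "pos_definite A"
  shows "invertible A"
proof -
  have "A *v x = 0 \<Longrightarrow> x = 0" for x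
    using assms unfolding pos_definite_def by (metis inner_zero_right less_irrefl)
  then show ?thesis
    using matrix_left_invertible_ker invertible_left_inverse by blast
qed

lemma orthonormal_rows_invertible:
  fixes v :: "'n \<Rightarrow> real ^ 'n"
  assumes "\<And>j l. v j \<bullet> v l = (if j = l then 1 else 0)"
  shows "invertible (\<chi> j. v j)"
proof -
  have "(\<chi> j. v j) ** transpose (\<chi> j. v j) = mat 1"
    using assms
    by (simp add: vec_eq_iff matrix_matrix_mult_def transpose_def mat_def inner_vec_def)
  then show ?thesis
    using invertible_right_inverse by blast
qed

text \<open>In the completion every subset of a null set is measurable, so \<open>f\<close> becomes
  measurable there through its agreement with \<open>g\<close>. Covariances can thus be computed
  with a measurable version of the score.\<close>

lemma integral_completion_AE_eq:
  fixes f g :: "'y \<Rightarrow> real"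
  assumes g: "g \<in> borel_measurable M" and eq: "AE y in M. f y = g y"
  shows "integral\<^sup>L (completion M) f = integral\<^sup>L M g"
proof -
  have ae: "AE y in completion M. g y = f y"
    using AE_completion[OF eq] by eventually_elim simp
  have "f \<in> borel_measurable (completion M)"
  proof (rule measurableI)
    fix A :: "real set" assume [measurable]: "A \<in> sets borel"
    have [measurable]: "Measurable.pred (completion M) (\<lambda>y. f y \<noteq> g y)"
      "Measurable.pred (completion M) (\<lambda>y. f y \<noteq> g y \<and> f y \<in> A)"
      using eq by (auto intro!: sets_completion_AE elim!: eventually_mono)
    note [measurable] = measurable_completion[OF g]
    have "{y \<in> space (completion M). (f y \<noteq> g y \<and> f y \<in> A) \<or> (\<not> (f y \<noteq> g y) \<and> g y \<in> A)} \<in> sets (completion M)"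
      by measurable
    also have "{y \<in> space (completion M). (f y \<noteq> g y \<and> f y \<in> A) \<or> (\<not> (f y \<noteq> g y) \<and> g y \<in> A)} =
        f -` A \<inter> space (completion M)"
      by auto
    finally show "f -` A \<inter> space (completion M) \<in> sets (completion M)" .
  qed simp
  then have "integral\<^sup>L (completion M) f = integral\<^sup>L (completion M) g"
    using ae measurable_completion[OF g] by (intro integral_cong_AE) auto
  then show ?thesis using integral_completion[OF g] by simp
qed

text \<open>\<open>X'\<close> plays the role of a measurable version of \<open>X\<close>, which
  itself may be non-measurable on the exceptional set.\<close>

lemma cov_matrix_AE_eq:
  fixes X X' :: "'y \<Rightarrow> real ^ 'd"
  assumes meas: "\<And>a. (\<lambda>y. X' y $ a) \<in> borel_measurable M" and eq: "AE y in M. X y = X' y"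
  shows "cov_matrix M X $ a $ b =
    (\<integral>y. (X' y $ a - (\<integral>z. X' z $ a \<partial>M)) * (X' y $ b - (\<integral>z. X' z $ b \<partial>M)) \<partial>M)"
proof -
  note [measurable] = meas
  have mean: "(\<integral>z. X z $ a \<partial>completion M) = (\<integral>z. X' z $ a \<partial>M)" for a
    by (rule integral_completion_AE_eq) (use eq in auto)
  show ?thesis
    unfolding cov_matrix_def mean vec_lambda_beta
    by (rule integral_completion_AE_eq) (use eq in auto)
qed

lemma cov_matrix_expand:
  fixes X X' :: "'y \<Rightarrow> real ^ 'd"
  assumes M: "prob_space M"
    and meas: "\<And>a. (\<lambda>y. X' y $ a) \<in> borel_measurable M" and eq: "AE y in M. X y = X' y"
    and int: "\<And>a. integrable M (\<lambda>y. X' y $ a)" "\<And>a b. integrable M (\<lambda>y. X' y $ a * X' y $ b)"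
  shows "cov_matrix M X $ a $ b =
    (\<integral>y. X' y $ a * X' y $ b \<partial>M) - (\<integral>y. X' y $ a \<partial>M) * (\<integral>y. X' y $ b \<partial>M)"
proof -
  interpret prob_space M by fact
  have "cov_matrix M X $ a $ b =
      (\<integral>y. X' y $ a * X' y $ b - (\<integral>z. X' z $ b \<partial>M) * X' y $ a - (\<integral>z. X' z $ a \<partial>M) * X' y $ b
        + (\<integral>z. X' z $ a \<partial>M) * (\<integral>z. X' z $ b \<partial>M) \<partial>M)"
    unfolding cov_matrix_AE_eq[OF meas eq] by (simp add: algebra_simps)
  also have "\<dots> = (\<integral>y. X' y $ a * X' y $ b \<partial>M) - (\<integral>y. X' y $ a \<partial>M) * (\<integral>y. X' y $ b \<partial>M)"
    using int by (simp add: prob_space)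
  finally show ?thesis .
qed

lemma cov_matrix_linear:
  fixes X X' :: "'y \<Rightarrow> real ^ 'd" and B :: "real ^ 'd ^ 'd"
  assumes M: "prob_space M"
    and meas: "\<And>a. (\<lambda>y. X' y $ a) \<in> borel_measurable M" and eq: "AE y in M. X y = X' y"
    and int: "\<And>a. integrable M (\<lambda>y. X' y $ a)" "\<And>a b. integrable M (\<lambda>y. X' y $ a * X' y $ b)"
  shows "cov_matrix M (\<lambda>y. B *v X y) = B ** cov_matrix M X ** transpose B"
proof -
  have comp: "(B *v X' y) $ a = (\<Sum>c\<in>UNIV. B $ a $ c * X' y $ c)" for a y
    by (simp add: matrix_vector_mult_def)
  have prod: "(B *v X' y) $ a * (B *v X' y) $ b =
      (\<Sum>c\<in>UNIV. \<Sum>e\<in>UNIV. (B $ a $ c * B $ b $ e) * (X' y $ c * X' y $ e))" for a b y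
    unfolding comp sum_product by (simp add: ac_simps)
  have intB: "integrable M (\<lambda>y. (B *v X' y) $ a)"
    "integrable M (\<lambda>y. (B *v X' y) $ a * (B *v X' y) $ b)" for a b
    unfolding prod unfolding comp using int by (auto intro!: Bochner_Integration.integrable_sum)
  have eqB: "AE y in M. B *v X y = B *v X' y"
    using eq by eventually_elim simp
  have "cov_matrix M (\<lambda>y. B *v X y) $ a $ b = (B ** cov_matrix M X ** transpose B) $ a $ b" for a b
  proof -
    have "cov_matrix M (\<lambda>y. B *v X y) $ a $ b =
        (\<integral>y. (B *v X' y) $ a * (B *v X' y) $ b \<partial>M) - (\<integral>y. (B *v X' y) $ a \<partial>M) * (\<integral>y. (B *v X' y) $ b \<partial>M)"
      using intB by (intro cov_matrix_expand[OF M _ eqB]) auto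
    also have "(\<integral>y. (B *v X' y) $ a * (B *v X' y) $ b \<partial>M) =
        (\<Sum>c\<in>UNIV. \<Sum>e\<in>UNIV. (B $ a $ c * B $ b $ e) * (\<integral>y. X' y $ c * X' y $ e \<partial>M))"
      unfolding prod using int by (simp add: Bochner_Integration.integral_sum)
    also have "(\<integral>y. (B *v X' y) $ a \<partial>M) * (\<integral>y. (B *v X' y) $ b \<partial>M) =
        (\<Sum>c\<in>UNIV. \<Sum>e\<in>UNIV. (B $ a $ c * B $ b $ e) * ((\<integral>y. X' y $ c \<partial>M) * (\<integral>y. X' y $ e \<partial>M)))"
      unfolding comp using int by (simp add: Bochner_Integration.integral_sum sum_product ac_simps)
    also have "(\<Sum>c\<in>UNIV. \<Sum>e\<in>UNIV. (B $ a $ c * B $ b $ e) * (\<integral>y. X' y $ c * X' y $ e \<partial>M)) - \<dots> =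
        (\<Sum>c\<in>UNIV. \<Sum>e\<in>UNIV. (B $ a $ c * B $ b $ e) * cov_matrix M X $ c $ e)"
      unfolding cov_matrix_expand[OF M meas eq int] by (simp add: sum_subtractf[symmetric] algebra_simps)
    also have "\<dots> = (B ** cov_matrix M X ** transpose B) $ a $ b"
      unfolding matrix_matrix_mult_def transpose_def vec_lambda_beta sum_distrib_right
      by (subst sum.swap) (simp add: ac_simps)
    finally show ?thesis .
  qed
  then show ?thesis by (simp add: vec_eq_iff)
qed

subsection \<open>Supports and product measures\<close>

text \<open>Reconciles the product sigma-algebra on functions with finitely many active coordinates
  with the product topology on the whole function type: on the space, the other coordinates are
  constantly \<open>undefined\<close>. Traces of open sets thereby become measurable, on which the
  construction of supports relies.\<close>

lemma measurable_ident_euclidean_borel: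
  assumes "sets M = sets (euclidean_borel r)"
  shows "(\<lambda>x. x) \<in> borel_measurable M"
proof -
  have [simp]: "space M = (\<Pi>\<^sub>E j\<in>{..<r}. UNIV)"
    using sets_eq_imp_space_eq[OF assms] by (simp add: euclidean_borel_def space_PiM)
  have "(\<lambda>x. x i) \<in> borel_measurable M" for i
  proof (cases "i < r")
    case True
    then have "(\<lambda>x. x i) \<in> borel_measurable (euclidean_borel r)"
      unfolding euclidean_borel_def by (intro measurable_component_singleton) simp
    then show ?thesis using measurable_cong_sets[OF assms refl] by blast
  next
    case False
    then have "(\<lambda>x. x i) \<in> borel_measurable M \<longleftrightarrow> (\<lambda>x. undefined::real) \<in> borel_measurable M"
      by (intro measurable_cong) (auto simp: PiE_def extensional_def)
    then show ?thesis by simp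
  qed
  then show ?thesis by (rule measurable_coordinatewise_then_product)
qed

lemma open_Int_space_sets:
  assumes "(\<lambda>x. x) \<in> borel_measurable M" "open U"
  shows "U \<inter> space M \<in> sets M"
  using measurable_sets[OF assms(1), of U] assms(2) by simp

lemma borel_measurable_indicator_mult_continuous_on:
  fixes g :: "'a::topological_space \<Rightarrow> real"
  assumes ident: "(\<lambda>x. x) \<in> borel_measurable M" and S: "S \<in> sets M" and g: "continuous_on S g"
  shows "(\<lambda>x. indicator S x * g x) \<in> borel_measurable M"
proof -
  have "(\<lambda>x. x) \<in> measurable (restrict_space M S) (restrict_space borel S)"
    by (rule measurable_restrict_space3[OF ident]) auto
  then have "g \<in> borel_measurable (restrict_space M S)"
    using measurable_compose[OF _ borel_measurable_continuous_on_restrict[OF g]] by blast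
  then show ?thesis
    using S sets.sets_into_space[OF S]
    by (subst (asm) borel_measurable_restrict_space_iff) (auto simp: Int_absorb2)
qed

text \<open>\<open>S\<close> is the support of \<open>M\<close> within \<open>Y\<close>: the null
  traces of basic open sets are removed, and a countable basis keeps their union null. If an open
  \<open>U\<close> met \<open>S\<close> in a null set, a basic set inside \<open>U\<close> around a
  common point would have a null trace as well, so that point would have been removed.\<close>

lemma support_within:
  fixes Y :: "'a::second_countable_topology set"
  assumes ident: "(\<lambda>x. x) \<in> borel_measurable M" and Y: "Y \<in> sets M"
  shows "\<exists>S\<in>sets M. S \<subseteq> Y \<and> Y - S \<in> null_sets M \<and>
    (\<forall>U. open U \<longrightarrow> U \<inter> S \<noteq> {} \<longrightarrow> U \<inter> S \<notin> null_sets M)"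
proof -
  obtain \<B> :: "'a set set" where \<B>: "countable \<B>" "topological_basis \<B>"
    using ex_countable_basis by blast
  define \<N> where "\<N> = {B \<in> \<B>. B \<inter> Y \<in> null_sets M}"
  define N where "N = (\<Union>B\<in>\<N>. B \<inter> Y)"
  have N: "N \<in> null_sets M"
    unfolding N_def using \<B>(1) by (intro null_sets_UN') (auto simp: \<N>_def)
  have meas: "U \<inter> Y \<in> sets M" if "open U" for U
    using sets.Int[OF open_Int_space_sets[OF ident that] Y] sets.sets_into_space[OF Y]
    by (simp add: Int_assoc Int_absorb1)
  show ?thesis
  proof (intro bexI[of _ "Y - N"] conjI allI impI notI)
    show "Y - N \<in> sets M" using Y N by auto
    have "Y - (Y - N) = N" by (auto simp: N_def)
    then show "Y - (Y - N) \<in> null_sets M" using N by simp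
  next
    fix U assume U: "open U" "U \<inter> (Y - N) \<noteq> {}" "U \<inter> (Y - N) \<in> null_sets M"
    then obtain x where x: "x \<in> U" "x \<in> Y" "x \<notin> N" by auto
    obtain B where B: "B \<in> \<B>" "x \<in> B" "B \<subseteq> U"
      using topological_basisE[OF \<B>(2) U(1) x(1)] by blast
    have "B \<inter> Y \<subseteq> (U \<inter> (Y - N)) \<union> N" using B by auto
    then have "B \<inter> Y \<in> null_sets M"
      using null_sets_subset[OF null_sets.Un[OF U(3) N] meas] topological_basis_open[OF \<B>(2)] B
      by blast
    then have "x \<in> N" using B x by (auto simp: N_def \<N>_def)
    then show False using x by simp
  qed auto
qed

lemma emeasure_PiM_PiE:
  assumes "finite I" "\<And>i. i \<in> I \<Longrightarrow> prob_space (M i)" "\<And>i. i \<in> I \<Longrightarrow> A i \<in> sets (M i)"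
  shows "emeasure (Pi\<^sub>M I M) (Pi\<^sub>E I A) = (\<Prod>i\<in>I. emeasure (M i) (A i))"
proof -
  have "Pi\<^sub>E I A \<subseteq> (\<Pi>\<^sub>E i\<in>I. space (M i))"
    using assms(3) sets.sets_into_space by (intro PiE_mono) blast
  then have "prod_emb I M I (Pi\<^sub>E I A) = Pi\<^sub>E I A"
    by (rule prod_emb_id)
  then show ?thesis
    using emeasure_PiM_emb[of I M I A] assms by simp
qed

text \<open>An exceptional null set that depends on the function can be removed uniformly: all
  continuous functions vanishing almost everywhere vanish on the same set, the product of the supports.\<close>
lemma continuous_AE_zero_on_support:
  fixes M :: "'i \<Rightarrow> 'a::second_countable_topology measure" and \<phi> :: "('i \<Rightarrow> 'a) \<Rightarrow> real"
  assumes I: "finite I" and prob: "\<And>i. i \<in> I \<Longrightarrow> prob_space (M i)"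
    and ident: "\<And>i. i \<in> I \<Longrightarrow> (\<lambda>x. x) \<in> borel_measurable (M i)"
    and S: "\<And>i. i \<in> I \<Longrightarrow> S i \<in> sets (M i)"
    and supp: "\<And>i U. i \<in> I \<Longrightarrow> open U \<Longrightarrow> U \<inter> S i \<noteq> {} \<Longrightarrow> U \<inter> S i \<notin> null_sets (M i)"
    and cont: "continuous_on (Pi\<^sub>E I S) \<phi>"
    and zero: "AE y in Pi\<^sub>M I M. \<phi> y = 0"
    and y: "y \<in> Pi\<^sub>E I S"
  shows "\<phi> y = 0"
proof (rule ccontr)
  assume nz: "\<phi> y \<noteq> 0"
  obtain V where V: "open V" "V \<inter> Pi\<^sub>E I S = \<phi> -` (- {0}) \<inter> Pi\<^sub>E I S"
    using cont unfolding continuous_on_open_invariant by (metis open_Compl closed_singleton)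
  then have "y \<in> V" using nz y by auto
  then obtain U where U: "y \<in> Pi\<^sub>E UNIV U" "\<And>i. open (U i)" "Pi\<^sub>E UNIV U \<subseteq> V"
    using product_topology_open_contains_basis[of "\<lambda>i. euclidean" UNIV V y] V(1)
    unfolding open_fun_def by (auto simp: open_openin[symmetric])
  \<comment> \<open>Outside \<open>I\<close> all points of the product are \<open>undefined\<close>,
    as \<open>y\<close> is, so the open box around \<open>y\<close> only has to be restricted in the
    coordinates of \<open>I\<close>.\<close>
  define E where "E = Pi\<^sub>E I (\<lambda>i. U i \<inter> S i)"
  have Emeas: "U i \<inter> S i \<in> sets (M i)" if "i \<in> I" for i
    using sets.Int[OF open_Int_space_sets[OF ident[OF that] U(2)] S[OF that], of i]
      sets.sets_into_space[OF S[OF that]]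
    by (simp add: Int_assoc Int_absorb1)
  have E_nz: "\<phi> x \<noteq> 0" if x: "x \<in> E" for x
  proof -
    have "x i \<in> U i" for i
    proof (cases "i \<in> I")
      case True
      then show ?thesis using x by (auto simp: E_def)
    next
      case False
      then have "x i = y i" using x y PiE_arb[of _ I _ i] unfolding E_def by metis
      then show ?thesis using U(1) by auto
    qed
    then have "x \<in> V" using U(3) by auto
    moreover have "x \<in> Pi\<^sub>E I S" using x by (auto simp: E_def PiE_def Pi_def)
    ultimately show ?thesis using V(2) by auto
  qed
  have "E \<in> sets (Pi\<^sub>M I M)"
    unfolding E_def using I Emeas by (intro sets_PiM_I_finite) auto
  moreover have "AE x in Pi\<^sub>M I M. x \<notin> E"
    using zero by eventually_elim (use E_nz in auto)
  ultimately have "emeasure (Pi\<^sub>M I M) E = 0"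
    by (subst (asm) AE_iff_measurable[of E]) (auto dest: sets.sets_into_space)
  then have "(\<Prod>i\<in>I. emeasure (M i) (U i \<inter> S i)) = 0"
    unfolding E_def using emeasure_PiM_PiE[OF I prob Emeas] by simp
  \<comment> \<open>A finite product vanishes only if a factor does, and a null factor contradicts
    full support in that coordinate.\<close>
  then obtain i where i: "i \<in> I" "emeasure (M i) (U i \<inter> S i) = 0"
    using I by (auto simp: prod_zero_iff)
  then have "U i \<inter> S i \<in> null_sets (M i)"
    using Emeas by auto
  moreover have "y i \<in> U i \<inter> S i"
    using U(1) y i by auto
  ultimately show False using supp[OF i(1) U(2)] by blast
qed

text \<open>Agreement on boxes suffices, and there both sides factor because the joint density is a
  product of functions of one coordinate each.\<close>

lemma PiM_density:
  fixes g :: "'i \<Rightarrow> 'a \<Rightarrow> ennreal"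
  assumes I: "finite I" and prob: "\<And>i. i \<in> I \<Longrightarrow> prob_space (M i)"
    and prob': "\<And>i. i \<in> I \<Longrightarrow> prob_space (density (M i) (g i))"
    and g: "\<And>i. i \<in> I \<Longrightarrow> g i \<in> borel_measurable (M i)"
  shows "(\<Pi>\<^sub>M i\<in>I. density (M i) (g i)) = density (Pi\<^sub>M I M) (\<lambda>x. \<Prod>i\<in>I. g i (x i))"
proof -
  \<comment> \<open>A point mass outside \<open>I\<close> makes every member of the family a
    probability space, as the locale \<open>product_prob_space\<close> demands, without changing the
    product over \<open>I\<close>.\<close>
  define M' where "M' i = (if i \<in> I then M i else return (count_space UNIV) undefined)" for i
  define N' where "N' i = (if i \<in> I then density (M i) (g i) else return (count_space UNIV) undefined)" for i
  interpret M': product_prob_space M'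
    unfolding product_prob_space_def product_prob_space_axioms_def product_sigma_finite_def
    using prob by (auto simp: M'_def prob_space_return prob_space_imp_sigma_finite)
  interpret N': product_prob_space N'
    unfolding product_prob_space_def product_prob_space_axioms_def product_sigma_finite_def
    using prob' by (auto simp: N'_def prob_space_return prob_space_imp_sigma_finite)
  have MM': "Pi\<^sub>M I M = Pi\<^sub>M I M'"
    by (intro PiM_cong) (auto simp: M'_def)
  have NN': "(\<Pi>\<^sub>M i\<in>I. density (M i) (g i)) = Pi\<^sub>M I N'"
    by (intro PiM_cong) (auto simp: N'_def)
  have g' [measurable]: "g i \<in> borel_measurable (M' i)" if "i \<in> I" for i
    using g that by (simp add: M'_def)
  have prod_meas: "(\<lambda>x. \<Prod>i\<in>I. g i (x i)) \<in> borel_measurable (Pi\<^sub>M I M')"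
    by measurable
  have "density (Pi\<^sub>M I M') (\<lambda>x. \<Prod>i\<in>I. g i (x i)) = Pi\<^sub>M I N'"
  proof (rule N'.PiM_eqI[OF I])
    show "sets (density (Pi\<^sub>M I M') (\<lambda>x. \<Prod>i\<in>I. g i (x i))) = sets (Pi\<^sub>M I N')"
      unfolding sets_density by (intro sets_PiM_cong) (auto simp: M'_def N'_def)
  next
    fix A assume A: "\<And>i. i \<in> I \<Longrightarrow> A i \<in> sets (N' i)"
    then have A' [measurable]: "A i \<in> sets (M' i)" if "i \<in> I" for i
      using that by (auto simp: M'_def N'_def)
    have PA: "Pi\<^sub>E I A \<in> sets (Pi\<^sub>M I M')"
      using I A' by (intro sets_PiM_I_finite) auto
    have "emeasure (density (Pi\<^sub>M I M') (\<lambda>x. \<Prod>i\<in>I. g i (x i))) (Pi\<^sub>E I A) =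
        (\<integral>\<^sup>+ x. (\<Prod>i\<in>I. g i (x i)) * indicator (Pi\<^sub>E I A) x \<partial>Pi\<^sub>M I M')"
      by (rule emeasure_density[OF prod_meas PA])
    also have "\<dots> = (\<integral>\<^sup>+ x. (\<Prod>i\<in>I. g i (x i) * indicator (A i) (x i)) \<partial>Pi\<^sub>M I M')"
    proof (rule nn_integral_cong)
      fix x assume "x \<in> space (Pi\<^sub>M I M')"
      then have "x \<in> extensional I" by (simp add: space_PiM PiE_def)
      then have "(indicator (Pi\<^sub>E I A) x :: ennreal) = (\<Prod>i\<in>I. indicator (A i) (x i))"
        using I by (auto simp: indicator_def PiE_def Pi_def prod_eq_1_iff intro!: prod_zero prod.neutral)
      then show "(\<Prod>i\<in>I. g i (x i)) * indicator (Pi\<^sub>E I A) x = (\<Prod>i\<in>I. g i (x i) * indicator (A i) (x i))"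
        by (simp add: prod.distrib)
    qed
    also have "\<dots> = (\<Prod>i\<in>I. \<integral>\<^sup>+ x. g i x * indicator (A i) x \<partial>M' i)"
      using I by (intro M'.product_nn_integral_prod) auto
    also have "\<dots> = (\<Prod>i\<in>I. emeasure (N' i) (A i))"
    proof (rule prod.cong[OF refl])
      fix i assume i: "i \<in> I"
      then have "N' i = density (M' i) (g i)" by (simp add: M'_def N'_def)
      then show "(\<integral>\<^sup>+ x. g i x * indicator (A i) x \<partial>M' i) = emeasure (N' i) (A i)"
        using emeasure_density[OF g'[OF i] A'[OF i]] by simp
    qed
    finally show "emeasure (density (Pi\<^sub>M I M') (\<lambda>x. \<Prod>i\<in>I. g i (x i))) (Pi\<^sub>E I A) = (\<Prod>i\<in>I. emeasure (N' i) (A i))" .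
  qed
  then show ?thesis by (simp add: MM' NN')
qed

subsection \<open>Partial derivatives\<close>

lemma partial_exists_iff_has_real_derivative:
  fixes g :: "real ^ 'd \<Rightarrow> real"
  shows "partial_exists j g \<tau> \<longleftrightarrow>
    ((\<lambda>t. g (\<tau> + t *\<^sub>R axis j 1)) has_real_derivative partial j g \<tau>) (at 0)"
  unfolding partial_exists_def partial_def has_real_derivative_iff_has_vector_derivative
  by (metis differentiableI_vector vector_derivative_works)

lemma has_real_derivative_imp_partial:
  fixes g :: "real ^ 'd \<Rightarrow> real"
  assumes "((\<lambda>t. g (\<tau> + t *\<^sub>R axis j 1)) has_real_derivative D) (at 0)"
  shows "partial j g \<tau> = D"
  using assms unfolding partial_def has_real_derivative_iff_has_vector_derivative
  by (rule vector_derivative_at)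

lemma partial_exists_has_real_derivative_at:
  fixes g :: "real ^ 'd \<Rightarrow> real"
  assumes "partial_exists j g (\<tau> + s *\<^sub>R axis j 1)"
  shows "((\<lambda>t. g (\<tau> + t *\<^sub>R axis j 1)) has_real_derivative partial j g (\<tau> + s *\<^sub>R axis j 1)) (at s)"
proof -
  have "((\<lambda>t. g (\<tau> + s *\<^sub>R axis j 1 + t *\<^sub>R axis j 1)) has_real_derivative
      partial j g (\<tau> + s *\<^sub>R axis j 1)) (at 0)"
    using assms by (simp only: partial_exists_iff_has_real_derivative)
  then have "((\<lambda>t. g (\<tau> + (t + s) *\<^sub>R axis j 1)) has_real_derivative
      partial j g (\<tau> + s *\<^sub>R axis j 1)) (at 0)"
    by (simp add: algebra_simps)
  then show ?thesis
    using DERIV_shift[of "\<lambda>t. g (\<tau> + t *\<^sub>R axis j 1)" "partial j g (\<tau> + s *\<^sub>R axis j 1)" 0 s] by simp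
qed

lemma eventually_line_in_open:
  fixes U :: "(real ^ 'd) set"
  assumes "open U" "\<tau> \<in> U"
  shows "\<forall>\<^sub>F t in nhds 0. \<tau> + t *\<^sub>R axis j 1 \<in> U"
proof -
  have "((\<lambda>t. \<tau> + t *\<^sub>R axis j 1) \<longlongrightarrow> \<tau> + 0 *\<^sub>R axis j 1) (nhds (0::real))"
    by (intro tendsto_intros filterlim_ident)
  then show ?thesis
    using topological_tendstoD[OF _ assms(1)] assms(2) by auto
qed

lemma partial_cong_open:
  fixes g h :: "real ^ 'd \<Rightarrow> 'b::real_normed_vector"
  assumes "open U" "\<tau> \<in> U" and eq: "\<And>\<sigma>. \<sigma> \<in> U \<Longrightarrow> g \<sigma> = h \<sigma>"
  shows "partial j g \<tau> = partial j h \<tau>"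
proof -
  have "\<forall>\<^sub>F t in nhds 0. g (\<tau> + t *\<^sub>R axis j 1) = h (\<tau> + t *\<^sub>R axis j 1)"
    using eventually_line_in_open[OF assms(1,2), of j] by eventually_elim (rule eq)
  then show ?thesis
    unfolding partial_def by (intro vector_derivative_cong_eq) (auto elim: eventually_mono)
qed

lemma partial_vec_lambda:
  fixes G :: "'m::finite \<Rightarrow> real ^ 'd \<Rightarrow> real"
  assumes "\<And>m. ((\<lambda>t. G m (\<tau> + t *\<^sub>R axis j 1)) has_real_derivative G' m) (at 0)"
  shows "partial j (\<lambda>\<tau>. \<chi> m. G m \<tau>) \<tau> = (\<chi> m. G' m)"
proof -
  have "((\<lambda>t. \<chi> m. G m (\<tau> + t *\<^sub>R axis j 1)) has_vector_derivative (\<chi> m. G' m)) (at 0)"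
    unfolding has_vector_derivative_def
  proof (subst has_derivative_componentwise_within, rule ballI)
    fix b :: "real ^ 'm" assume "b \<in> Basis"
    then obtain m where b: "b = axis m 1" by (auto simp: Basis_vec_def)
    have "((\<lambda>t. G m (\<tau> + t *\<^sub>R axis j 1)) has_derivative (\<lambda>h. h * G' m)) (at 0)"
      using assms[of m] by (simp add: has_field_derivative_def mult_commute_abs)
    then show "((\<lambda>t. (\<chi> m. G m (\<tau> + t *\<^sub>R axis j 1)) \<bullet> b) has_derivative (\<lambda>x. (x *\<^sub>R (\<chi> m. G' m)) \<bullet> b)) (at 0)"
      by (simp add: b inner_axis)
  qed
  then show ?thesis
    unfolding partial_def by (rule vector_derivative_at)
qed

text \<open>Agreement of \<open>F\<close> with its formula at a single point says nothing about
  derivatives, so the induction carries the identity on the whole open set \<open>U\<close>.\<close>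

lemma iterated_partial_vec_lambda:
  fixes G :: "'m::finite \<Rightarrow> nat \<Rightarrow> real ^ 'd \<Rightarrow> real" and F :: "real ^ 'd \<Rightarrow> real ^ 'm"
  assumes U: "open U"
    and F: "\<And>\<tau>. \<tau> \<in> U \<Longrightarrow> F \<tau> = (\<chi> m. G m 0 \<tau>)"
    and deriv: "\<And>m l \<tau>. l < L \<Longrightarrow> \<tau> \<in> U \<Longrightarrow>
      ((\<lambda>t. G m l (\<tau> + t *\<^sub>R axis j 1)) has_real_derivative G m (Suc l) \<tau>) (at 0)"
    and "\<tau> \<in> U" "l \<le> L"
  shows "(partial j ^^ l) F \<tau> = (\<chi> m. G m l \<tau>)"
  using assms(4,5)
proof (induction l arbitrary: \<tau>)
  case 0
  then show ?case using F by simp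
next
  case (Suc l)
  have "(partial j ^^ Suc l) F \<tau> = partial j ((partial j ^^ l) F) \<tau>"
    by simp
  also have "\<dots> = partial j (\<lambda>\<tau>. \<chi> m. G m l \<tau>) \<tau>"
    using Suc by (intro partial_cong_open[OF U]) auto
  also have "\<dots> = (\<chi> m. G m (Suc l) \<tau>)"
    using Suc deriv by (intro partial_vec_lambda) auto
  finally show ?case .
qed

lemma partials_replicate_Suc:
  "partials (replicate (Suc l) j @ [m]) g = partial j (partials (replicate l j @ [m]) g)"
  by (simp add: partials_def)

text \<open>Since \<open>foldr\<close> applies the last list entry first,
  \<open>replicate l j @ [m]\<close> takes the gradient component \<open>m\<close> and then
  \<open>l\<close> derivatives in direction \<open>j\<close>. The list has length
  \<open>l + 1\<close>, so \<open>l < K\<close> keeps its order within \<open>K\<close>.\<close>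

lemma iterated_partial_score_obs:
  fixes ell :: "nat \<Rightarrow> real ^ 'd \<Rightarrow> obs \<Rightarrow> real"
  assumes U: "open U"
    and ex: "\<And>js j \<tau>. length js < K \<Longrightarrow> \<tau> \<in> U \<Longrightarrow> partial_exists j (partials js (\<lambda>t. ell i t y)) \<tau>"
    and "\<tau> \<in> U" "l < K"
  shows "(partial j ^^ l) (\<lambda>t. score_obs ell i t y) \<tau> =
    (\<chi> m. partials (replicate l j @ [m]) (\<lambda>t. ell i t y) \<tau>)"
proof (rule iterated_partial_vec_lambda[OF U _ _ assms(3), where L = "K - 1"
      and G = "\<lambda>m l. partials (replicate l j @ [m]) (\<lambda>t. ell i t y)"])
  fix \<tau>
  show "score_obs ell i \<tau> y = (\<chi> m. partials (replicate 0 j @ [m]) (\<lambda>t. ell i t y) \<tau>)"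
    by (simp add: score_obs_def grad_def partials_def)
next
  fix m l \<tau> assume "l < K - 1" "\<tau> \<in> U"
  then show "((\<lambda>t. partials (replicate l j @ [m]) (\<lambda>t. ell i t y) (\<tau> + t *\<^sub>R axis j 1))
      has_real_derivative partials (replicate (Suc l) j @ [m]) (\<lambda>t. ell i t y) \<tau>) (at 0)"
    unfolding partials_replicate_Suc partial_exists_iff_has_real_derivative[symmetric]
    by (intro ex) auto
qed (use assms in auto)

lemma iterated_partial_score:
  fixes ell :: "nat \<Rightarrow> real ^ 'd \<Rightarrow> obs \<Rightarrow> real"
  assumes U: "open U"
    and ex: "\<And>i js j \<tau>. i \<in> {1..n} \<Longrightarrow> length js < K \<Longrightarrow> \<tau> \<in> U \<Longrightarrow>
      partial_exists j (partials js (\<lambda>t. ell i t (y i))) \<tau>"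
    and "\<tau> \<in> U" "l < K"
  shows "(partial j ^^ l) (\<lambda>t. score ell n t y) \<tau> =
    (\<chi> m. \<Sum>i=1..n. partials (replicate l j @ [m]) (\<lambda>t. ell i t (y i)) \<tau>)"
proof (rule iterated_partial_vec_lambda[OF U _ _ assms(3), where L = "K - 1"
      and G = "\<lambda>m l \<tau>. \<Sum>i=1..n. partials (replicate l j @ [m]) (\<lambda>t. ell i t (y i)) \<tau>"])
  fix \<tau> assume \<tau>: "\<tau> \<in> U"
  have "partial m (\<lambda>t. loglik ell n t y) \<tau> = (\<Sum>i=1..n. partial m (\<lambda>t. ell i t (y i)) \<tau>)" for m
    unfolding loglik_def
  proof (rule has_real_derivative_imp_partial, rule DERIV_sum)
    fix i assume "i \<in> {1..n}"
    then show "((\<lambda>t. ell i (\<tau> + t *\<^sub>R axis m 1) (y i)) has_real_derivative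
        partial m (\<lambda>t. ell i t (y i)) \<tau>) (at 0)"
      using ex[of i "[]" \<tau> m] assms(4) \<tau>
      by (simp add: partials_def partial_exists_iff_has_real_derivative)
  qed
  then show "score ell n \<tau> y = (\<chi> m. \<Sum>i=1..n. partials (replicate 0 j @ [m]) (\<lambda>t. ell i t (y i)) \<tau>)"
    by (simp add: score_def grad_def partials_def)
next
  fix m l \<tau> assume "l < K - 1" "\<tau> \<in> U"
  then show "((\<lambda>t. \<Sum>i=1..n. partials (replicate l j @ [m]) (\<lambda>t. ell i t (y i)) (\<tau> + t *\<^sub>R axis j 1))
      has_real_derivative (\<Sum>i=1..n. partials (replicate (Suc l) j @ [m]) (\<lambda>t. ell i t (y i)) \<tau>)) (at 0)"
    unfolding partials_replicate_Suc
    by (intro DERIV_sum) (auto simp: partial_exists_iff_has_real_derivative[symmetric] intro!: ex)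
qed (use assms in auto)

text \<open>The coordinates are moved one at a time; each move changes the value by at most
  \<open>M * norm \<delta>\<close> by the mean value theorem.\<close>
lemma bounded_partials_Lipschitz:
  fixes g :: "real ^ 'd \<Rightarrow> real"
  assumes ex: "\<And>j \<tau>. \<tau> \<in> ball \<theta> e \<Longrightarrow> partial_exists j g \<tau>"
    and bound: "\<And>j \<tau>. \<tau> \<in> ball \<theta> e \<Longrightarrow> \<bar>partial j g \<tau>\<bar> \<le> M"
    and \<delta>: "norm \<delta> < e"
  shows "\<bar>g (\<theta> + \<delta>) - g \<theta>\<bar> \<le> real CARD('d) * M * norm \<delta>"
proof -
  define pt where "pt A = (\<chi> i. \<theta> $ i + (if i \<in> A then \<delta> $ i else 0))" for A
  have M0: "0 \<le> M"
  proof -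
    have "0 < e" using \<delta> norm_ge_zero[of \<delta>] by linarith
    then show ?thesis using bound[of \<theta> undefined] by auto
  qed
  have "\<bar>g (pt A) - g \<theta>\<bar> \<le> real (card A) * M * norm \<delta>" for A :: "'d set"
    using finite[of A]
  proof (induction A rule: finite_induct)
    case empty
    have "pt {} = \<theta>" by (simp add: pt_def vec_eq_iff)
    then show ?case by simp
  next
    case (insert j A)
    define h where "h t = g (pt A + t *\<^sub>R axis j 1)" for t :: real
    have pt_insert: "pt A + (\<delta> $ j) *\<^sub>R axis j 1 = pt (insert j A)"
      using insert by (auto simp: pt_def vec_eq_iff axis_def)
    \<comment> \<open>Intermediate corners stay in the ball because no coordinate deviates from
      \<open>\<theta>\<close> by more than that of \<open>\<delta>\<close>.\<close>
    have in_ball: "pt A + t *\<^sub>R axis j 1 \<in> ball \<theta> e" if "\<bar>t\<bar> \<le> \<bar>\<delta> $ j\<bar>" for t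
    proof -
      have "norm (\<theta> - (pt A + t *\<^sub>R axis j 1)) \<le> norm \<delta>"
        using that insert by (intro norm_le_componentwise_cart) (auto simp: pt_def axis_def)
      then show ?thesis using \<delta> by (simp add: dist_norm)
    qed
    have deriv: "(h has_real_derivative partial j g (pt A + t *\<^sub>R axis j 1)) (at t)"
      if "\<bar>t\<bar> \<le> \<bar>\<delta> $ j\<bar>" for t
      unfolding h_def using that by (intro partial_exists_has_real_derivative_at ex in_ball)
    have "norm (h (\<delta> $ j) - h 0) \<le> M * norm (\<delta> $ j - 0)"
    proof (rule field_differentiable_bound[of "cball 0 \<bar>\<delta> $ j\<bar>"])
      show "(h has_real_derivative partial j g (pt A + t *\<^sub>R axis j 1)) (at t within cball 0 \<bar>\<delta> $ j\<bar>)"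
        if "t \<in> cball 0 \<bar>\<delta> $ j\<bar>" for t
        using that by (auto intro: has_field_derivative_at_within[OF deriv])
      show "norm (partial j g (pt A + t *\<^sub>R axis j 1)) \<le> M" if "t \<in> cball 0 \<bar>\<delta> $ j\<bar>" for t
        unfolding real_norm_def using that by (intro bound in_ball) simp
    qed auto
    also have "\<dots> \<le> M * norm \<delta>"
      using M0 component_le_norm_cart[of \<delta> j] by (simp add: mult_left_mono)
    finally have "\<bar>g (pt (insert j A)) - g (pt A)\<bar> \<le> M * norm \<delta>"
      by (simp add: h_def pt_insert)
    then show ?case using insert by (simp add: algebra_simps)
  qed
  moreover have "pt UNIV = \<theta> + \<delta>"
    by (simp add: pt_def vec_eq_iff)
  ultimately show ?thesis
    by metis
qed

text \<open>The smoothness condition states continuity of the partials of order at least 1;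
  continuity of the log-density itself in the parameter, on which convergence of the densities
  rests, is derived here. Continuous partials are bounded near the point, which gives a linear bound
  on the increments of \<open>g\<close>.\<close>

lemma continuous_partials_imp_continuous:
  fixes g :: "real ^ 'd \<Rightarrow> real"
  assumes U: "open U" "\<theta> \<in> U"
    and ex: "\<And>j \<tau>. \<tau> \<in> U \<Longrightarrow> partial_exists j g \<tau>"
    and cont: "\<And>j. continuous_on U (partial j g)"
  shows "isCont g \<theta>"
proof -
  define M where "M = (\<Sum>j\<in>UNIV. \<bar>partial j g \<theta>\<bar>) + 1"
  have "\<forall>\<^sub>F \<tau> in nhds \<theta>. \<bar>partial j g \<tau>\<bar> < M" for j
  proof -
    have "isCont (partial j g) \<theta>"
      using cont U continuous_on_eq_continuous_at by blast
    then have "((\<lambda>\<tau>. \<bar>partial j g \<tau>\<bar>) \<longlongrightarrow> \<bar>partial j g \<theta>\<bar>) (nhds \<theta>)"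
      by (intro tendsto_rabs) (simp add: isCont_def tendsto_at_iff_tendsto_nhds)
    moreover have "\<bar>partial j g \<theta>\<bar> < M"
      using member_le_sum[of j UNIV "\<lambda>j. \<bar>partial j g \<theta>\<bar>"] by (simp add: M_def)
    ultimately show ?thesis by (rule order_tendstoD)
  qed
  then have "\<forall>\<^sub>F \<tau> in nhds \<theta>. (\<forall>j. \<bar>partial j g \<tau>\<bar> < M) \<and> \<tau> \<in> U"
    using U by (intro eventually_conj eventually_all_finite eventually_nhds_in_open) auto
  then obtain e where e: "0 < e" "\<And>\<tau>. dist \<tau> \<theta> < e \<Longrightarrow> (\<forall>j. \<bar>partial j g \<tau>\<bar> < M) \<and> \<tau> \<in> U"
    unfolding eventually_nhds_metric by blast
  have "\<forall>\<^sub>F \<delta> in at 0. norm (g (\<theta> + \<delta>) - g \<theta>) \<le> real CARD('d) * M * norm \<delta>"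
  proof -
    have "\<forall>\<^sub>F \<delta> in at 0. norm (\<delta> :: real ^ 'd) < e"
      using e(1) by (auto simp: eventually_at dist_norm)
    then show ?thesis
    proof eventually_elim
      case (elim \<delta>)
      show ?case
        unfolding real_norm_def
        by (rule bounded_partials_Lipschitz[of \<theta> e])
          (use e elim ex in \<open>auto simp: dist_commute less_imp_le\<close>)
    qed
  qed
  moreover have "((\<lambda>\<delta>. real CARD('d) * M * norm \<delta>) \<longlongrightarrow> 0) (at (0 :: real ^ 'd))"
    by (intro tendsto_eq_intros) auto
  ultimately have "((\<lambda>\<delta>. g (\<theta> + \<delta>) - g \<theta>) \<longlongrightarrow> 0) (at 0)"
    by (rule Lim_null_comparison)
  then have "((\<lambda>\<delta>. g (\<theta> + \<delta>)) \<longlongrightarrow> g \<theta>) (at 0)"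
    by (rule LIM_zero_cancel)
  then show ?thesis
    by (simp add: isCont_iff)
qed

subsection \<open>Regular points\<close>

lemma continuous_on_curried_compose:
  assumes "continuous_on (A \<times> B) (\<lambda>(x, y). g x y)"
    and "continuous_on D h" "continuous_on D k" "\<And>x. x \<in> D \<Longrightarrow> h x \<in> A" "\<And>x. x \<in> D \<Longrightarrow> k x \<in> B"
  shows "continuous_on D (\<lambda>x. g (h x) (k x))"
proof -
  have "continuous_on D (\<lambda>x. (h x, k x))"
    using assms by (intro continuous_intros)
  moreover have "(\<lambda>x. (h x, k x)) ` D \<subseteq> A \<times> B"
    using assms by auto
  ultimately show ?thesis
    using continuous_on_compose2[OF assms(1)] by fastforce
qed

text \<open>The product is at most the square of the larger factor. For \<open>p > 2\<close> this
  turns moments of order \<open>p\<close> of score components into moments of order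
  \<open>p / 2 > 1\<close> of their products.\<close>

lemma abs_mult_powr_half_le:
  fixes x z :: real
  assumes "0 < p"
  shows "\<bar>x * z\<bar> powr (p / 2) \<le> \<bar>x\<bar> powr p + \<bar>z\<bar> powr p"
proof -
  define c where "c = max \<bar>x\<bar> \<bar>z\<bar>"
  have c: "\<bar>x\<bar> \<le> c" "\<bar>z\<bar> \<le> c" "0 \<le> c"
    by (auto simp: c_def)
  have "\<bar>x * z\<bar> powr (p / 2) \<le> (c * c) powr (p / 2)"
    unfolding abs_mult using assms c by (intro powr_mono2 mult_mono) auto
  also have "\<dots> = c powr p"
    using c by (simp add: powr_mult powr_add[symmetric])
  also have "\<dots> \<le> \<bar>x\<bar> powr p + \<bar>z\<bar> powr p"
    by (auto simp: c_def max_def)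
  finally show ?thesis .
qed

lemma powr_half_le:
  fixes x :: real
  assumes "0 < p"
  shows "\<bar>x\<bar> powr (p / 2) \<le> 1 + \<bar>x\<bar> powr p"
  using abs_mult_powr_half_le[OF assms, of x 1] by simp

text \<open>One constant serves both estimates: 1 is the total mass that enters for \<open>X\<close>
  alone, and \<open>2 * C\<close> comes from the two factors of the product.\<close>

lemma nn_integral_powr_half_le:
  fixes X Z :: "'y \<Rightarrow> real"
  assumes M: "prob_space M" and p: "0 < p" and C: "0 \<le> C"
    and [measurable]: "X \<in> borel_measurable M" "Z \<in> borel_measurable M"
    and X: "(\<integral>\<^sup>+ y. ennreal (\<bar>X y\<bar> powr p) \<partial>M) \<le> ennreal C"
    and Z: "(\<integral>\<^sup>+ y. ennreal (\<bar>Z y\<bar> powr p) \<partial>M) \<le> ennreal C"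
  shows "(\<integral>\<^sup>+ y. ennreal (\<bar>X y\<bar> powr (p / 2)) \<partial>M) \<le> ennreal (1 + 2 * C)"
    "(\<integral>\<^sup>+ y. ennreal (\<bar>X y * Z y\<bar> powr (p / 2)) \<partial>M) \<le> ennreal (1 + 2 * C)"
proof -
  interpret prob_space M by fact
  have "(\<integral>\<^sup>+ y. ennreal (\<bar>X y\<bar> powr (p / 2)) \<partial>M) \<le> (\<integral>\<^sup>+ y. 1 + ennreal (\<bar>X y\<bar> powr p) \<partial>M)"
    using powr_half_le[OF p]
    by (intro nn_integral_mono) (simp add: ennreal_plus[symmetric] ennreal_leI del: ennreal_plus flip: ennreal_1)
  also have "\<dots> \<le> 1 + ennreal C"
    using X by (simp add: nn_integral_add emeasure_space_1)
  also have "\<dots> \<le> ennreal (1 + 2 * C)"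
    using C by (simp add: ennreal_leI flip: ennreal_1 ennreal_plus)
  finally show "(\<integral>\<^sup>+ y. ennreal (\<bar>X y\<bar> powr (p / 2)) \<partial>M) \<le> ennreal (1 + 2 * C)" .
  have "(\<integral>\<^sup>+ y. ennreal (\<bar>X y * Z y\<bar> powr (p / 2)) \<partial>M) \<le>
      (\<integral>\<^sup>+ y. ennreal (\<bar>X y\<bar> powr p) + ennreal (\<bar>Z y\<bar> powr p) \<partial>M)"
    using abs_mult_powr_half_le[OF p]
    by (intro nn_integral_mono) (simp add: ennreal_leI flip: ennreal_plus)
  also have "\<dots> \<le> ennreal C + ennreal C"
    using X Z by (simp add: nn_integral_add add_mono)
  also have "\<dots> \<le> ennreal (1 + 2 * C)"
    using C by (simp add: ennreal_leI flip: ennreal_plus)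
  finally show "(\<integral>\<^sup>+ y. ennreal (\<bar>X y * Z y\<bar> powr (p / 2)) \<partial>M) \<le> ennreal (1 + 2 * C)" .
qed

text \<open>The local situation at \<open>\<theta>0\<close>. The sets \<open>S\<close> are meant to
  be the same for all base points, whereas the radius \<open>e\<close>, the exponent
  \<open>p\<close> (in place of 2 + \<delta>), the order \<open>K\<close> (in place of
  \<open>k\<close>) and the moment bounds \<open>C\<close> vary with \<open>\<theta>0\<close>. By
  \<open>supp\<close>, an open set that meets \<open>S i\<close> has positive mass in it under every
  parameter.\<close>

locale regular_point =
  fixes \<Theta> :: "(real ^ 'd) set" and \<gamma> :: "nat \<Rightarrow> obs measure"
    and f ell :: "nat \<Rightarrow> real ^ 'd \<Rightarrow> obs \<Rightarrow> real" and n :: nat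
    and S :: "nat \<Rightarrow> obs set" and \<theta>0 :: "real ^ 'd" and e p :: real and K :: nat
    and C :: "'d list \<Rightarrow> real"
  assumes \<theta>0: "\<theta>0 \<in> \<Theta>" and e: "0 < e" and p: "2 < p" and K: "2 \<le> K"
    and prob: "\<And>i \<theta>. i \<in> {1..n} \<Longrightarrow> \<theta> \<in> \<Theta> \<Longrightarrow> prob_space (law \<gamma> f i \<theta>)"
    and ident: "\<And>i. i \<in> {1..n} \<Longrightarrow> (\<lambda>x. x) \<in> borel_measurable (\<gamma> i)"
    and S_sets: "\<And>i. i \<in> {1..n} \<Longrightarrow> S i \<in> sets (\<gamma> i)"
    and S_AE: "\<And>i \<theta>. i \<in> {1..n} \<Longrightarrow> \<theta> \<in> \<Theta> \<Longrightarrow> AE y in law \<gamma> f i \<theta>. y \<in> S i"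
    and supp: "\<And>i \<theta> U. i \<in> {1..n} \<Longrightarrow> \<theta> \<in> \<Theta> \<Longrightarrow> open U \<Longrightarrow> U \<inter> S i \<noteq> {} \<Longrightarrow>
      U \<inter> S i \<notin> null_sets (law \<gamma> f i \<theta>)"
    and f_meas: "\<And>i \<theta>. i \<in> {1..n} \<Longrightarrow> \<theta> \<in> \<Theta> \<Longrightarrow> f i \<theta> \<in> borel_measurable (\<gamma> i)"
    and f_nonneg: "\<And>i \<theta> y. i \<in> {1..n} \<Longrightarrow> \<theta> \<in> \<Theta> \<Longrightarrow> y \<in> space (\<gamma> i) \<Longrightarrow> 0 \<le> f i \<theta> y"
    and f_pos: "\<And>i \<theta> y. i \<in> {1..n} \<Longrightarrow> \<theta> \<in> \<Theta> \<Longrightarrow> \<theta> \<in> ball \<theta>0 e \<Longrightarrow> y \<in> S i \<Longrightarrow> 0 < f i \<theta> y"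
    and ell_eq: "\<And>i \<theta> y. i \<in> {1..n} \<Longrightarrow> \<theta> \<in> \<Theta> \<Longrightarrow> \<theta> \<in> ball \<theta>0 e \<Longrightarrow> y \<in> S i \<Longrightarrow>
      ell i \<theta> y = ln (f i \<theta> y)"
    and ex: "\<And>i js j \<tau> y. i \<in> {1..n} \<Longrightarrow> length js < K \<Longrightarrow> \<tau> \<in> ball \<theta>0 e \<Longrightarrow> y \<in> S i \<Longrightarrow>
      partial_exists j (partials js (\<lambda>t. ell i t y)) \<tau>"
    and cont: "\<And>i js. i \<in> {1..n} \<Longrightarrow> 1 \<le> length js \<Longrightarrow> length js \<le> K \<Longrightarrow>
      continuous_on (ball \<theta>0 e \<times> S i) (\<lambda>(\<tau>, y). partials js (\<lambda>t. ell i t y) \<tau>)"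
    and C_nonneg: "\<And>js. 0 \<le> C js"
    and moments: "\<And>i js \<theta> \<tau>. i \<in> {1..n} \<Longrightarrow> length js \<le> K \<Longrightarrow> \<theta> \<in> \<Theta> \<Longrightarrow> \<theta> \<in> ball \<theta>0 e \<Longrightarrow>
      \<tau> \<in> ball \<theta>0 e \<Longrightarrow>
      (\<integral>\<^sup>+ y. ennreal (\<bar>partials js (\<lambda>t. ell i t y) \<tau>\<bar> powr p) \<partial>law \<gamma> f i \<theta>) \<le> ennreal (C js)"
begin

abbreviation J where "J \<equiv> joint_law \<gamma> f n"

definition Y :: "(nat \<Rightarrow> obs) set" where "Y = Pi\<^sub>E {1..n} S"

text \<open>An explicit form of the \<open>l\<close>th derivative of the score in direction
  \<open>j\<close>. It agrees with \<open>partial j ^^ l\<close> on the ball and on \<open>Y\<close>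
  for \<open>l < K\<close>, and inherits joint continuity directly from the scalar partials.\<close>

definition score_deriv :: "'d \<Rightarrow> nat \<Rightarrow> real ^ 'd \<Rightarrow> (nat \<Rightarrow> obs) \<Rightarrow> real ^ 'd" where
  "score_deriv j l \<tau> y = (\<chi> m. \<Sum>i=1..n. partials (replicate l j @ [m]) (\<lambda>t. ell i t (y i)) \<tau>)"

lemma sets_law [simp]: "sets (law \<gamma> f i \<theta>) = sets (\<gamma> i)"
  and space_law [simp]: "space (law \<gamma> f i \<theta>) = space (\<gamma> i)"
  by (simp_all add: law_def)

lemma ident_law: "i \<in> {1..n} \<Longrightarrow> (\<lambda>x. x) \<in> borel_measurable (law \<gamma> f i \<theta>)"
  using ident by (simp add: law_def)

lemma prob_J: "\<theta> \<in> \<Theta> \<Longrightarrow> prob_space (J \<theta>)"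
  unfolding joint_law_def using prob by (intro prob_space_PiM) auto

lemma Y_sets: "Y \<in> sets (J \<theta>)"
  unfolding Y_def joint_law_def using S_sets by (intro sets_PiM_I_finite) auto

lemma Y_AE:
  assumes "\<theta> \<in> \<Theta>"
  shows "AE y in J \<theta>. y \<in> Y"
proof -
  have "AE y in J \<theta>. \<forall>i\<in>{1..n}. y i \<in> S i"
    unfolding joint_law_def using assms prob S_AE
    by (intro AE_finite_allI AE_PiM_component) auto
  moreover have "AE y in J \<theta>. y \<in> extensional {1..n}"
    by (intro AE_I2) (auto simp: joint_law_def space_PiM PiE_def)
  ultimately show ?thesis
    by eventually_elim (auto simp: Y_def PiE_def)
qed

lemma Y_component: "y \<in> Y \<Longrightarrow> i \<in> {1..n} \<Longrightarrow> y i \<in> S i"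
  unfolding Y_def by (rule PiE_mem)

lemma component_measurable:
  assumes "i \<in> {1..n}"
  shows "(\<lambda>y. y i) \<in> measurable (J \<theta>) (law \<gamma> f i \<theta>)"
  unfolding joint_law_def by (rule measurable_component_singleton[OF assms])

lemma ident_J: "(\<lambda>y. y) \<in> borel_measurable (J \<theta>)"
proof (rule measurable_coordinatewise_then_product)
  fix i
  show "(\<lambda>y. y i) \<in> borel_measurable (J \<theta>)"
  proof (cases "i \<in> {1..n}")
    case True
    from measurable_compose[OF component_measurable[OF True] ident_law[OF True]] show ?thesis .
  next
    case False
    then have "(\<lambda>y. y i) \<in> borel_measurable (J \<theta>) \<longleftrightarrow> (\<lambda>y. undefined :: obs) \<in> borel_measurable (J \<theta>)"
      by (intro measurable_cong) (auto simp: joint_law_def space_PiM PiE_def extensional_def)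
    then show ?thesis by simp
  qed
qed

lemma score_deriv_eq:
  assumes "y \<in> Y" "\<tau> \<in> ball \<theta>0 e" "l < K"
  shows "(partial j ^^ l) (\<lambda>t. score ell n t y) \<tau> = score_deriv j l \<tau> y"
  unfolding score_deriv_def
proof (rule iterated_partial_score[OF open_ball _ assms(2,3)])
  fix i and js :: "'d list" and j \<tau> assume "i \<in> {1..n}" "length js < K" "\<tau> \<in> ball \<theta>0 e"
  then show "partial_exists j (partials js (\<lambda>t. ell i t (y i))) \<tau>"
    by (intro ex Y_component[OF assms(1)])
qed

lemma score_eq:
  assumes "y \<in> Y" "\<tau> \<in> ball \<theta>0 e"
  shows "score ell n \<tau> y = score_deriv j 0 \<tau> y"
  using score_deriv_eq[of y \<tau> 0 j] assms K by simp

lemma sum_score_obs_deriv_eq: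
  assumes "y \<in> Y" "\<tau> \<in> ball \<theta>0 e" "l < K"
  shows "(\<Sum>i=1..n. (partial j ^^ l) (\<lambda>t. score_obs ell i t (y i)) \<tau>) = score_deriv j l \<tau> y"
proof -
  have "(partial j ^^ l) (\<lambda>t. score_obs ell i t (y i)) \<tau> =
      (\<chi> m. partials (replicate l j @ [m]) (\<lambda>t. ell i t (y i)) \<tau>)" if "i \<in> {1..n}" for i
    using assms(2,3) ex[OF that _ _ Y_component[OF assms(1) that]]
    by (intro iterated_partial_score_obs[OF open_ball])
  then show ?thesis
    by (simp add: score_deriv_def vec_eq_iff)
qed

lemma score_deriv_continuous:
  assumes "l < K"
  shows "continuous_on (ball \<theta>0 e \<times> Y) (\<lambda>(\<tau>, y). score_deriv j l \<tau> y \<bullet> w)"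
proof -
  have term_cont: "continuous_on (ball \<theta>0 e \<times> Y) (\<lambda>x. partials (replicate l j @ [m]) (\<lambda>t. ell i t (snd x i)) (fst x))"
    if i: "i \<in> {1..n}" for i m
  proof -
    show ?thesis
    proof (rule continuous_on_curried_compose[OF cont[OF i, of "replicate l j @ [m]"],
          where h = fst and k = "\<lambda>x. snd x i"])
      show "continuous_on (ball \<theta>0 e \<times> Y) fst"
        by (rule continuous_on_fst[OF continuous_on_id])
      show "continuous_on (ball \<theta>0 e \<times> Y) (\<lambda>x. snd x i)"
        by (rule continuous_on_compose2[OF continuous_on_product_coordinates
              continuous_on_snd[OF continuous_on_id]]) simp
    qed (use assms Y_component[OF _ i] in \<open>auto simp del: atLeastAtMost_iff\<close>)
  qed
  show ?thesis
    unfolding score_deriv_def inner_vec_def case_prod_unfold vec_lambda_beta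
    by (intro continuous_on_sum continuous_on_inner continuous_on_const term_cont)
qed

lemma score_deriv_continuous_fixed:
  assumes "l < K" "\<tau> \<in> ball \<theta>0 e"
  shows "continuous_on Y (\<lambda>y. score_deriv j l \<tau> y \<bullet> w)"
  by (rule continuous_on_curried_compose[OF score_deriv_continuous[OF assms(1)],
        where h = "\<lambda>_. \<tau>" and k = "\<lambda>z. z", OF continuous_on_const continuous_on_id assms(2)])

lemma score_deriv_measurable:
  assumes "l < K" "\<tau> \<in> ball \<theta>0 e"
  shows "(\<lambda>y. indicator Y y * (score_deriv j l \<tau> y \<bullet> w)) \<in> borel_measurable (J \<theta>)"
  by (rule borel_measurable_indicator_mult_continuous_on[OF ident_J Y_sets score_deriv_continuous_fixed[OF assms]])

lemma score_deriv_has_derivative: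
  assumes "y \<in> Y" "Suc l < K" "\<tau> + s *\<^sub>R axis j 1 \<in> ball \<theta>0 e"
  shows "((\<lambda>t. score_deriv j l (\<tau> + t *\<^sub>R axis j 1) y \<bullet> w) has_real_derivative
    score_deriv j (Suc l) (\<tau> + s *\<^sub>R axis j 1) y \<bullet> w) (at s)"
  unfolding score_deriv_def inner_vec_def vec_lambda_beta partials_replicate_Suc inner_real_def
  using assms
  by (intro DERIV_sum DERIV_cmult_right partial_exists_has_real_derivative_at ex) (auto simp: Y_def)

text \<open>The scalar partials, one for each pair of a component and an observation, are combined
  by \<open>abs_sum_powr_le\<close> and integrated against the marginal laws. The law parameter
  \<open>\<theta>\<close> and the point of differentiation \<open>\<tau>\<close> are separate
  because Taylor expansions leave \<open>\<theta>\<close>, possibly even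
  \<open>\<Theta>\<close>.\<close>

lemma score_deriv_moment:
  assumes l: "l < K" and w: "norm w \<le> 1"
  shows "\<exists>C'\<ge>0. \<forall>\<theta>\<in>\<Theta> \<inter> ball \<theta>0 e. \<forall>\<tau>\<in>ball \<theta>0 e.
    (\<integral>\<^sup>+ y. ennreal (\<bar>score_deriv j l \<tau> y \<bullet> w\<bar> powr p) \<partial>J \<theta>) \<le> ennreal C'"
proof -
  define A where "A = (UNIV :: 'd set) \<times> {1..n}"
  define c where "c = real (card A) powr (p - 1)"
  have A: "finite A" by (simp add: A_def)
  have c: "0 \<le> c" by (simp add: c_def)
  define C' where "C' = (\<Sum>(m, i)\<in>A. c * C (replicate l j @ [m]))"
  have "(\<integral>\<^sup>+ y. ennreal (\<bar>score_deriv j l \<tau> y \<bullet> w\<bar> powr p) \<partial>J \<theta>) \<le> ennreal C'"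
    if \<theta>: "\<theta> \<in> \<Theta>" "\<theta> \<in> ball \<theta>0 e" and \<tau>: "\<tau> \<in> ball \<theta>0 e" for \<theta> \<tau>
  proof -
    define g where "g m i z = partials (replicate l j @ [m]) (\<lambda>t. ell i t z) \<tau>" for m i z
    \<comment> \<open>The indicator makes \<open>h\<close> measurable: off \<open>S i\<close>
      nothing is known about \<open>g\<close>.\<close>
    define h where "h m i z = ennreal (\<bar>indicator (S i) z * g m i z\<bar> powr p)" for m i z
    have h_meas: "h m i \<in> borel_measurable (law \<gamma> f i \<theta>)" if i: "i \<in> {1..n}" for m i
    proof -
      have "continuous_on (S i) (g m i)"
        unfolding g_def
        by (rule continuous_on_curried_compose[OF cont[OF i, of "replicate l j @ [m]"],
              where h = "\<lambda>_. \<tau>" and k = "\<lambda>z. z", OF _ _ continuous_on_const continuous_on_id \<tau>])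
          (use l in auto)
      then have "(\<lambda>z. indicator (S i) z * g m i z) \<in> borel_measurable (law \<gamma> f i \<theta>)"
        using S_sets[OF i] by (intro borel_measurable_indicator_mult_continuous_on ident_law i) simp_all
      then show ?thesis
        unfolding h_def by measurable
    qed
    have h_int: "(\<integral>\<^sup>+ y. h m i (y i) \<partial>J \<theta>) \<le> ennreal (C (replicate l j @ [m]))" if i: "i \<in> {1..n}" for m i
    proof -
      have "distr (J \<theta>) (law \<gamma> f i \<theta>) (\<lambda>y. y i) = law \<gamma> f i \<theta>"
        unfolding joint_law_def using prob \<theta> i by (intro distr_PiM_component) auto
      then have "(\<integral>\<^sup>+ y. h m i (y i) \<partial>J \<theta>) = (\<integral>\<^sup>+ z. h m i z \<partial>law \<gamma> f i \<theta>)"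
        using nn_integral_distr[OF component_measurable[OF i] , of "h m i" \<theta>] h_meas[OF i] by metis
      also have "\<dots> = (\<integral>\<^sup>+ z. ennreal (\<bar>g m i z\<bar> powr p) \<partial>law \<gamma> f i \<theta>)"
        by (rule nn_integral_cong_AE, use S_AE[OF i \<theta>(1)] in eventually_elim) (simp add: h_def)
      also have "\<dots> \<le> ennreal (C (replicate l j @ [m]))"
        unfolding g_def using i \<theta> \<tau> l by (intro moments) auto
      finally show ?thesis .
    qed
    have "(\<integral>\<^sup>+ y. ennreal (\<bar>score_deriv j l \<tau> y \<bullet> w\<bar> powr p) \<partial>J \<theta>) \<le>
        (\<integral>\<^sup>+ y. (\<Sum>(m, i)\<in>A. ennreal c * h m i (y i)) \<partial>J \<theta>)"
    proof (rule nn_integral_mono_AE, use Y_AE[OF \<theta>(1)] in eventually_elim)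
      case (elim y)
      have "score_deriv j l \<tau> y \<bullet> w = (\<Sum>x\<in>A. g (fst x) (snd x) (y (snd x)) * w $ fst x)"
        by (simp add: score_deriv_def inner_vec_def A_def g_def sum_distrib_right
            sum.cartesian_product' case_prod_unfold)
      then have "\<bar>score_deriv j l \<tau> y \<bullet> w\<bar> powr p \<le>
          c * (\<Sum>x\<in>A. \<bar>g (fst x) (snd x) (y (snd x)) * w $ fst x\<bar> powr p)"
        unfolding c_def using abs_sum_powr_le[OF A, of p] p by simp
      also have "\<dots> \<le> c * (\<Sum>x\<in>A. \<bar>g (fst x) (snd x) (y (snd x))\<bar> powr p)"
      proof (intro mult_left_mono sum_mono powr_mono2 c)
        fix x :: "'d \<times> nat"
        have "\<bar>w $ fst x\<bar> \<le> 1"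
          using component_le_norm_cart[of w "fst x"] w by linarith
        then show "\<bar>g (fst x) (snd x) (y (snd x)) * w $ fst x\<bar> \<le> \<bar>g (fst x) (snd x) (y (snd x))\<bar>"
          by (simp add: abs_mult mult_left_le)
      qed (use p in auto)
      finally have "ennreal (\<bar>score_deriv j l \<tau> y \<bullet> w\<bar> powr p) \<le>
          ennreal (\<Sum>x\<in>A. c * \<bar>g (fst x) (snd x) (y (snd x))\<bar> powr p)"
        by (simp add: sum_distrib_left ennreal_leI)
      also have "\<dots> = (\<Sum>x\<in>A. ennreal c * ennreal (\<bar>g (fst x) (snd x) (y (snd x))\<bar> powr p))"
        using c by (simp add: sum_ennreal[symmetric] ennreal_mult)
      also have "\<dots> = (\<Sum>(m, i)\<in>A. ennreal c * h m i (y i))"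
        using elim by (intro sum.cong refl) (auto simp: h_def A_def Y_def indicator_def)
      finally show ?case .
    qed
    also have "\<dots> = (\<Sum>(m, i)\<in>A. ennreal c * (\<integral>\<^sup>+ y. h m i (y i) \<partial>J \<theta>))"
    proof -
      have hJ: "(\<lambda>y. h m i (y i)) \<in> borel_measurable (J \<theta>)" if i: "i \<in> {1..n}" for m i
        by (rule measurable_compose[OF component_measurable[OF i] h_meas[OF i]])
      have "(\<integral>\<^sup>+ y. (\<Sum>x\<in>A. ennreal c * h (fst x) (snd x) (y (snd x))) \<partial>J \<theta>) =
          (\<Sum>x\<in>A. \<integral>\<^sup>+ y. ennreal c * h (fst x) (snd x) (y (snd x)) \<partial>J \<theta>)"
        using hJ by (intro nn_integral_sum borel_measurable_times_ennreal borel_measurable_const)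
          (auto simp: A_def)
      also have "\<dots> = (\<Sum>x\<in>A. ennreal c * (\<integral>\<^sup>+ y. h (fst x) (snd x) (y (snd x)) \<partial>J \<theta>))"
        using hJ by (intro sum.cong refl nn_integral_cmult) (auto simp: A_def)
      finally show ?thesis by (simp add: case_prod_unfold)
    qed
    also have "\<dots> \<le> (\<Sum>(m, i)\<in>A. ennreal c * ennreal (C (replicate l j @ [m])))"
      unfolding case_prod_unfold using h_int by (intro sum_mono mult_left_mono) (auto simp: A_def)
    also have "\<dots> = ennreal C'"
      unfolding C'_def case_prod_unfold using c C_nonneg
      by (simp add: sum_ennreal[symmetric] ennreal_mult)
    finally show ?thesis .
  qed
  moreover have "0 \<le> C'"
    unfolding C'_def using c C_nonneg by (auto intro!: sum_nonneg)
  ultimately show ?thesis by blast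
qed

text \<open>The null set in the vanishing condition depends on \<open>\<tau>\<close>, while the
  limit argument evaluates at base points that vary with \<open>m\<close> and at varying data. Here
  the condition becomes an identity on the fixed set \<open>Y\<close>.\<close>

lemma score_deriv_zero:
  assumes "l < K" "\<tau> \<in> ball \<theta>0 e" "\<theta> \<in> \<Theta>" "AE y in J \<theta>. (partial j ^^ l) (\<lambda>t. score ell n t y) \<tau> \<bullet> w = 0"
    and y: "y \<in> Y"
  shows "score_deriv j l \<tau> y \<bullet> w = 0"
proof -
  have zero: "AE y in Pi\<^sub>M {1..n} (\<lambda>i. law \<gamma> f i \<theta>). score_deriv j l \<tau> y \<bullet> w = 0"
    unfolding joint_law_def[symmetric] using assms(4) Y_AE[OF assms(3)]
  proof eventually_elim
    case (elim y)
    then show ?case using score_deriv_eq[OF elim(2) assms(2,1), of j] by simp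
  qed
  show ?thesis
    using continuous_AE_zero_on_support[OF finite_atLeastAtMost prob[OF _ assms(3)] ident_law _
        supp[OF _ assms(3)] score_deriv_continuous_fixed[OF assms(1,2), unfolded Y_def] zero y[unfolded Y_def]]
      S_sets by simp
qed

section \<open>Likelihood ratios near the base point\<close>

lemma density_ratio_tendsto:
  assumes i: "i \<in> {1..n}" and y: "y \<in> S i"
    and \<theta>s: "\<And>m. \<theta>s m \<in> \<Theta>" "\<And>m. \<theta>s m \<in> ball \<theta>0 e" "\<theta>s \<longlonglongrightarrow> \<theta>0"
  shows "(\<lambda>m. f i (\<theta>s m) y / f i \<theta>0 y) \<longlonglongrightarrow> 1"
proof -
  have "isCont (\<lambda>t. ell i t y) \<theta>0"
  proof (rule continuous_partials_imp_continuous[of "ball \<theta>0 e"])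
    fix j
    show "partial_exists j (\<lambda>t. ell i t y) \<tau>" if "\<tau> \<in> ball \<theta>0 e" for \<tau>
      using ex[OF i, of "[]" \<tau> y j] that y K by (simp add: partials_def)
    have "continuous_on (ball \<theta>0 e) (\<lambda>\<tau>. partials [j] (\<lambda>t. ell i t y) \<tau>)"
      by (rule continuous_on_curried_compose[OF cont[OF i, of "[j]"], where h = "\<lambda>z. z" and k = "\<lambda>_. y",
            OF _ _ continuous_on_id continuous_on_const _ y]) (use K in auto)
    then show "continuous_on (ball \<theta>0 e) (partial j (\<lambda>t. ell i t y))"
      by (simp add: partials_def)
  qed (use e in auto)
  then have "(\<lambda>m. ell i (\<theta>s m) y) \<longlonglongrightarrow> ell i \<theta>0 y"
    using \<theta>s(3) by (rule isCont_tendsto_compose)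
  then have "(\<lambda>m. exp (ell i (\<theta>s m) y) / f i \<theta>0 y) \<longlonglongrightarrow> exp (ell i \<theta>0 y) / f i \<theta>0 y"
    using f_pos[OF i \<theta>0 _ y] e by (intro tendsto_intros) auto
  moreover have "exp (ell i \<theta> y) = f i \<theta> y" if "\<theta> \<in> \<Theta>" "\<theta> \<in> ball \<theta>0 e" for \<theta>
    using f_pos[OF i that y] ell_eq[OF i that y] by simp
  ultimately show ?thesis
    using \<theta>s \<theta>0 e f_pos[OF i \<theta>0 _ y] by simp
qed

text \<open>The likelihood ratio of \<open>\<theta>\<close> against \<open>\<theta>0\<close>. The
  indicators confine it to observations in \<open>S i\<close>, where for \<open>\<theta>\<close> in
  the ball and in \<open>\<Theta>\<close> both densities are positive, so that it is nonnegative
  everywhere.\<close>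

definition F :: "real ^ 'd \<Rightarrow> (nat \<Rightarrow> obs) \<Rightarrow> real" where
  "F \<theta> y = (\<Prod>i=1..n. indicator (S i) (y i) * (f i \<theta> (y i) / f i \<theta>0 (y i)))"

text \<open>\<open>S i\<close> has full mass under \<open>\<theta>\<close>, so
  \<open>f i \<theta>\<close> vanishes almost everywhere outside it; inside, both densities are
  positive and \<open>f i \<theta>0\<close> cancels.\<close>

lemma law_eq_density:
  assumes i: "i \<in> {1..n}" and \<theta>: "\<theta> \<in> \<Theta>" "\<theta> \<in> ball \<theta>0 e"
  shows "law \<gamma> f i \<theta> = density (law \<gamma> f i \<theta>0) (\<lambda>z. ennreal (indicator (S i) z * (f i \<theta> z / f i \<theta>0 z)))"
proof -
  note [measurable] = f_meas[OF i \<theta>(1)] f_meas[OF i \<theta>0] S_sets[OF i]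
  have ae: "AE z in \<gamma> i. 0 < f i \<theta> z \<longrightarrow> z \<in> S i"
    using S_AE[OF i \<theta>(1)] unfolding law_def by (subst (asm) AE_density) auto
  have "density (law \<gamma> f i \<theta>0) (\<lambda>z. ennreal (indicator (S i) z * (f i \<theta> z / f i \<theta>0 z))) =
      density (\<gamma> i) (\<lambda>z. ennreal (f i \<theta>0 z) * ennreal (indicator (S i) z * (f i \<theta> z / f i \<theta>0 z)))"
    unfolding law_def by (rule density_density_eq) measurable
  also have "\<dots> = law \<gamma> f i \<theta>"
    unfolding law_def
  proof (rule density_cong)
    show "AE z in \<gamma> i. ennreal (f i \<theta>0 z) * ennreal (indicator (S i) z * (f i \<theta> z / f i \<theta>0 z)) = ennreal (f i \<theta> z)"
      using ae AE_space
    proof eventually_elim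
      case (elim z)
      show ?case
      proof (cases "z \<in> S i")
        case True
        then have "0 < f i \<theta>0 z" "0 < f i \<theta> z" using f_pos[OF i] \<theta>0 \<theta> e by auto
        then show ?thesis using True by (simp flip: ennreal_mult)
      next
        case False
        then have "f i \<theta> z = 0" using elim f_nonneg[OF i \<theta>(1)] by force
        then show ?thesis by simp
      qed
    qed
  qed measurable
  finally show ?thesis ..
qed

lemma J_eq_density:
  assumes \<theta>: "\<theta> \<in> \<Theta>" "\<theta> \<in> ball \<theta>0 e"
  shows "J \<theta> = density (J \<theta>0) (\<lambda>y. ennreal (F \<theta> y))"
proof -
  let ?g = "\<lambda>i z. ennreal (indicator (S i) z * (f i \<theta> z / f i \<theta>0 z))"
  have g: "?g i \<in> borel_measurable (law \<gamma> f i \<theta>0)" if i: "i \<in> {1..n}" for i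
  proof -
    have "?g i \<in> borel_measurable (\<gamma> i)"
      using f_meas[OF i \<theta>(1)] f_meas[OF i \<theta>0] S_sets[OF i] by measurable
    then show ?thesis by (simp add: law_def)
  qed
  have "J \<theta> = (\<Pi>\<^sub>M i\<in>{1..n}. density (law \<gamma> f i \<theta>0) (?g i))"
    unfolding joint_law_def using law_eq_density \<theta> by (intro PiM_cong) auto
  also have "\<dots> = density (J \<theta>0) (\<lambda>y. \<Prod>i\<in>{1..n}. ?g i (y i))"
    unfolding joint_law_def
    using law_eq_density[OF _ \<theta>] prob[OF _ \<theta>(1)] prob[OF _ \<theta>0] g by (intro PiM_density) auto
  also have "(\<lambda>y. \<Prod>i\<in>{1..n}. ?g i (y i)) = (\<lambda>y. ennreal (F \<theta> y))"
  proof
    fix y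
    have "0 \<le> indicator (S i) (y i) * (f i \<theta> (y i) / f i \<theta>0 (y i))" if i: "i \<in> {1..n}" for i
    proof (cases "y i \<in> S i")
      case True
      then show ?thesis using f_pos[OF i \<theta>] f_pos[OF i \<theta>0] e by (simp add: less_imp_le)
    qed simp
    then show "(\<Prod>i\<in>{1..n}. ?g i (y i)) = ennreal (F \<theta> y)"
      unfolding F_def by (intro prod_ennreal)
  qed
  finally show ?thesis .
qed

lemma F_measurable:
  assumes \<theta>: "\<theta> \<in> \<Theta>"
  shows "F \<theta> \<in> borel_measurable (J \<theta>0)"
  unfolding F_def[abs_def]
proof (intro borel_measurable_prod)
  fix i assume i: "i \<in> {1..n}"
  have "(\<lambda>z. indicator (S i) z * (f i \<theta> z / f i \<theta>0 z)) \<in> borel_measurable (\<gamma> i)"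
    using f_meas[OF i \<theta>(1)] f_meas[OF i \<theta>0] S_sets[OF i] by measurable
  then have "(\<lambda>z. indicator (S i) z * (f i \<theta> z / f i \<theta>0 z)) \<in> borel_measurable (law \<gamma> f i \<theta>0)"
    by (simp add: law_def)
  from measurable_compose[OF component_measurable[OF i] this]
  show "(\<lambda>y. indicator (S i) (y i) * (f i \<theta> (y i) / f i \<theta>0 (y i)) :: real) \<in> borel_measurable (J \<theta>0)" .
qed

lemma F_nonneg:
  assumes \<theta>: "\<theta> \<in> \<Theta>" "\<theta> \<in> ball \<theta>0 e"
  shows "0 \<le> F \<theta> y"
  unfolding F_def
proof (rule prod_nonneg)
  fix i assume i: "i \<in> {1..n}"
  show "0 \<le> indicator (S i) (y i) * (f i \<theta> (y i) / f i \<theta>0 (y i))"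
  proof (cases "y i \<in> S i")
    case True
    then show ?thesis using f_pos[OF i \<theta>] f_pos[OF i \<theta>0] e by (simp add: less_imp_le)
  qed simp
qed

lemma F_tendsto:
  assumes y: "y \<in> Y"
    and \<theta>s: "\<And>m. \<theta>s m \<in> \<Theta>" "\<And>m. \<theta>s m \<in> ball \<theta>0 e" "\<theta>s \<longlonglongrightarrow> \<theta>0"
  shows "(\<lambda>m. F (\<theta>s m) y) \<longlonglongrightarrow> 1"
proof -
  have "(\<lambda>m. F (\<theta>s m) y) \<longlonglongrightarrow> (\<Prod>i=1..n. 1)"
    unfolding F_def
  proof (rule tendsto_prod)
    fix i assume i: "i \<in> {1..n}"
    then have "y i \<in> S i" using y by (auto simp: Y_def)
    then show "(\<lambda>m. indicator (S i) (y i) * (f i (\<theta>s m) (y i) / f i \<theta>0 (y i))) \<longlonglongrightarrow> 1"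
      using density_ratio_tendsto[OF i _ \<theta>s] by simp
  qed
  then show ?thesis by simp
qed

end

lemma integrable_of_powr_moment:
  fixes X Z :: "'y \<Rightarrow> real"
  assumes M: "prob_space M" and p: "2 < p" and C: "0 \<le> C"
    and [measurable]: "X \<in> borel_measurable M" "Z \<in> borel_measurable M"
    and X: "(\<integral>\<^sup>+ y. ennreal (\<bar>X y\<bar> powr p) \<partial>M) \<le> ennreal C"
    and Z: "(\<integral>\<^sup>+ y. ennreal (\<bar>Z y\<bar> powr p) \<partial>M) \<le> ennreal C"
  shows "integrable M X" "integrable M (\<lambda>y. X y * Z y)"
proof -
  interpret prob_space M by fact
  have le: "\<bar>x\<bar> \<le> 1 + \<bar>x\<bar> powr (p / 2)" for x :: real
    using powr_mono[of 1 "p / 2" "\<bar>x\<bar>"] powr_ge_zero[of "\<bar>x\<bar>" "p / 2"] p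
    by (cases "\<bar>x\<bar> \<le> 1") (linarith, auto)
  have int: "integrable M g"
    if g: "g \<in> borel_measurable M" "(\<integral>\<^sup>+ y. ennreal (\<bar>g y\<bar> powr (p / 2)) \<partial>M) \<le> ennreal (1 + 2 * C)" for g
  proof (rule Bochner_Integration.integrable_bound)
    have "(\<integral>\<^sup>+ y. ennreal (\<bar>g y\<bar> powr (p / 2)) \<partial>M) < \<infinity>"
      using g(2) by (rule le_less_trans) simp
    then have "integrable M (\<lambda>y. \<bar>g y\<bar> powr (p / 2))"
      using g(1) by (auto simp: integrable_iff_bounded)
    then show "integrable M (\<lambda>y. 1 + \<bar>g y\<bar> powr (p / 2))"
      by simp
  qed (use g le in auto)
  show "integrable M X" "integrable M (\<lambda>y. X y * Z y)"
    using nn_integral_powr_half_le[OF M _ C _ _ X Z] p by (auto intro!: int)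
qed

text \<open>Only the \<open>j\<close>th coordinate changes, to \<open>c $ j + t\<close>. The whole
  segment of a Taylor expansion in direction \<open>j\<close> is therefore as close to
  \<open>c\<close> as \<open>x\<close> is.\<close>

lemma norm_reset_coordinate_le:
  fixes x c :: "real ^ 'd"
  assumes "\<bar>t\<bar> \<le> \<bar>x $ j - c $ j\<bar>"
  shows "norm (x - (x $ j - c $ j) *\<^sub>R axis j 1 + t *\<^sub>R axis j 1 - c) \<le> norm (x - c)"
  using assms by (intro norm_le_componentwise_cart) (auto simp: axis_def)

section \<open>Limit of the score statistic along non-critical points\<close>

context regular_point
begin

text \<open>\<open>w\<close> and \<open>N\<close> are the eigenvectors and orders at
  \<open>\<theta>0\<close>, kept fixed along the sequence, and \<open>X\<close> stands for the
  modified score there. The data vary with \<open>m\<close> too, so that the limit yields joint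
  continuity.\<close>

lemma score_stat_tendsto:
  fixes w :: "'d \<Rightarrow> real ^ 'd" and N :: "'d \<Rightarrow> nat" and X :: "(nat \<Rightarrow> obs) \<Rightarrow> real ^ 'd"
  assumes w: "\<And>j l. w j \<bullet> w l = (if j = l then 1 else 0)"
    and N: "\<And>j. 1 \<le> N j" "\<And>j. N j \<le> K"
    and vanish: "\<And>j l \<tau> y. l + 2 \<le> N j \<Longrightarrow> \<tau> \<in> ball \<theta>0 e \<Longrightarrow> \<tau> $ j = \<theta>0 $ j \<Longrightarrow> y \<in> Y \<Longrightarrow>
      score_deriv j l \<tau> y \<bullet> w j = 0"
    and X: "\<And>y. y \<in> Y \<Longrightarrow> X y = (\<chi> j. score_deriv j (N j - 1) \<theta>0 y \<bullet> w j)"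
    and inv: "invertible (cov_matrix (J \<theta>0) X)"
    and \<theta>s: "\<And>m. \<theta>s m \<in> \<Theta>" "\<And>m. \<theta>s m \<in> ball \<theta>0 e" "\<theta>s \<longlonglongrightarrow> \<theta>0"
    and noncrit: "\<And>m. \<not> critical \<gamma> f ell n (\<theta>s m)"
    and ys: "\<And>m. ys m \<in> Y" "ys \<longlonglongrightarrow> y" "y \<in> Y"
  shows "(\<lambda>m. score_stat \<gamma> f ell n (\<theta>s m) (ys m)) \<longlonglongrightarrow>
    X y \<bullet> (matrix_inv (cov_matrix (J \<theta>0) X) *v X y)"
proof -
  define L where "L j = N j - 1" for j
  define \<delta> where "\<delta> m j = \<theta>s m $ j - \<theta>0 $ j" for m j
  \<comment> \<open>\<open>\<theta>s m\<close> with its \<open>j\<close>th coordinate reset to that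
    of \<open>\<theta>0\<close>: a point where the vanishing condition applies, hence the base of
    the expansion in direction \<open>j\<close>. It may lie outside \<open>\<Theta>\<close>.\<close>
  define \<tau> where "\<tau> m j = \<theta>s m - \<delta> m j *\<^sub>R axis j 1" for m j
  \<comment> \<open>The reciprocal of the leading Taylor factor; \<open>B m\<close> below applies it
    to the score components along the \<open>w j\<close>.\<close>
  define a where "a m j = fact (L j) / \<delta> m j ^ L j" for m j
  define A where "A = (\<chi> j. w j)"
  define B where "B m = (\<chi> j. a m j *\<^sub>R w j)" for m
  define s where "s m = score ell n (\<theta>s m)" for m
  \<comment> \<open>A measurable version of the score: at order 0 the direction index is immaterial,
    and \<open>axis c 1\<close> picks out the component.\<close>
  define s' where "s' m y = (\<chi> c. indicator Y y * (score_deriv c 0 (\<theta>s m) y \<bullet> axis c 1))" for m y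
  define I where "I m = information \<gamma> f ell n (\<theta>s m)" for m
  define u' where "u' m y = (\<chi> j. a m j * (indicator Y y * (score_deriv j 0 (\<theta>s m) y \<bullet> w j)))" for m y
  define X' where "X' y = (\<chi> j. indicator Y y * (score_deriv j (L j) \<theta>0 y \<bullet> w j))" for y
  have L: "L j < K" for j
    using N[of j] by (simp add: L_def)
  have K0: "0 < K" using K by simp
  have I: "invertible (I m)" for m
    using noncrit by (simp add: I_def critical_def)
  have w_norm: "norm (w j) \<le> 1" for j
    using w[of j j] by (simp add: norm_eq_sqrt_inner)
  have \<theta>0_ball: "\<theta>0 \<in> ball \<theta>0 e" using e by simp
  have near: "norm (\<tau> m j + t *\<^sub>R axis j 1 - \<theta>0) \<le> norm (\<theta>s m - \<theta>0)" if "\<bar>t\<bar> \<le> \<bar>\<delta> m j\<bar>" for m j t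
    using norm_reset_coordinate_le[of t "\<theta>s m" j \<theta>0] that by (simp add: \<tau>_def \<delta>_def)
  have in_ball: "\<tau> m j + t *\<^sub>R axis j 1 \<in> ball \<theta>0 e" if "\<bar>t\<bar> \<le> \<bar>\<delta> m j\<bar>" for m j t
    using near[OF that] \<theta>s(2)[of m] by (simp add: dist_norm norm_minus_commute)
  have \<tau>\<delta>: "\<tau> m j + \<delta> m j *\<^sub>R axis j 1 = \<theta>s m" for m j
    by (simp add: \<tau>_def)
  have \<tau>_coord: "\<tau> m j $ j = \<theta>0 $ j" for m j
    by (simp add: \<tau>_def \<delta>_def)
  have s_eq: "s m y = score_deriv j 0 (\<theta>s m) y" if "y \<in> Y" for m j y
    unfolding s_def using score_eq[OF that \<theta>s(2)] .
  have s_AE: "AE y in J (\<theta>s m). s m y = s' m y" for m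
    using Y_AE[OF \<theta>s(1)]
    by eventually_elim (simp add: s'_def vec_eq_iff s_eq[symmetric] inner_axis)
  have s'_meas: "(\<lambda>y. s' m y $ c) \<in> borel_measurable (J \<theta>)" for m c \<theta>
    unfolding s'_def vec_lambda_beta by (rule score_deriv_measurable[OF K0 \<theta>s(2)])
  have s'_int: "integrable (J (\<theta>s m)) (\<lambda>y. s' m y $ c)"
    "integrable (J (\<theta>s m)) (\<lambda>y. s' m y $ c * s' m y $ b)" for m b c
  proof -
    have "\<exists>C'\<ge>0. (\<integral>\<^sup>+ y. ennreal (\<bar>s' m y $ c\<bar> powr p) \<partial>J (\<theta>s m)) \<le> ennreal C'" for c
    proof -
      have "norm (axis c 1 :: real ^ 'd) \<le> 1" by simp
      from score_deriv_moment[OF K0 this, of c] obtain C' where C': "0 \<le> C'"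
        "(\<integral>\<^sup>+ y. ennreal (\<bar>score_deriv c 0 (\<theta>s m) y \<bullet> axis c 1\<bar> powr p) \<partial>J (\<theta>s m)) \<le> ennreal C'"
        using \<theta>s by blast
      moreover have "(\<integral>\<^sup>+ y. ennreal (\<bar>s' m y $ c\<bar> powr p) \<partial>J (\<theta>s m)) =
          (\<integral>\<^sup>+ y. ennreal (\<bar>score_deriv c 0 (\<theta>s m) y \<bullet> axis c 1\<bar> powr p) \<partial>J (\<theta>s m))"
        by (rule nn_integral_cong_AE, use Y_AE[OF \<theta>s(1)] in eventually_elim) (simp add: s'_def)
      ultimately show ?thesis by auto
    qed
    then obtain C1 C2 where C: "0 \<le> C1" "(\<integral>\<^sup>+ y. ennreal (\<bar>s' m y $ c\<bar> powr p) \<partial>J (\<theta>s m)) \<le> ennreal C1"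
      "0 \<le> C2" "(\<integral>\<^sup>+ y. ennreal (\<bar>s' m y $ b\<bar> powr p) \<partial>J (\<theta>s m)) \<le> ennreal C2"
      by meson
    have "(\<integral>\<^sup>+ y. ennreal (\<bar>s' m y $ c\<bar> powr p) \<partial>J (\<theta>s m)) \<le> ennreal (max C1 C2)"
      "(\<integral>\<^sup>+ y. ennreal (\<bar>s' m y $ b\<bar> powr p) \<partial>J (\<theta>s m)) \<le> ennreal (max C1 C2)"
      by (rule order_trans[OF C(2)], simp add: ennreal_leI,
          rule order_trans[OF C(4)], simp add: ennreal_leI)
    from integrable_of_powr_moment[OF prob_J[OF \<theta>s(1)] p _ s'_meas s'_meas this] C(1)
    show "integrable (J (\<theta>s m)) (\<lambda>y. s' m y $ c)"
      "integrable (J (\<theta>s m)) (\<lambda>y. s' m y $ c * s' m y $ b)"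
      by auto
  qed
  have cov_linear: "cov_matrix (J (\<theta>s m)) (\<lambda>y. D *v s m y) = D ** I m ** transpose D" for D :: "real ^ 'd ^ 'd" and m
    unfolding I_def information_def s_def[symmetric]
    by (rule cov_matrix_linear[OF prob_J[OF \<theta>s(1)] s'_meas s_AE s'_int])
  have A: "invertible A"
    unfolding A_def by (rule orthonormal_rows_invertible[OF w])
  have A_row: "(A *v x) $ j = w j \<bullet> x" for x j
    by (simp add: A_def matrix_vector_mul_component)
  have B_row: "(B m *v x) $ j = a m j * (w j \<bullet> x)" for m x j
    by (simp add: B_def matrix_vector_mul_component)
  \<comment> \<open>If \<open>\<delta> m j = 0\<close> and \<open>L j > 0\<close>, the vanishing
    condition at \<open>\<theta>s m\<close> itself kills the score along \<open>w j\<close>. Then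
    row \<open>j\<close> of its covariance in the basis \<open>w\<close> is zero and
    \<open>\<theta>s m\<close> would be critical. For \<open>L j = 0\<close> the power is 1,
    whatever \<open>\<delta> m j\<close> is.\<close>
  have \<delta>_nz: "\<delta> m j ^ L j \<noteq> 0" for m j
  proof
    assume "\<delta> m j ^ L j = 0"
    then have z: "\<delta> m j = 0" "0 < L j" by (auto split: if_splits)
    then have v: "score_deriv j 0 (\<theta>s m) y \<bullet> w j = 0" if "y \<in> Y" for y
      using that \<theta>s(2) by (intro vanish) (auto simp: L_def \<delta>_def)
    define Z where "Z y = (\<chi> c. if c = j then 0 else w c \<bullet> s' m y)" for y
    have Z_AE: "AE y in J (\<theta>s m). A *v s m y = Z y"
      using s_AE[of m] Y_AE[OF \<theta>s(1)[of m]]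
    proof eventually_elim
      case (elim y)
      have "w j \<bullet> s m y = 0"
        using v[OF elim(2)] s_eq[OF elim(2), of m j] by (simp add: inner_commute)
      then show ?case using elim(1) unfolding vec_eq_iff[of "A *v s m y"] A_row Z_def by simp
    qed
    have Z_meas: "(\<lambda>y. Z y $ c) \<in> borel_measurable (J (\<theta>s m))" for c
    proof -
      have "(\<lambda>y. w c \<bullet> s' m y) \<in> borel_measurable (J (\<theta>s m))"
        unfolding inner_vec_def inner_real_def
        by (intro borel_measurable_sum borel_measurable_times borel_measurable_const s'_meas)
      then show ?thesis by (cases "c = j") (simp_all add: Z_def)
    qed
    have "cov_matrix (J (\<theta>s m)) (\<lambda>y. A *v s m y) $ j $ b = 0" for b
      using cov_matrix_AE_eq[OF Z_meas Z_AE, of j b] by (simp add: Z_def)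
    then have row: "(A ** I m ** transpose A) $ j $ b = 0" for b
      by (simp add: cov_linear)
    have "invertible (A ** I m ** transpose A)"
      by (intro invertible_mult A I invertible_transpose_real)
    then have "((A ** I m ** transpose A) ** matrix_inv (A ** I m ** transpose A)) $ j $ j = 1"
      by (simp add: matrix_inv_mult mat_def)
    then show False
      by (simp add: matrix_matrix_mult_def[of "A ** I m ** transpose A"] row)
  qed
  have a_mult: "a m j * \<delta> m j ^ L j = fact (L j)" for m j
    using \<delta>_nz[of m j] by (simp add: a_def del: power_eq_0_iff)
  have B: "invertible (B m)" for m
  proof -
    have "x = 0" if "B m *v x = 0" for x
    proof -
      have "a m j * (w j \<bullet> x) = 0" for j
        using that B_row[of m x j] by simp
      moreover have "a m j \<noteq> 0" for j
        using \<delta>_nz by (simp add: a_def)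
      ultimately have "A *v x = 0"
        by (auto simp: vec_eq_iff A_row)
      then show ?thesis
        using matrix_inv_vector_eqI[OF A, of x 0] by simp
    qed
    then show ?thesis
      using matrix_left_invertible_ker invertible_left_inverse by blast
  qed
  \<comment> \<open>Used with \<open>ys\<close> for the statistic and with constant data for the
    almost everywhere limit. The intermediate point depends on the data, but joint continuity only
    asks that it tend to \<open>\<theta>0\<close>.\<close>
  have pointwise: "(\<lambda>m. (B m *v s m (zs m)) $ j) \<longlonglongrightarrow> score_deriv j (L j) \<theta>0 z \<bullet> w j"
    if zs: "\<And>m. zs m \<in> Y" "zs \<longlonglongrightarrow> z" "z \<in> Y" for zs z j
  proof -
    have "\<exists>\<xi>. \<bar>\<xi>\<bar> \<le> \<bar>\<delta> m j\<bar> \<and>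
        (B m *v s m (zs m)) $ j = score_deriv j (L j) (\<tau> m j + \<xi> *\<^sub>R axis j 1) (zs m) \<bullet> w j" for m
    proof -
      define D where "D l t = score_deriv j l (\<tau> m j + t *\<^sub>R axis j 1) (zs m) \<bullet> w j" for l t
      have "\<exists>\<xi>. \<bar>\<xi>\<bar> \<le> \<bar>\<delta> m j\<bar> \<and> D 0 (\<delta> m j) =
          (\<Sum>l<L j. D l 0 / fact l * \<delta> m j ^ l) + D (L j) \<xi> / fact (L j) * \<delta> m j ^ L j"
      proof (rule Maclaurin_bi_le[OF refl], intro allI impI)
        fix l t assume lt: "l < L j \<and> \<bar>t\<bar> \<le> \<bar>\<delta> m j\<bar>"
        show "(D l has_real_derivative D (Suc l) t) (at t)"
          unfolding D_def[abs_def] using lt L[of j]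
          by (intro score_deriv_has_derivative zs in_ball) auto
      qed
      then obtain \<xi> where \<xi>: "\<bar>\<xi>\<bar> \<le> \<bar>\<delta> m j\<bar>" and eq: "D 0 (\<delta> m j) =
          (\<Sum>l<L j. D l 0 / fact l * \<delta> m j ^ l) + D (L j) \<xi> / fact (L j) * \<delta> m j ^ L j"
        by blast
      \<comment> \<open>The Taylor polynomial disappears: \<open>l < L j\<close> means
        \<open>l + 2 \<le> N j\<close>, the range of the vanishing condition.\<close>
      have "D l 0 = 0" if "l < L j" for l
        unfolding D_def using that zs \<tau>_coord in_ball[of 0 m j]
        by (intro vanish) (auto simp: L_def)
      then have "D 0 (\<delta> m j) = D (L j) \<xi> / fact (L j) * \<delta> m j ^ L j"
        using eq by simp
      moreover have "(B m *v s m (zs m)) $ j = a m j * D 0 (\<delta> m j)"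
        unfolding B_row D_def \<tau>\<delta> by (simp add: s_eq[of "zs m" m j, OF zs(1)] inner_commute)
      moreover have "a m j * (D (L j) \<xi> / fact (L j) * \<delta> m j ^ L j) =
          (a m j * \<delta> m j ^ L j) * D (L j) \<xi> / fact (L j)"
        by (simp add: mult_ac)
      ultimately have "(B m *v s m (zs m)) $ j = D (L j) \<xi>"
        by (simp add: a_mult)
      then show ?thesis using \<xi> by (auto simp: D_def)
    qed
    then obtain \<xi> where \<xi>: "\<And>m. \<bar>\<xi> m\<bar> \<le> \<bar>\<delta> m j\<bar>"
      and eq: "\<And>m. (B m *v s m (zs m)) $ j = score_deriv j (L j) (\<tau> m j + \<xi> m *\<^sub>R axis j 1) (zs m) \<bullet> w j"
      by metis
    have "(\<lambda>m. \<tau> m j + \<xi> m *\<^sub>R axis j 1 - \<theta>0) \<longlonglongrightarrow> 0"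
    proof (rule Lim_null_comparison)
      show "\<forall>\<^sub>F m in sequentially. norm (\<tau> m j + \<xi> m *\<^sub>R axis j 1 - \<theta>0) \<le> norm (\<theta>s m - \<theta>0)"
        using near[OF \<xi>] by simp
      show "(\<lambda>m. norm (\<theta>s m - \<theta>0)) \<longlonglongrightarrow> 0"
        using \<theta>s(3) by (simp add: LIM_zero tendsto_norm_zero)
    qed
    then have "(\<lambda>m. \<tau> m j + \<xi> m *\<^sub>R axis j 1) \<longlonglongrightarrow> \<theta>0"
      by (rule LIM_zero_cancel)
    then have lim: "(\<lambda>m. (\<tau> m j + \<xi> m *\<^sub>R axis j 1, zs m)) \<longlonglongrightarrow> (\<theta>0, z)"
      using zs(2) by (rule tendsto_Pair)
    have "(\<lambda>m. (\<lambda>(\<tau>, y). score_deriv j (L j) \<tau> y \<bullet> w j) (\<tau> m j + \<xi> m *\<^sub>R axis j 1, zs m))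
        \<longlonglongrightarrow> (\<lambda>(\<tau>, y). score_deriv j (L j) \<tau> y \<bullet> w j) (\<theta>0, z)"
    proof (rule continuous_on_tendsto_compose[OF score_deriv_continuous[OF L] lim])
      show "(\<theta>0, z) \<in> ball \<theta>0 e \<times> Y"
        using \<theta>0_ball zs(3) by blast
      show "\<forall>\<^sub>F m in sequentially. (\<tau> m j + \<xi> m *\<^sub>R axis j 1, zs m) \<in> ball \<theta>0 e \<times> Y"
        by (intro always_eventually allI SigmaI in_ball \<xi> zs)
    qed
    then show ?thesis by (simp add: eq)
  qed
  have u'_eq: "B m *v s m y = u' m y" if "y \<in> Y" for m y
  proof -
    have "(B m *v s m y) $ j = u' m y $ j" for j
      using that s_eq[OF that, of m j] by (simp add: u'_def B_row inner_commute)
    then show ?thesis by (simp add: vec_eq_iff)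
  qed
  have u'_meas: "(\<lambda>y. u' m y $ j) \<in> borel_measurable (J \<theta>)" for m j \<theta>
    unfolding u'_def vec_lambda_beta
    by (rule borel_measurable_times[OF borel_measurable_const score_deriv_measurable[OF K0 \<theta>s(2)]])
  have X'_meas: "(\<lambda>y. X' y $ j) \<in> borel_measurable (J \<theta>)" for j \<theta>
    unfolding X'_def vec_lambda_beta by (rule score_deriv_measurable[OF L \<theta>0_ball])
  \<comment> \<open>The moment bound goes through iterated integration along the segment, at fixed
    points \<open>t\<close>, and not through the data-dependent intermediate point of
    \<open>pointwise\<close>.\<close>
  have "\<exists>C'\<ge>0. \<forall>m. (\<integral>\<^sup>+ y. ennreal (\<bar>u' m y $ j\<bar> powr p) \<partial>J (\<theta>s m)) \<le> ennreal C'" for j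
  proof -
    obtain C' where C': "0 \<le> C'"
      "\<And>\<theta> \<tau>. \<theta> \<in> \<Theta> \<inter> ball \<theta>0 e \<Longrightarrow> \<tau> \<in> ball \<theta>0 e \<Longrightarrow>
        (\<integral>\<^sup>+ y. ennreal (\<bar>score_deriv j (L j) \<tau> y \<bullet> w j\<bar> powr p) \<partial>J \<theta>) \<le> ennreal C'"
      using score_deriv_moment[OF L w_norm, of j j] by blast
    have "(\<integral>\<^sup>+ y. ennreal (\<bar>u' m y $ j\<bar> powr p) \<partial>J (\<theta>s m)) \<le> ennreal (fact (L j) powr p * C')" for m
    proof -
      define D where "D l t y = indicator Y y * (score_deriv j l (\<tau> m j + t *\<^sub>R axis j 1) y \<bullet> w j)" for l t y
      have D_meas: "D l t \<in> borel_measurable (J (\<theta>s m))" if "l \<le> L j" "\<bar>t\<bar> \<le> \<bar>\<delta> m j\<bar>" for l t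
        unfolding D_def using that L[of j] by (intro score_deriv_measurable in_ball) auto
      have D0: "(\<integral>\<^sup>+ y. ennreal (\<bar>D 0 (\<delta> m j) y\<bar> powr p) \<partial>J (\<theta>s m)) \<le>
          ennreal (\<bar>\<delta> m j\<bar> powr p) ^ L j * ennreal C'"
      proof (rule nn_integral_powr_le_iterated_derivative[where D = D])
        show "AE y in J (\<theta>s m). \<forall>l<L j. D l 0 y = 0"
          using Y_AE[OF \<theta>s(1)]
        proof eventually_elim
          case (elim y)
          have "score_deriv j l (\<tau> m j) y \<bullet> w j = 0" if "l < L j" for l
            using that elim \<tau>_coord in_ball[of 0 m j] by (intro vanish) (auto simp: L_def)
          then show ?case by (simp add: D_def)
        qed
        show "AE y in J (\<theta>s m). continuous_on {- \<bar>\<delta> m j\<bar>..\<bar>\<delta> m j\<bar>} (\<lambda>t. D (L j) t y)"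
          using Y_AE[OF \<theta>s(1)]
        proof eventually_elim
          case (elim y)
          have "continuous_on {- \<bar>\<delta> m j\<bar>..\<bar>\<delta> m j\<bar>} (\<lambda>t. score_deriv j (L j) (\<tau> m j + t *\<^sub>R axis j 1) y \<bullet> w j)"
          proof (rule continuous_on_curried_compose[OF score_deriv_continuous[OF L],
                where h = "\<lambda>t. \<tau> m j + t *\<^sub>R axis j 1" and k = "\<lambda>_. y"])
            show "continuous_on {- \<bar>\<delta> m j\<bar>..\<bar>\<delta> m j\<bar>} (\<lambda>t. \<tau> m j + t *\<^sub>R axis j 1)"
              by (intro continuous_on_add continuous_on_scaleR continuous_on_const continuous_on_id)
            show "\<tau> m j + t *\<^sub>R axis j 1 \<in> ball \<theta>0 e" if "t \<in> {- \<bar>\<delta> m j\<bar>..\<bar>\<delta> m j\<bar>}" for t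
              using that by (intro in_ball) auto
          qed (use elim in auto)
          then show ?case
            unfolding D_def by (intro continuous_on_mult continuous_on_const)
        qed
        show "AE y in J (\<theta>s m). \<forall>l<L j. \<forall>t. \<bar>t\<bar> \<le> \<bar>\<delta> m j\<bar> \<longrightarrow>
            ((\<lambda>t. D l t y) has_real_derivative D (Suc l) t y) (at t)"
          using Y_AE[OF \<theta>s(1)]
        proof eventually_elim
          case (elim y)
          show ?case
          proof (intro allI impI)
            fix l t assume "l < L j" "\<bar>t\<bar> \<le> \<bar>\<delta> m j\<bar>"
            then show "((\<lambda>t. D l t y) has_real_derivative D (Suc l) t y) (at t)"
              unfolding D_def using L[of j]
              by (intro DERIV_cmult score_deriv_has_derivative elim in_ball) auto
          qed
        qed
        show "(\<integral>\<^sup>+ y. ennreal (\<bar>D (L j) t y\<bar> powr p) \<partial>J (\<theta>s m)) \<le> ennreal C'" if "\<bar>t\<bar> \<le> \<bar>\<delta> m j\<bar>" for t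
        proof -
          have "(\<integral>\<^sup>+ y. ennreal (\<bar>D (L j) t y\<bar> powr p) \<partial>J (\<theta>s m)) =
              (\<integral>\<^sup>+ y. ennreal (\<bar>score_deriv j (L j) (\<tau> m j + t *\<^sub>R axis j 1) y \<bullet> w j\<bar> powr p) \<partial>J (\<theta>s m))"
            by (rule nn_integral_cong_AE, use Y_AE[OF \<theta>s(1)] in eventually_elim) (simp add: D_def)
          also have "\<dots> \<le> ennreal C'"
            using \<theta>s(1,2) in_ball[OF that] by (intro C'(2)) auto
          finally show ?thesis .
        qed
      qed (use p D_meas in auto)
      have "(\<integral>\<^sup>+ y. ennreal (\<bar>u' m y $ j\<bar> powr p) \<partial>J (\<theta>s m)) =
          (\<integral>\<^sup>+ y. ennreal (\<bar>a m j\<bar> powr p) * ennreal (\<bar>D 0 (\<delta> m j) y\<bar> powr p) \<partial>J (\<theta>s m))"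
        by (intro nn_integral_cong) (simp add: u'_def D_def \<tau>\<delta> abs_mult powr_mult ennreal_mult)
      also have "\<dots> = ennreal (\<bar>a m j\<bar> powr p) * (\<integral>\<^sup>+ y. ennreal (\<bar>D 0 (\<delta> m j) y\<bar> powr p) \<partial>J (\<theta>s m))"
        using D_meas[of 0 "\<delta> m j"] by (intro nn_integral_cmult) simp
      also have "\<dots> \<le> ennreal (\<bar>a m j\<bar> powr p) * (ennreal (\<bar>\<delta> m j\<bar> powr p) ^ L j * ennreal C')"
        by (intro mult_left_mono D0) simp
      also have "\<dots> = ennreal (\<bar>a m j\<bar> powr p * (\<bar>\<delta> m j\<bar> powr p) ^ L j * C')"
        using C'(1) by (simp add: ennreal_power ennreal_mult mult.assoc)
      \<comment> \<open>Here the powers of \<open>\<delta> m j\<close> cancel, and with them the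
        dependence on \<open>m\<close>.\<close>
      also have "\<bar>a m j\<bar> powr p * (\<bar>\<delta> m j\<bar> powr p) ^ L j = fact (L j) powr p"
      proof -
        have "(\<bar>\<delta> m j\<bar> powr p) ^ i = (\<bar>\<delta> m j\<bar> ^ i) powr p" for i
          by (induction i) (simp_all add: powr_mult)
        then have "\<bar>a m j\<bar> powr p * (\<bar>\<delta> m j\<bar> powr p) ^ L j = (\<bar>a m j\<bar> * \<bar>\<delta> m j\<bar> ^ L j) powr p"
          by (simp add: powr_mult)
        also have "\<bar>a m j\<bar> * \<bar>\<delta> m j\<bar> ^ L j = fact (L j)"
          using a_mult[of m j] by (simp flip: power_abs abs_mult)
        finally show ?thesis .
      qed
      finally show ?thesis .
    qed
    then show ?thesis
      using C'(1) by (intro exI[of _ "fact (L j) powr p * C'"]) auto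
  qed
  then obtain C' where C': "\<And>j. 0 \<le> C' j"
    "\<And>j m. (\<integral>\<^sup>+ y. ennreal (\<bar>u' m y $ j\<bar> powr p) \<partial>J (\<theta>s m)) \<le> ennreal (C' j)"
    by metis
  define CC where "CC = (\<Sum>j\<in>UNIV. C' j)"
  have CC: "0 \<le> CC" "(\<integral>\<^sup>+ y. ennreal (\<bar>u' m y $ j\<bar> powr p) \<partial>J (\<theta>s m)) \<le> ennreal CC" for j m
  proof -
    show "0 \<le> CC" unfolding CC_def using C'(1) by (intro sum_nonneg) auto
    have "C' j \<le> CC"
      unfolding CC_def using C'(1) by (intro member_le_sum) auto
    then show "(\<integral>\<^sup>+ y. ennreal (\<bar>u' m y $ j\<bar> powr p) \<partial>J (\<theta>s m)) \<le> ennreal CC"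
      using C'(2)[of m j] by (meson ennreal_leI order_trans)
  qed
  have u'_lim: "AE y in J \<theta>0. (\<lambda>m. u' m y $ j) \<longlonglongrightarrow> X' y $ j" for j
    using Y_AE[OF \<theta>0]
  proof eventually_elim
    case (elim y)
    show ?case
      using pointwise[of "\<lambda>_. y" y j] elim u'_eq[OF elim] by (simp add: X'_def)
  qed
  have half: "1 < p / 2" "0 < p" using p by auto
  have Js: "J (\<theta>s m) = density (J \<theta>0) (\<lambda>y. ennreal (F (\<theta>s m) y))" for m
    by (rule J_eq_density[OF \<theta>s(1,2)])
  have F_lim: "AE y in J \<theta>0. (\<lambda>m. F (\<theta>s m) y) \<longlonglongrightarrow> 1"
    using Y_AE[OF \<theta>0] by eventually_elim (rule F_tendsto[OF _ \<theta>s])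
  \<comment> \<open>All laws are densities relative to \<open>J \<theta>0\<close>. The exponent
    \<open>p / 2\<close> lets one rule cover both means and products.\<close>
  note conv = integral_density_tendsto[OF prob_J[OF \<theta>0] F_measurable[OF \<theta>s(1)] F_nonneg[OF \<theta>s(1,2)]
      prob_J[OF \<theta>s(1), unfolded Js] F_lim _ _ _ half(1), folded Js]
  have mean: "(\<lambda>m. \<integral>y. u' m y $ j \<partial>J (\<theta>s m)) \<longlonglongrightarrow> (\<integral>y. X' y $ j \<partial>J \<theta>0)"
    "integrable (J (\<theta>s m)) (\<lambda>y. u' m y $ j)" "integrable (J \<theta>0) (\<lambda>y. X' y $ j)" for j m
    using conv[OF u'_meas X'_meas u'_lim nn_integral_powr_half_le(1)[OF prob_J[OF \<theta>s(1)] half(2) CC(1)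
        u'_meas u'_meas CC(2) CC(2)]] by auto
  have prod_lim: "AE y in J \<theta>0. (\<lambda>m. u' m y $ j * u' m y $ b) \<longlonglongrightarrow> X' y $ j * X' y $ b" for j b
    using u'_lim[of j] u'_lim[of b] by eventually_elim (rule tendsto_mult)
  have second: "(\<lambda>m. \<integral>y. u' m y $ j * u' m y $ b \<partial>J (\<theta>s m)) \<longlonglongrightarrow> (\<integral>y. X' y $ j * X' y $ b \<partial>J \<theta>0)"
    "integrable (J (\<theta>s m)) (\<lambda>y. u' m y $ j * u' m y $ b)" "integrable (J \<theta>0) (\<lambda>y. X' y $ j * X' y $ b)"
    for j b m
    using conv[OF borel_measurable_times[OF u'_meas u'_meas] borel_measurable_times[OF X'_meas X'_meas]
        prod_lim nn_integral_powr_half_le(2)[OF prob_J[OF \<theta>s(1)] half(2) CC(1) u'_meas u'_meas CC(2) CC(2)]]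
    by auto
  have u'_AE: "AE y in J (\<theta>s m). B m *v s m y = u' m y" for m
    using Y_AE[OF \<theta>s(1)] by eventually_elim (rule u'_eq)
  have X'_AE: "AE y in J \<theta>0. X y = X' y"
    using Y_AE[OF \<theta>0] by eventually_elim (simp add: X X'_def L_def)
  have cov_lim: "(\<lambda>m. cov_matrix (J (\<theta>s m)) (\<lambda>y. B m *v s m y) $ j $ b) \<longlonglongrightarrow> cov_matrix (J \<theta>0) X $ j $ b" for j b
    unfolding cov_matrix_expand[OF prob_J[OF \<theta>s(1)] u'_meas u'_AE mean(2) second(2)]
      cov_matrix_expand[OF prob_J[OF \<theta>0] X'_meas X'_AE mean(3) second(3)]
    by (intro tendsto_intros mean second)
  have u_lim: "(\<lambda>m. B m *v s m (ys m)) \<longlonglongrightarrow> X y"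
    using pointwise[OF ys] by (intro vec_tendstoI) (simp add: X[OF ys(3)] L_def)
  have "invertible (cov_matrix (J (\<theta>s m)) (\<lambda>y. B m *v s m y))" for m
    unfolding cov_linear by (intro invertible_mult B I invertible_transpose_real)
  then have "(\<lambda>m. (B m *v s m (ys m)) \<bullet> (matrix_inv (cov_matrix (J (\<theta>s m)) (\<lambda>y. B m *v s m y)) *v (B m *v s m (ys m))))
      \<longlonglongrightarrow> X y \<bullet> (matrix_inv (cov_matrix (J \<theta>0) X) *v X y)"
    by (intro tendsto_inner u_lim tendsto_matrix_inv_vector cov_lim inv)
  then show ?thesis
    unfolding cov_linear quadratic_form_inverse_change_of_basis[OF B I]
    by (simp add: score_stat_def s_def I_def)
qed

end

subsection \<open>Continuous extension\<close>

lemma (in regular_point) score_stat_tendsto_mod_score_stat: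
  assumes kk: "\<And>j. 1 \<le> kk \<theta>0 n j" "\<And>j. kk \<theta>0 n j \<le> K"
    and orth: "orthonormal_eigenvectors (information \<gamma> f ell n \<theta>0) (v \<theta>0 n)"
    and pd: "pos_definite (mod_information \<gamma> f ell kk v n \<theta>0)"
    and vanish: "\<And>j l \<tau> \<theta>'. l + 2 \<le> kk \<theta>0 n j \<Longrightarrow> \<tau> \<in> ball \<theta>0 e \<Longrightarrow> \<tau> $ j = \<theta>0 $ j \<Longrightarrow> \<theta>' \<in> \<Theta> \<Longrightarrow>
      AE y in J \<theta>'. (partial j ^^ l) (\<lambda>t. score ell n t y) \<tau> \<bullet> v \<theta>0 n j = 0"
    and \<theta>s: "\<And>m. \<theta>s m \<in> \<Theta>" "\<theta>s \<longlonglongrightarrow> \<theta>0"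
    and noncrit: "\<And>m. \<not> critical \<gamma> f ell n (\<theta>s m)"
    and ys: "\<And>m. ys m \<in> Y" "ys \<longlonglongrightarrow> y" "y \<in> Y"
  shows "(\<lambda>m. score_stat \<gamma> f ell n (\<theta>s m) (ys m)) \<longlonglongrightarrow> mod_score_stat \<gamma> f ell kk v n \<theta>0 y"
proof -
  have "\<theta>0 \<in> ball \<theta>0 e" using e by simp
  from topological_tendstoD[OF \<theta>s(2) open_ball this]
  obtain M where M: "\<And>m. M \<le> m \<Longrightarrow> \<theta>s m \<in> ball \<theta>0 e"
    unfolding eventually_sequentially by blast
  \<comment> \<open>The expansion is available only inside the ball, so the finitely many terms
    before \<open>M\<close> are skipped.\<close>
  have "(\<lambda>m. score_stat \<gamma> f ell n (\<theta>s (m + M)) (ys (m + M))) \<longlonglongrightarrow>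
      mod_score ell kk v n \<theta>0 y \<bullet>
      (matrix_inv (cov_matrix (J \<theta>0) (mod_score ell kk v n \<theta>0)) *v mod_score ell kk v n \<theta>0 y)"
  proof (rule score_stat_tendsto[where w = "v \<theta>0 n" and N = "kk \<theta>0 n"])
    show "v \<theta>0 n j \<bullet> v \<theta>0 n l = (if j = l then 1 else 0)" for j l
      using orth by (simp add: orthonormal_eigenvectors_def)
    show "score_deriv j l \<tau> z \<bullet> v \<theta>0 n j = 0"
      if "l + 2 \<le> kk \<theta>0 n j" "\<tau> \<in> ball \<theta>0 e" "\<tau> $ j = \<theta>0 $ j" "z \<in> Y" for j l \<tau> z
      using that kk(2)[of j] by (intro score_deriv_zero[OF _ _ \<theta>0 vanish[OF _ _ _ \<theta>0]]) auto
    show "mod_score ell kk v n \<theta>0 z = (\<chi> j. score_deriv j (kk \<theta>0 n j - 1) \<theta>0 z \<bullet> v \<theta>0 n j)"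
      if z: "z \<in> Y" for z
    proof -
      have "mod_score ell kk v n \<theta>0 z $ j = score_deriv j (kk \<theta>0 n j - 1) \<theta>0 z \<bullet> v \<theta>0 n j" for j
      proof -
        have "kk \<theta>0 n j - 1 < K" using kk[of j] by linarith
        then have "score_deriv j (kk \<theta>0 n j - 1) \<theta>0 z =
            (\<Sum>i=1..n. (partial j ^^ (kk \<theta>0 n j - 1)) (\<lambda>t. score_obs ell i t (z i)) \<theta>0)"
          using sum_score_obs_deriv_eq[OF z \<open>\<theta>0 \<in> ball \<theta>0 e\<close>] by simp
        then show ?thesis
          by (simp add: mod_score_def mod_score_obs_def inner_sum_left)
      qed
      then show ?thesis by (simp add: vec_eq_iff)
    qed
    show "invertible (cov_matrix (J \<theta>0) (mod_score ell kk v n \<theta>0))"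
      using pos_definite_invertible[OF pd] by (simp add: mod_information_def)
    show "(\<lambda>m. \<theta>s (m + M)) \<longlonglongrightarrow> \<theta>0" "(\<lambda>m. ys (m + M)) \<longlonglongrightarrow> y"
      using \<theta>s(2) ys(2) by (auto intro: LIMSEQ_ignore_initial_segment)
    show "\<theta>s (m + M) \<in> ball \<theta>0 e" for m by (rule M) simp
  qed (use kk \<theta>s noncrit ys in auto)
  then show ?thesis
    unfolding mod_score_stat_def mod_information_def by (rule LIMSEQ_offset)
qed

text \<open>The order \<open>k \<theta>\<close> of smoothness may jump, so that each level set of \<open>k\<close> is covered separately.\<close>
lemma countable_ball_cover_of_level_sets:
  fixes \<Theta> :: "'a::{metric_space, second_countable_topology} set" and k :: "'a \<Rightarrow> nat"
  assumes "\<And>\<theta>. \<theta> \<in> \<Theta> \<Longrightarrow> 0 < \<rho> \<theta>"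
  shows "\<exists>D\<subseteq>\<Theta>. countable D \<and> (\<forall>\<theta>\<in>\<Theta>. \<exists>c\<in>D. k c = k \<theta> \<and> \<theta> \<in> ball c (\<rho> c))"
proof -
  have "\<exists>D\<subseteq>{\<theta>\<in>\<Theta>. k \<theta> = \<kappa>}. countable D \<and> (\<forall>\<theta>\<in>\<Theta>. k \<theta> = \<kappa> \<longrightarrow> (\<exists>c\<in>D. \<theta> \<in> ball c (\<rho> c)))" for \<kappa>
  proof -
    let ?\<F> = "(\<lambda>c. ball c (\<rho> c)) ` {\<theta>\<in>\<Theta>. k \<theta> = \<kappa>}"
    obtain \<G> where \<G>: "\<G> \<subseteq> ?\<F>" "countable \<G>" "\<Union>\<G> = \<Union>?\<F>"
      using Lindelof[of ?\<F>] by auto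
    then obtain D where D: "countable D" "D \<subseteq> {\<theta>\<in>\<Theta>. k \<theta> = \<kappa>}" "\<G> = (\<lambda>c. ball c (\<rho> c)) ` D"
      using countable_subset_image[of \<G> "\<lambda>c. ball c (\<rho> c)" "{\<theta>\<in>\<Theta>. k \<theta> = \<kappa>}"] by auto
    have "\<exists>c\<in>D. \<theta> \<in> ball c (\<rho> c)" if "\<theta> \<in> \<Theta>" "k \<theta> = \<kappa>" for \<theta>
    proof -
      have "\<theta> \<in> \<Union>?\<F>" using that assms by (auto intro!: exI[of _ \<theta>])
      then show ?thesis using \<G>(3) D(3) by blast
    qed
    then show ?thesis using D by (intro exI[of _ D]) auto
  qed
  then obtain D where D: "\<And>\<kappa>. D \<kappa> \<subseteq> {\<theta>\<in>\<Theta>. k \<theta> = \<kappa>}" "\<And>\<kappa>. countable (D \<kappa>)"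
    "\<And>\<kappa> \<theta>. \<theta> \<in> \<Theta> \<Longrightarrow> k \<theta> = \<kappa> \<Longrightarrow> \<exists>c\<in>D \<kappa>. \<theta> \<in> ball c (\<rho> c)"
    by metis
  show ?thesis
  proof (intro exI[of _ "\<Union>\<kappa>. D \<kappa>"] conjI ballI)
    fix \<theta> assume "\<theta> \<in> \<Theta>"
    then obtain c where "c \<in> D (k \<theta>)" "\<theta> \<in> ball c (\<rho> c)" using D(3) by blast
    then show "\<exists>c\<in>\<Union>\<kappa>. D \<kappa>. k c = k \<theta> \<and> \<theta> \<in> ball c (\<rho> c)" using D(1) by blast
  qed (use D in auto)
qed

text \<open>Each parameter brings its own regularity set, and uncountably many of them cannot be
  intersected. A countable family of balls covers \<open>\<Theta>\<close>, so only the sets of its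
  centres are intersected, and supports are taken inside the result. A point inherits its
  derivatives from a centre with the same order \<open>k\<close>, but keeps its own moment
  bounds.\<close>

lemma regular_points_exist:
  fixes \<Theta> :: "(real ^ 'd) set"
  assumes model: "density_model \<Theta> r \<gamma> f" and null: "common_null_sets \<Theta> \<gamma> f"
    and smooth: "smoothness_and_moments \<Theta> \<gamma> f ell \<rho> k \<delta>" and \<theta>1: "\<theta>1 \<in> \<Theta>"
  shows "\<exists>S. \<forall>\<theta>0\<in>\<Theta>. \<exists>e C. ball \<theta>0 e \<subseteq> ball \<theta>0 (\<rho> \<theta>0) \<and>
    regular_point \<Theta> \<gamma> f ell n S \<theta>0 e (2 + \<delta> \<theta>0) (k \<theta>0) C"
proof -
  have sets_law [simp]: "sets (law \<gamma> f i \<theta>) = sets (\<gamma> i)" "space (law \<gamma> f i \<theta>) = space (\<gamma> i)" for i \<theta>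
    by (simp_all add: law_def)
  define Q where "Q i c Z \<longleftrightarrow> full_measure \<Theta> (law \<gamma> f i) Z \<and>
      (\<forall>\<theta>\<in>ball c (\<rho> c) \<inter> \<Theta>. \<forall>y\<in>Z. 0 < f i \<theta> y \<and> ell i \<theta> y = ln (f i \<theta> y)) \<and>
      (\<forall>js j. length js < k c \<longrightarrow>
        (\<forall>\<theta>\<in>ball c (\<rho> c). \<forall>y\<in>Z. partial_exists j (partials js (\<lambda>t. ell i t y)) \<theta>)) \<and>
      (\<forall>js. 1 \<le> length js \<and> length js \<le> k c \<longrightarrow>
        continuous_on (ball c (\<rho> c) \<times> Z) (\<lambda>(\<theta>, y). partials js (\<lambda>t. ell i t y) \<theta>))" for i c Z
  have sm: "0 < \<rho> c" "2 \<le> k c" "0 < \<delta> c" "\<forall>i\<ge>1. \<exists>Z. Q i c Z"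
    "\<forall>js. length js \<le> k c \<longrightarrow>
      (SUP i\<in>{1..}. SUP \<theta>\<in>ball c (\<rho> c) \<inter> \<Theta>. SUP \<tau>\<in>ball c (\<rho> c).
        \<integral>\<^sup>+ y. ennreal (\<bar>partials js (\<lambda>t. ell i t y) \<tau>\<bar> powr (2 + \<delta> c)) \<partial>law \<gamma> f i \<theta>) < \<infinity>"
    if "c \<in> \<Theta>" for c
    using smooth that unfolding smoothness_and_moments_def Q_def by blast+
  then obtain Z where Z: "\<And>c i. c \<in> \<Theta> \<Longrightarrow> 1 \<le> i \<Longrightarrow> Q i c (Z c i)"
    by metis
  obtain D where D: "D \<subseteq> \<Theta>" "countable D" "\<And>\<theta>. \<theta> \<in> \<Theta> \<Longrightarrow> \<exists>c\<in>D. k c = k \<theta> \<and> \<theta> \<in> ball c (\<rho> c)"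
    using countable_ball_cover_of_level_sets[of \<Theta> \<rho> k] sm(1) by metis
  have sets_\<gamma>: "sets (\<gamma> i) = sets (euclidean_borel (r i))"
    and f_meas: "\<theta> \<in> \<Theta> \<Longrightarrow> f i \<theta> \<in> borel_measurable (\<gamma> i)"
    and f_nonneg: "\<theta> \<in> \<Theta> \<Longrightarrow> y \<in> space (\<gamma> i) \<Longrightarrow> 0 \<le> f i \<theta> y"
    and f_one: "\<theta> \<in> \<Theta> \<Longrightarrow> (\<integral>\<^sup>+ y. ennreal (f i \<theta> y) \<partial>\<gamma> i) = 1"
    if "1 \<le> i" for i \<theta> y
    using model that unfolding density_model_def by blast+
  have prob: "prob_space (law \<gamma> f i \<theta>)" if "1 \<le> i" "\<theta> \<in> \<Theta>" for i \<theta>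
    using f_meas[OF that] f_one[OF that]
    by (intro prob_spaceI) (simp add: law_def emeasure_density cong: nn_integral_cong)
  have ident: "(\<lambda>x. x) \<in> borel_measurable (\<gamma> i)" if "1 \<le> i" for i
    using measurable_ident_euclidean_borel[OF sets_\<gamma>[OF that]] .
  define Y0 where "Y0 i = (\<Inter>c\<in>D. Z c i)" for i
  have Z_sets: "Z c i \<in> sets (\<gamma> i)" and Z_AE: "\<theta> \<in> \<Theta> \<Longrightarrow> AE y in law \<gamma> f i \<theta>. y \<in> Z c i"
    if "c \<in> D" "1 \<le> i" for c i \<theta>
    using Z[of c i] that D(1) \<theta>1 unfolding Q_def full_measure_def by auto
  have Y0_sets: "Y0 i \<in> sets (\<gamma> i)" if "1 \<le> i" for i
    unfolding Y0_def
    using D(2) D(3)[OF \<theta>1] Z_sets[OF _ that] by (intro sets.countable_INT') auto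
  have Y0_AE: "AE y in law \<gamma> f i \<theta>. y \<in> Y0 i" if "1 \<le> i" "\<theta> \<in> \<Theta>" for i \<theta>
  proof -
    have "AE y in law \<gamma> f i \<theta>. \<forall>c\<in>D. y \<in> Z c i"
      using Z_AE that by (intro AE_ball_countable'[OF _ D(2)]) auto
    then show ?thesis
      by (simp add: Y0_def)
  qed
  have "\<exists>S. S \<in> sets (\<gamma> i) \<and> S \<subseteq> Y0 i \<and> Y0 i - S \<in> null_sets (law \<gamma> f i \<theta>1) \<and>
      (\<forall>U. open U \<longrightarrow> U \<inter> S \<noteq> {} \<longrightarrow> U \<inter> S \<notin> null_sets (law \<gamma> f i \<theta>1))" if "1 \<le> i" for i
  proof -
    have "(\<lambda>x. x) \<in> borel_measurable (law \<gamma> f i \<theta>1)"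
      using ident[OF that] by (simp add: law_def)
    from support_within[OF this, of "Y0 i"] show ?thesis
      using Y0_sets[OF that] by auto
  qed
  then obtain S where S: "\<And>i. 1 \<le> i \<Longrightarrow> S i \<in> sets (\<gamma> i)" "\<And>i. 1 \<le> i \<Longrightarrow> S i \<subseteq> Y0 i"
    "\<And>i. 1 \<le> i \<Longrightarrow> Y0 i - S i \<in> null_sets (law \<gamma> f i \<theta>1)"
    "\<And>i U. 1 \<le> i \<Longrightarrow> open U \<Longrightarrow> U \<inter> S i \<noteq> {} \<Longrightarrow> U \<inter> S i \<notin> null_sets (law \<gamma> f i \<theta>1)"
    by metis
  \<comment> \<open>Thus the supports, taken under \<open>\<theta>1\<close>, have full mass and full
    support under every parameter.\<close>
  have null_eq: "null_sets (law \<gamma> f i \<theta>) = null_sets (law \<gamma> f i \<theta>1)" if "1 \<le> i" "\<theta> \<in> \<Theta>" for i \<theta>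
    using null that \<theta>1 unfolding common_null_sets_def by blast
  have S_AE: "AE y in law \<gamma> f i \<theta>. y \<in> S i" if "1 \<le> i" "\<theta> \<in> \<Theta>" for i \<theta>
  proof -
    have "AE y in law \<gamma> f i \<theta>. y \<notin> Y0 i - S i"
      using S(3)[OF that(1)] null_eq[OF that] by (intro AE_not_in) simp
    with Y0_AE[OF that] show ?thesis by eventually_elim auto
  qed
  show ?thesis
  proof (intro exI[of _ S] ballI)
    fix \<theta>0 assume \<theta>0: "\<theta>0 \<in> \<Theta>"
    obtain c where c: "c \<in> D" "k c = k \<theta>0" "\<theta>0 \<in> ball c (\<rho> c)"
      using D(3)[OF \<theta>0] by blast
    have c\<Theta>: "c \<in> \<Theta>" using c(1) D(1) by blast
    have "open (ball c (\<rho> c) \<inter> ball \<theta>0 (\<rho> \<theta>0))" by auto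
    moreover have "\<theta>0 \<in> ball c (\<rho> c) \<inter> ball \<theta>0 (\<rho> \<theta>0)"
      using c(3) sm(1)[OF \<theta>0] by simp
    \<comment> \<open>Both balls matter: regularity comes from the ball of the centre
      \<open>c\<close>, the moment bounds from that of \<open>\<theta>0\<close>.\<close>
    ultimately obtain e where e: "0 < e" "ball \<theta>0 e \<subseteq> ball c (\<rho> c) \<inter> ball \<theta>0 (\<rho> \<theta>0)"
      by (meson openE)
    define C where "C js = (if length js \<le> k \<theta>0 then
        enn2real (SUP i\<in>{1..}. SUP \<theta>\<in>ball \<theta>0 (\<rho> \<theta>0) \<inter> \<Theta>. SUP \<tau>\<in>ball \<theta>0 (\<rho> \<theta>0).
          \<integral>\<^sup>+ y. ennreal (\<bar>partials js (\<lambda>t. ell i t y) \<tau>\<bar> powr (2 + \<delta> \<theta>0)) \<partial>law \<gamma> f i \<theta>) else 0)" for js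
    have SZ: "S i \<subseteq> Z c i" if "1 \<le> i" for i
      using S(2)[OF that] c(1) by (auto simp: Y0_def)
    have "regular_point \<Theta> \<gamma> f ell n S \<theta>0 e (2 + \<delta> \<theta>0) (k \<theta>0) C"
    proof (rule regular_point.intro, goal_cases)
      \<comment> \<open>The numbers follow the order of the locale assumptions: 12 to 15
        (positivity, log-density, derivatives, continuity) are inherited from \<open>c\<close>,
        while 17 (moments) comes from \<open>\<theta>0\<close> itself.\<close>
      case (6 i)
      then show ?case using ident by auto
    next
      case (12 i \<theta> y)
      then have i: "1 \<le> i" by simp
      show ?case
        using Z[OF c\<Theta> i] 12 SZ[OF i] e(2) unfolding Q_def by blast
    next
      case (13 i \<theta> y)
      then have i: "1 \<le> i" by simp
      show ?case
        using Z[OF c\<Theta> i] 13 SZ[OF i] e(2) unfolding Q_def by blast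
    next
      case (14 i js j \<tau> y)
      then have i: "1 \<le> i" by simp
      show ?case
        using Z[OF c\<Theta> i] 14 SZ[OF i] e(2) c(2) unfolding Q_def by (metis Int_iff subsetD)
    next
      case (15 i js)
      then have i: "1 \<le> i" by simp
      have "continuous_on (ball c (\<rho> c) \<times> Z c i) (\<lambda>(\<theta>, y). partials js (\<lambda>t. ell i t y) \<theta>)"
        using Z[OF c\<Theta> i] 15 c(2) unfolding Q_def by metis
      then show ?case
        by (rule continuous_on_subset) (use SZ[OF i] e(2) in auto)
    next
      case (17 i js \<theta> \<tau>)
      let ?I = "\<lambda>i \<theta> \<tau>. \<integral>\<^sup>+ y. ennreal (\<bar>partials js (\<lambda>t. ell i t y) \<tau>\<bar> powr (2 + \<delta> \<theta>0)) \<partial>law \<gamma> f i \<theta>"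
      let ?S = "SUP i\<in>{1..}. SUP \<theta>\<in>ball \<theta>0 (\<rho> \<theta>0) \<inter> \<Theta>. SUP \<tau>\<in>ball \<theta>0 (\<rho> \<theta>0). ?I i \<theta> \<tau>"
      have "?I i \<theta> \<tau> \<le> (SUP \<tau>\<in>ball \<theta>0 (\<rho> \<theta>0). ?I i \<theta> \<tau>)"
        using 17 e(2) by (intro SUP_upper) auto
      also have "\<dots> \<le> (SUP \<theta>\<in>ball \<theta>0 (\<rho> \<theta>0) \<inter> \<Theta>. SUP \<tau>\<in>ball \<theta>0 (\<rho> \<theta>0). ?I i \<theta> \<tau>)"
        using 17 e(2) by (intro SUP_upper) auto
      also have "\<dots> \<le> ?S"
        using 17 by (intro SUP_upper) auto
      also have "\<dots> = ennreal (C js)"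
        using sm(5)[OF \<theta>0] 17 by (simp add: C_def)
      finally show ?case .
    qed (use \<theta>0 e sm[OF \<theta>0] prob S S_AE null_eq f_meas f_nonneg C_def in auto)
    then show "\<exists>e C. ball \<theta>0 e \<subseteq> ball \<theta>0 (\<rho> \<theta>0) \<and>
        regular_point \<Theta> \<gamma> f ell n S \<theta>0 e (2 + \<delta> \<theta>0) (k \<theta>0) C"
      using e(2) by blast
  qed
qed

theorem theorem2p1:
  fixes \<Theta> :: "(real ^ 'd) set"
    and r :: "nat \<Rightarrow> nat"
    and \<gamma> :: "nat \<Rightarrow> obs measure"
    and f ell :: "nat \<Rightarrow> real ^ 'd \<Rightarrow> obs \<Rightarrow> real"
    and \<rho> \<delta> :: "real ^ 'd \<Rightarrow> real"
    and k :: "real ^ 'd \<Rightarrow> nat"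
    and kk :: "real ^ 'd \<Rightarrow> nat \<Rightarrow> 'd \<Rightarrow> nat"
    and v :: "real ^ 'd \<Rightarrow> nat \<Rightarrow> 'd \<Rightarrow> real ^ 'd"
    and n :: nat
  assumes "density_model \<Theta> r \<gamma> f"
    and "common_null_sets \<Theta> \<gamma> f"
    and "smoothness_and_moments \<Theta> \<gamma> f ell \<rho> k \<delta>"
    and "nondegenerate_mod_score \<Theta> \<gamma> f ell \<rho> k kk v"
    and "dense_noncritical \<Theta> \<gamma> f ell"
    and "1 \<le> n"
  shows "\<exists>\<Y>. full_measure \<Theta> (joint_law \<gamma> f n) \<Y> \<and>
           continuous_extension \<Theta> \<gamma> f ell n \<Y> (mod_score_stat \<gamma> f ell kk v n) \<and>
           (\<forall>T. continuous_extension \<Theta> \<gamma> f ell n \<Y> T \<longrightarrow>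
              (\<forall>\<theta>\<in>\<Theta>. \<forall>y\<in>\<Y>. T \<theta> y = mod_score_stat \<gamma> f ell kk v n \<theta> y))"
\<comment> \<open>Without a parameter there is no law in which to take supports, and every claim is
  vacuous.\<close>
proof (cases "\<Theta> = {}")
  case True
  then show ?thesis
    by (auto simp: full_measure_def continuous_extension_def)
next
  case False
  then obtain \<theta>1 where "\<theta>1 \<in> \<Theta>" by blast
  from regular_points_exist[OF assms(1-3) this, of n] obtain S where S: "\<And>\<theta>0. \<theta>0 \<in> \<Theta> \<Longrightarrow>
      \<exists>e C. ball \<theta>0 e \<subseteq> ball \<theta>0 (\<rho> \<theta>0) \<and> regular_point \<Theta> \<gamma> f ell n S \<theta>0 e (2 + \<delta> \<theta>0) (k \<theta>0) C"
    by blast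
  define \<Y> where "\<Y> = Pi\<^sub>E {1..n} S"
  let ?T = "mod_score_stat \<gamma> f ell kk v n" and ?s = "score_stat \<gamma> f ell n"
  have full: "full_measure \<Theta> (joint_law \<gamma> f n) \<Y>"
    unfolding full_measure_def
  proof
    fix \<theta> assume \<theta>: "\<theta> \<in> \<Theta>"
    then obtain e C where "regular_point \<Theta> \<gamma> f ell n S \<theta> e (2 + \<delta> \<theta>) (k \<theta>) C"
      using S by blast
    then interpret regular_point \<Theta> \<gamma> f ell n S \<theta> e "2 + \<delta> \<theta>" "k \<theta>" C .
    show "\<Y> \<in> sets (joint_law \<gamma> f n \<theta>) \<and> (AE y in joint_law \<gamma> f n \<theta>. y \<in> \<Y>)"
      using Y_sets Y_AE[OF \<theta>] by (simp add: \<Y>_def Y_def)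
  qed
  have lim: "(\<lambda>m. ?s (\<theta>s m) (ys m)) \<longlonglongrightarrow> ?T \<theta> y"
    if \<theta>: "\<theta> \<in> \<Theta>" and \<theta>s: "\<And>m. \<theta>s m \<in> \<Theta> \<and> \<not> critical \<gamma> f ell n (\<theta>s m)" "\<theta>s \<longlonglongrightarrow> \<theta>"
      and ys: "\<And>m. ys m \<in> \<Y>" "ys \<longlonglongrightarrow> y" "y \<in> \<Y>" for \<theta> \<theta>s ys y
  proof -
    obtain e C where sub: "ball \<theta> e \<subseteq> ball \<theta> (\<rho> \<theta>)"
      and "regular_point \<Theta> \<gamma> f ell n S \<theta> e (2 + \<delta> \<theta>) (k \<theta>) C"
      using S[OF \<theta>] by blast
    then interpret regular_point \<Theta> \<gamma> f ell n S \<theta> e "2 + \<delta> \<theta>" "k \<theta>" C by simp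
    note nd = assms(4)[unfolded nondegenerate_mod_score_def, rule_format, OF \<theta> assms(6)]
    show ?thesis
    proof (rule score_stat_tendsto_mod_score_stat)
      show "AE y in joint_law \<gamma> f n \<theta>'. (partial j ^^ l) (\<lambda>t. score ell n t y) \<tau> \<bullet> v \<theta> n j = 0"
        if "l + 2 \<le> kk \<theta> n j" "\<tau> \<in> ball \<theta> e" "\<tau> $ j = \<theta> $ j" "\<theta>' \<in> \<Theta>" for j l \<tau> \<theta>'
        using nd that sub by blast
    qed (use nd \<theta>s ys in \<open>auto simp: \<Y>_def Y_def\<close>)
  qed
  have dense: "\<exists>x. (\<forall>m::nat. x m \<in> \<Theta> \<and> \<not> critical \<gamma> f ell n (x m)) \<and> x \<longlonglongrightarrow> \<theta>" if "\<theta> \<in> \<Theta>" for \<theta>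
    using assms(5,6) that unfolding dense_noncritical_def by blast
  have "continuous_on (\<Theta> \<times> \<Y>) (\<lambda>(\<theta>, y). ?T \<theta> y)"
  proof (rule continuous_on_sequentiallyI)
    fix z a assume z: "\<forall>m. z m \<in> \<Theta> \<times> \<Y>" and a: "a \<in> \<Theta> \<times> \<Y>" "z \<longlonglongrightarrow> a"
    have z_lims: "(\<lambda>m. fst (z m)) \<longlonglongrightarrow> fst a" "(\<lambda>m. snd (z m)) \<longlonglongrightarrow> snd a"
      using a(2) by (auto intro: tendsto_fst tendsto_snd)
    \<comment> \<open>The points \<open>z m\<close> may be critical, where \<open>lim\<close> says
      nothing along the sequence. Each parameter is replaced by a non-critical one that is close
      both in position and in the value of the statistic at the same data; \<open>lim\<close> then
      applies to the replacements.\<close>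
    have "\<exists>\<theta>. (\<theta> \<in> \<Theta> \<and> \<not> critical \<gamma> f ell n \<theta>) \<and> dist \<theta> (fst (z m)) < 1 / real (Suc m) \<and>
        dist (?s \<theta> (snd (z m))) (?T (fst (z m)) (snd (z m))) < 1 / real (Suc m)" for m
    proof -
      have zm: "fst (z m) \<in> \<Theta>" "snd (z m) \<in> \<Y>" using z by (auto simp: mem_Times_iff)
      obtain x where x: "\<And>i. x i \<in> \<Theta> \<and> \<not> critical \<gamma> f ell n (x i)" "x \<longlonglongrightarrow> fst (z m)"
        using dense[OF zm(1)] by blast
      have "(\<lambda>i. ?s (x i) (snd (z m))) \<longlonglongrightarrow> ?T (fst (z m)) (snd (z m))"
        using zm by (intro lim x) auto
      then have "\<forall>\<^sub>F i in sequentially. dist (x i) (fst (z m)) < 1 / real (Suc m) \<and>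
          dist (?s (x i) (snd (z m))) (?T (fst (z m)) (snd (z m))) < 1 / real (Suc m)"
        using x(2) by (intro eventually_conj tendstoD) auto
      then obtain i where "dist (x i) (fst (z m)) < 1 / real (Suc m) \<and>
          dist (?s (x i) (snd (z m))) (?T (fst (z m)) (snd (z m))) < 1 / real (Suc m)"
        using eventually_happens' sequentially_bot by blast
      then show ?thesis using x(1) by blast
    qed
    then obtain x where x: "\<And>m. x m \<in> \<Theta> \<and> \<not> critical \<gamma> f ell n (x m)"
      "\<And>m. dist (x m) (fst (z m)) < 1 / real (Suc m)"
      "\<And>m. dist (?s (x m) (snd (z m))) (?T (fst (z m)) (snd (z m))) < 1 / real (Suc m)"
      by metis
    have null: "(\<lambda>m. 1 / real (Suc m)) \<longlonglongrightarrow> 0"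
      by (rule LIMSEQ_Suc[OF lim_1_over_n])
    have "(\<lambda>m. x m - fst (z m)) \<longlonglongrightarrow> 0"
      by (rule Lim_null_comparison[OF _ null])
        (use x(2) in \<open>auto simp: dist_norm less_imp_le simp del: of_nat_Suc\<close>)
    from tendsto_add[OF this z_lims(1)] have "x \<longlonglongrightarrow> fst a" by simp
    then have "(\<lambda>m. ?s (x m) (snd (z m))) \<longlonglongrightarrow> ?T (fst a) (snd a)"
      using z a x(1) z_lims(2) by (intro lim) (auto simp: mem_Times_iff)
    moreover have "(\<lambda>m. ?T (fst (z m)) (snd (z m)) - ?s (x m) (snd (z m))) \<longlonglongrightarrow> 0"
      by (rule Lim_null_comparison[OF _ null])
        (use x(3) in \<open>auto simp: dist_norm norm_minus_commute abs_minus_commute less_imp_le simp del: of_nat_Suc\<close>)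
    ultimately have "(\<lambda>m. (?T (fst (z m)) (snd (z m)) - ?s (x m) (snd (z m))) + ?s (x m) (snd (z m)))
        \<longlonglongrightarrow> 0 + ?T (fst a) (snd a)"
      by (intro tendsto_add)
    then show "(\<lambda>m. case z m of (\<theta>, y) \<Rightarrow> ?T \<theta> y) \<longlonglongrightarrow> (case a of (\<theta>, y) \<Rightarrow> ?T \<theta> y)"
      by (simp add: case_prod_unfold)
  qed
  \<comment> \<open>At a non-critical point the constant sequence is admissible, and its limit is
    both values.\<close>
  moreover have "?T \<theta> y = ?s \<theta> y" if "\<theta> \<in> \<Theta>" "\<not> critical \<gamma> f ell n \<theta>" "y \<in> \<Y>" for \<theta> y
    using lim[of \<theta> "\<lambda>_. \<theta>" "\<lambda>_. y" y] that LIMSEQ_unique[OF tendsto_const] by fastforce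
  ultimately have ext: "continuous_extension \<Theta> \<gamma> f ell n \<Y> ?T"
    by (simp add: continuous_extension_def)
  \<comment> \<open>With \<open>y\<close> fixed, both extensions follow the same statistic along
    non-critical parameters.\<close>
  have "T \<theta> y = ?T \<theta> y" if T: "continuous_extension \<Theta> \<gamma> f ell n \<Y> T" and \<theta>: "\<theta> \<in> \<Theta>" and y: "y \<in> \<Y>" for T \<theta> y
  proof -
    obtain x where x: "\<And>i. x i \<in> \<Theta> \<and> \<not> critical \<gamma> f ell n (x i)" "x \<longlonglongrightarrow> \<theta>"
      using dense[OF \<theta>] by blast
    have "(\<lambda>i. (\<lambda>(\<theta>, y). T \<theta> y) (x i, y)) \<longlonglongrightarrow> (\<lambda>(\<theta>, y). T \<theta> y) (\<theta>, y)"
    proof (rule continuous_on_tendsto_compose[where f = "\<lambda>(\<theta>, y). T \<theta> y" and s = "\<Theta> \<times> \<Y>"])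
      show "continuous_on (\<Theta> \<times> \<Y>) (\<lambda>(\<theta>, y). T \<theta> y)"
        using T by (simp add: continuous_extension_def)
      show "(\<lambda>i. (x i, y)) \<longlonglongrightarrow> (\<theta>, y)"
        by (intro tendsto_Pair x tendsto_const)
    qed (use \<theta> y x in auto)
    moreover have "T (x i) y = ?s (x i) y" for i
      using T x(1) y by (simp add: continuous_extension_def)
    ultimately have "(\<lambda>i. ?s (x i) y) \<longlonglongrightarrow> T \<theta> y" by simp
    moreover have "(\<lambda>i. ?s (x i) y) \<longlonglongrightarrow> ?T \<theta> y"
      using \<theta> y by (intro lim x) auto
    ultimately show ?thesis by (rule LIMSEQ_unique)
  qed
  then show ?thesis
    using full ext by blast
qed

end
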